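(* (Relativised Dependent Choices.) In the v-set interpretation: let $\phi(x)$ be a formula of first-order set theory and $\psi(x,y)$ an arbitrary binary relation on v-sets (any formula of the ambient system). If for every set $x$ with $\phi(x)$ there is a set $y$ with $\phi(y)$ and $\psi(x,y)$, then for every set $x$ with $\phi(x)$ there is a set $f$ which is a function with domain $\omega$ such that $f(0)\simeq x$ and, for every $n\in\omega$, $\phi(f(n))$ and $\psi(f(n),f(n+1))$.
   Context: Work in Heyting arithmetic extended by unary predicates $\mathcal V$ ("v-set"), $\mathcal M$ ("Meaningful condition"), $\mathcal T$ ("True condition"). $\langle\cdot,\cdot\rangle$ is Cantor pairing with projections $(\cdot)_L,(\cdot)_R$; $en$ is Kleene application, $en\!\downarrow$ means it is defined. Write $\mathrm{cd}_x(n)=(xn)_R$, $\mathrm{el}_x(n)=(xn)_L$. $\Xi(f,g)$ is a fixed primitive recursive injective coding of pairs. Axioms: (V1) $\forall x\,[\forall n\,(xn\!\downarrow\wedge\mathcal M(\mathrm{cd}_x(n))\wedge(\mathcal T(\mathrm{cd}_x(n))\to\mathcal V(\mathrm{el}_x(n))))]\to\mathcal V(x)$; (V2) for every formula $\phi$: if the antecedent of (V1) with $\mathcal V$ replaced by $\phi$ implies $\phi(x)$ for all $x$, then $\forall x(\mathcal V(x)\to\phi(x))$; (X1) $\mathcal M(\Xi(f,g))\to(\mathcal T(\Xi(f,g))\leftrightarrow\forall n(fn\!\downarrow\wedge\mathcal T(fn)\to gn\!\downarrow\wedge\mathcal T(gn)))$; (X2) if $\forall n(fn\!\downarrow\to\mathcal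 M(fn))$ and $\forall n(fn\!\downarrow\wedge gn\!\downarrow\wedge\mathcal T(fn)\to\mathcal M(gn))$ then $\mathcal M(\Xi(f,g))$; ($\mathsf{ECT}_V$) $(\forall n(\phi(n)\to\exists m\,\psi(n,m)))\to\exists e\,\forall n(\phi(n)\to en\!\downarrow\wedge\psi(n,en))$ for arbitrary $\psi$ and almost-negative $\phi$ (built from $\Sigma_1$ formulas and atoms $\mathcal V(t),\mathcal M(t),\mathcal T(t)$ by $\wedge,\to,\forall_{\mathbb N}$). Sets are interpreted as v-sets (numbers $x$ with $\mathcal V(x)$); $EL(x)=\{\mathrm{el}_x(n):\mathcal T(\mathrm{cd}_x(n))\}$. Set equality is extensional equality $\simeq$ of v-sets, characterized by $x\simeq y\iff(\forall a\in EL(x)\exists b\in EL(y)\,a\simeq b)\wedge(\forall b\in EL(y)\exists a\in EL(x)\,b\simeq a)$. Unbounded set quantifiers range over v-sets, bounded quantifiers range over $EL(x)$, and $x\in y$ means $\exists y'\in EL(y)\,x\simeq y'$. A set-theoretic statement holds in the v-set interpretation if its interpretation is provable in this system. *)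

theory Defs
  imports "HOL-Library.Nat_Bijection"
begin

section \<open>Primitive recursive function symbols\<close>

datatype prim =
    Zr
  | Sc
  | Pj nat
  | Cn prim "prim list"
  | Pr prim prim

fun has_arity :: "nat \<Rightarrow> prim \<Rightarrow> bool" where
  "has_arity n Zr = True"
| "has_arity n Sc = (n = 1)"
| "has_arity n (Pj i) = (i < n)"
| "has_arity n (Cn f gs) = (has_arity (length gs) f \<and> (\<forall>g\<in>set gs. has_arity n g))"
| "has_arity n (Pr f g) = (n \<noteq> 0 \<and> has_arity (n - 1) f \<and> has_arity (n + 1) g)"

text \<open>The value on argument lists of the wrong length is irrelevant. The recursion argument
  comes first.\<close>

primrec prim_eval :: "prim \<Rightarrow> nat list \<Rightarrow> nat" where
  "prim_eval Zr xs = 0"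
| "prim_eval Sc xs = Suc (hd xs)"
| "prim_eval (Pj i) xs = xs ! i"
| "prim_eval (Cn f gs) xs = prim_eval f (map (\<lambda>g. prim_eval g xs) gs)"
| "prim_eval (Pr f g) xs =
     rec_nat (prim_eval f (tl xs)) (\<lambda>n r. prim_eval g (n # r # tl xs)) (hd xs)"

definition pAdd :: prim where "pAdd = Pr (Pj 0) (Cn Sc [Pj 1])"
definition pPred :: prim where "pPred = Pr Zr (Pj 0)"
definition pMonus :: prim where "pMonus = Cn (Pr (Pj 0) (Cn pPred [Pj 1])) [Pj 1, Pj 0]"
definition pTri :: prim where "pTri = Pr Zr (Cn pAdd [Cn Sc [Pj 0], Pj 1])"
definition pIfz :: prim where "pIfz = Pr (Pj 0) (Pj 3)"

text \<open>Cantor pairing and its projections; \<open>pDiag n\<close> is the number of the diagonal that contains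
  \<open>n\<close>, the greatest \<open>d\<close> with \<open>triangle d \<le> n\<close>.\<close>

definition pPair :: prim where "pPair = Cn pAdd [Cn pTri [Cn pAdd [Pj 0, Pj 1]], Pj 0]"
definition pDiag :: prim where
  "pDiag = Pr Zr (Cn pIfz [Cn pMonus [Cn pTri [Cn Sc [Pj 1]], Cn Sc [Pj 0]], Cn Sc [Pj 1], Pj 1])"
definition pLeft :: prim where "pLeft = Cn pMonus [Pj 0, Cn pTri [pDiag]]"
definition pRight :: prim where "pRight = Cn pMonus [pDiag, pLeft]"

lemma prim_eval_pAdd: "prim_eval pAdd [x, y] = x + y"
  by (induction x) (simp_all add: pAdd_def)

lemma prim_eval_pPred: "prim_eval pPred [x] = x - 1"
  by (cases x) (simp_all add: pPred_def)

lemma prim_eval_pMonus: "prim_eval pMonus [x, y] = x - y"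
proof -
  have "rec_nat x (\<lambda>n r. prim_eval pPred [r]) y = x - y"
    by (induction y) (simp_all add: prim_eval_pPred)
  then show ?thesis by (simp add: pMonus_def)
qed

lemma prim_eval_pTri: "prim_eval pTri [x] = triangle x"
  by (induction x) (simp_all add: pTri_def prim_eval_pAdd)

lemma prim_eval_pIfz: "prim_eval pIfz [x, y, z] = (if x = 0 then y else z)"
  by (cases x) (simp_all add: pIfz_def)

lemma prim_eval_pPair: "prim_eval pPair [x, y] = prod_encode (x, y)"
  by (simp add: pPair_def prim_eval_pAdd prim_eval_pTri prod_encode_def)

lemma prim_eval_pDiag:
  "triangle (prim_eval pDiag [x]) \<le> x \<and> x < triangle (Suc (prim_eval pDiag [x]))"
proof (induction x)
  case 0
  then show ?case by (simp add: pDiag_def)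
next
  case (Suc x)
  have "prim_eval pDiag [Suc x] = (let d = prim_eval pDiag [x] in
      if triangle (Suc d) \<le> Suc x then Suc d else d)"
    by (simp add: pDiag_def prim_eval_pIfz prim_eval_pMonus prim_eval_pTri Let_def)
  with Suc show ?case by (auto simp: Let_def)
qed

lemma prim_eval_pDiag_pair: "prim_eval pDiag [prod_encode (x, y)] = x + y"
proof -
  let ?d = "prim_eval pDiag [prod_encode (x, y)]"
  have mono: "triangle a \<le> triangle b" if "a \<le> b" for a b
    using that by (induction rule: dec_induct) auto
  have *: "triangle ?d \<le> triangle (x + y) + x" "triangle (x + y) + x < triangle (Suc ?d)"
    using prim_eval_pDiag[of "prod_encode (x, y)"] by (simp_all add: prod_encode_def)
  have "\<not> ?d < x + y"
    using mono[of "Suc ?d" "x + y"] * by force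
  moreover have "\<not> x + y < ?d"
    using mono[of "Suc (x + y)" ?d] * by force
  ultimately show ?thesis by simp
qed

lemma prim_eval_pLeft: "prim_eval pLeft [prod_encode (x, y)] = x"
proof -
  have "prim_eval pLeft [prod_encode (x, y)] = prod_encode (x, y) - triangle (x + y)"
    by (simp add: pLeft_def prim_eval_pMonus prim_eval_pTri prim_eval_pDiag_pair)
  then show ?thesis by (simp add: prod_encode_def)
qed

lemma prim_eval_pRight: "prim_eval pRight [prod_encode (x, y)] = y"
  by (simp add: pRight_def prim_eval_pMonus prim_eval_pDiag_pair prim_eval_pLeft)

section \<open>Kleene application\<close>

text \<open>
  Indices of the partial recursive functions, as unary functions on Cantor-coded tuples:

  \<^item> \<open>\<langle>0, _\<rangle>\<close> is \<open>n \<mapsto> 0\<close>, \<open>\<langle>1, _\<rangle>\<close> is \<open>n \<mapsto> n + 1\<close>, \<open>\<langle>2, _\<rangle>\<close> and \<open>\<langle>3, _\<rangle>\<close> are the projections;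
  \<^item> \<open>\<langle>4, \<langle>a, b\<rangle>\<rangle>\<close> is \<open>n \<mapsto> \<langle>a n, b n\<rangle>\<close> and \<open>\<langle>5, \<langle>a, b\<rangle>\<rangle>\<close> is \<open>n \<mapsto> a (b n)\<close>;
  \<^item> \<open>e = \<langle>6, \<langle>a, b\<rangle>\<rangle>\<close> is primitive recursion:
    \<open>e \<langle>0, n\<rangle> = a n\<close> and \<open>e \<langle>k + 1, n\<rangle> = b \<langle>k, \<langle>e \<langle>k, n\<rangle>, n\<rangle>\<rangle>\<close>;
  \<^item> \<open>\<langle>7, a\<rangle>\<close> is minimisation: \<open>n \<mapsto> \<mu>k. a \<langle>k, n\<rangle> = 0\<close>;
  \<^item> every other number is an index of the empty function.

  They are executed by a machine with configurations \<open>\<langle>0, \<langle>e, \<langle>n, s\<rangle>\<rangle>\<rangle>\<close> (apply \<open>e\<close> to \<open>n\<close>, then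
  proceed with the stack \<open>s\<close>) and \<open>\<langle>1, \<langle>v, s\<rangle>\<rangle>\<close> (return \<open>v\<close> to the stack \<open>s\<close>). The empty stack is
  \<open>0\<close>, and \<open>\<langle>frame, s\<rangle> + 1\<close> is a nonempty one. The configuration \<open>\<langle>1, \<langle>v, 0\<rangle>\<rangle>\<close> is final and is a
  fixed point of the step function. The functions below build symbols of the arity of their
  arguments.
\<close>

primrec cnst :: "nat \<Rightarrow> prim" where
  "cnst 0 = Zr"
| "cnst (Suc k) = Cn Sc [cnst k]"

abbreviation suc' :: "prim \<Rightarrow> prim" where "suc' f \<equiv> Cn Sc [f]"
abbreviation pred' :: "prim \<Rightarrow> prim" where "pred' f \<equiv> Cn pPred [f]"
abbreviation left' :: "prim \<Rightarrow> prim" where "left' f \<equiv> Cn pLeft [f]"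
abbreviation right' :: "prim \<Rightarrow> prim" where "right' f \<equiv> Cn pRight [f]"
abbreviation pair' :: "prim \<Rightarrow> prim \<Rightarrow> prim" where "pair' f g \<equiv> Cn pPair [f, g]"
abbreviation ifz' :: "prim \<Rightarrow> prim \<Rightarrow> prim \<Rightarrow> prim" where "ifz' f g h \<equiv> Cn pIfz [f, g, h]"

primrec switch' :: "prim \<Rightarrow> prim list \<Rightarrow> prim \<Rightarrow> prim" where
  "switch' f [] d = d"
| "switch' f (g # gs) d = ifz' f g (switch' (pred' f) gs d)"

definition call' :: "prim \<Rightarrow> prim \<Rightarrow> prim \<Rightarrow> prim" where
  "call' e n s = pair' (cnst 0) (pair' e (pair' n s))"

definition ret' :: "prim \<Rightarrow> prim \<Rightarrow> prim" where
  "ret' v s = pair' (cnst 1) (pair' v s)"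

definition push' :: "nat \<Rightarrow> prim \<Rightarrow> prim \<Rightarrow> prim" where
  "push' tag f s = suc' (pair' (pair' (cnst tag) f) s)"

definition pCallStep :: prim where
  "pCallStep = (let c = Pj 0;
      e = left' (right' c); n = left' (right' (right' c)); s = right' (right' (right' c));
      a = left' (right' e); b = right' (right' e); m = right' e
    in switch' (left' e)
      [ret' (cnst 0) s,
       ret' (suc' n) s,
       ret' (left' n) s,
       ret' (right' n) s,
       call' a n (push' 0 (pair' b n) s),
       call' b n (push' 2 a s),
       ifz' (left' n)
         (call' a (right' n) s)
         (let q = pair' (pred' (left' n)) (right' n) in call' e q (push' 3 (pair' b q) s)),
       (let q = pair' (cnst 0) n in call' m q (push' 4 (pair' m q) s))]
      c)"

definition pRetStep :: prim where
  "pRetStep = (let c = Pj 0;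
      v = left' (right' c); stk = right' (right' c);
      fr = left' (pred' stk); s = right' (pred' stk); x = right' fr;
      k = left' (right' x); n = right' (right' x)
    in ifz' stk c (switch' (left' fr)
      [call' (left' x) (right' x) (push' 1 v s),
       ret' (pair' x v) s,
       call' x v s,
       call' (left' x) (pair' k (pair' v n)) s,
       ifz' v (ret' k s)
         (let q = pair' (suc' k) n in call' (left' x) q (push' 4 (pair' (left' x) q) s))]
      c))"

definition pStep :: prim where
  "pStep = switch' (left' (Pj 0)) [pCallStep, pRetStep] (Pj 0)"

text \<open>\<open>pRun\<close> takes the number of steps, the index and the argument.\<close>

definition pRun :: prim where
  "pRun = Pr (call' (Pj 0) (Pj 1) (cnst 0)) (Cn pStep [Pj 1])"

definition pFinal :: prim where
  "pFinal = ret' (Pj 0) (cnst 0)"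

section \<open>Terms and formulas of the ambient system\<close>

text \<open>De Bruijn indices are used throughout.\<close>

datatype tm =
    Var nat
  | Zero
  | Succ tm
  | Fn prim "tm list"

datatype fm =
    Fls
  | Eq tm tm (infix \<open>\<^bold>=\<close> 70)
  | VS tm
  | MC tm
  | TC tm
  | Conj fm fm (infixr \<open>\<^bold>\<and>\<close> 64)
  | Disj fm fm (infixr \<open>\<^bold>\<or>\<close> 62)
  | Impl fm fm (infixr \<open>\<^bold>\<longrightarrow>\<close> 60)
  | Uni fm (\<open>\<^bold>\<forall>_\<close> [66] 66)
  | Exi fm (\<open>\<^bold>\<exists>_\<close> [66] 66)

abbreviation Iff :: "fm \<Rightarrow> fm \<Rightarrow> fm" (infix \<open>\<^bold>\<longleftrightarrow>\<close> 58) where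
  "a \<^bold>\<longleftrightarrow> b \<equiv> (a \<^bold>\<longrightarrow> b) \<^bold>\<and> (b \<^bold>\<longrightarrow> a)"

primrec subst_tm :: "(nat \<Rightarrow> tm) \<Rightarrow> tm \<Rightarrow> tm" where
  "subst_tm \<sigma> (Var i) = \<sigma> i"
| "subst_tm \<sigma> Zero = Zero"
| "subst_tm \<sigma> (Succ t) = Succ (subst_tm \<sigma> t)"
| "subst_tm \<sigma> (Fn f ts) = Fn f (map (subst_tm \<sigma>) ts)"

abbreviation lift_tm :: "tm \<Rightarrow> tm" where
  "lift_tm \<equiv> subst_tm (\<lambda>i. Var (Suc i))"

definition up :: "(nat \<Rightarrow> tm) \<Rightarrow> nat \<Rightarrow> tm" where
  "up \<sigma> = case_nat (Var 0) (\<lambda>i. lift_tm (\<sigma> i))"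

primrec subst_fm :: "(nat \<Rightarrow> tm) \<Rightarrow> fm \<Rightarrow> fm" where
  "subst_fm \<sigma> Fls = Fls"
| "subst_fm \<sigma> (t \<^bold>= u) = (subst_tm \<sigma> t \<^bold>= subst_tm \<sigma> u)"
| "subst_fm \<sigma> (VS t) = VS (subst_tm \<sigma> t)"
| "subst_fm \<sigma> (MC t) = MC (subst_tm \<sigma> t)"
| "subst_fm \<sigma> (TC t) = TC (subst_tm \<sigma> t)"
| "subst_fm \<sigma> (a \<^bold>\<and> b) = (subst_fm \<sigma> a \<^bold>\<and> subst_fm \<sigma> b)"
| "subst_fm \<sigma> (a \<^bold>\<or> b) = (subst_fm \<sigma> a \<^bold>\<or> subst_fm \<sigma> b)"
| "subst_fm \<sigma> (a \<^bold>\<longrightarrow> b) = (subst_fm \<sigma> a \<^bold>\<longrightarrow> subst_fm \<sigma> b)"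
| "subst_fm \<sigma> (Uni a) = Uni (subst_fm (up \<sigma>) a)"
| "subst_fm \<sigma> (Exi a) = Exi (subst_fm (up \<sigma>) a)"

abbreviation lift_fm :: "fm \<Rightarrow> fm" where
  "lift_fm \<equiv> subst_fm (\<lambda>i. Var (Suc i))"

text \<open>\<open>sub ts d a\<close> replaces the variables \<open>0, 1, \<dots>\<close> of \<open>a\<close> by the terms \<open>ts\<close>; the remaining free
  variables are the parameters of \<open>a\<close>, and they are made to refer across \<open>d\<close> binders.\<close>

definition sub :: "tm list \<Rightarrow> nat \<Rightarrow> fm \<Rightarrow> fm" where
  "sub ts d = subst_fm (\<lambda>i. if i < length ts then ts ! i else Var (i - length ts + d))"

primrec fv_tm :: "tm \<Rightarrow> nat set" where
  "fv_tm (Var i) = {i}"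
| "fv_tm Zero = {}"
| "fv_tm (Succ t) = fv_tm t"
| "fv_tm (Fn f ts) = \<Union> (set (map fv_tm ts))"

primrec fv_fm :: "fm \<Rightarrow> nat set" where
  "fv_fm Fls = {}"
| "fv_fm (t \<^bold>= u) = fv_tm t \<union> fv_tm u"
| "fv_fm (VS t) = fv_tm t"
| "fv_fm (MC t) = fv_tm t"
| "fv_fm (TC t) = fv_tm t"
| "fv_fm (a \<^bold>\<and> b) = fv_fm a \<union> fv_fm b"
| "fv_fm (a \<^bold>\<or> b) = fv_fm a \<union> fv_fm b"
| "fv_fm (a \<^bold>\<longrightarrow> b) = fv_fm a \<union> fv_fm b"
| "fv_fm (Uni a) = {i. Suc i \<in> fv_fm a}"
| "fv_fm (Exi a) = {i. Suc i \<in> fv_fm a}"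

abbreviation Lft :: "tm \<Rightarrow> tm" where "Lft t \<equiv> Fn pLeft [t]"
abbreviation Rgt :: "tm \<Rightarrow> tm" where "Rgt t \<equiv> Fn pRight [t]"

text \<open>\<open>App e n m\<close> states that \<open>e n\<close> is defined and equal to \<open>m\<close>. A partial term \<open>e n\<close> occurring in
  an assertion is expressed through a bound variable \<open>m\<close> with \<open>App e n m\<close>.\<close>

definition App :: "tm \<Rightarrow> tm \<Rightarrow> tm \<Rightarrow> fm" where
  "App e n m = \<^bold>\<exists> (Fn pRun [Var 0, lift_tm e, lift_tm n] \<^bold>= Fn pFinal [lift_tm m])"

section \<open>The axioms\<close>

text \<open>Every primitive recursive predicate is given by an equation, so quantifier-free matrices
  suffice for \<open>\<Sigma>\<^sub>1\<close> formulas.\<close>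

inductive qfree :: "fm \<Rightarrow> bool" where
  "qfree Fls"
| "qfree (t \<^bold>= u)"
| "qfree a \<Longrightarrow> qfree b \<Longrightarrow> qfree (a \<^bold>\<and> b)"
| "qfree a \<Longrightarrow> qfree b \<Longrightarrow> qfree (a \<^bold>\<or> b)"
| "qfree a \<Longrightarrow> qfree b \<Longrightarrow> qfree (a \<^bold>\<longrightarrow> b)"

inductive sigma1 :: "fm \<Rightarrow> bool" where
  "qfree a \<Longrightarrow> sigma1 a"
| "sigma1 a \<Longrightarrow> sigma1 (Exi a)"

inductive almost_neg :: "fm \<Rightarrow> bool" where
  "sigma1 a \<Longrightarrow> almost_neg a"
| "almost_neg (VS t)"
| "almost_neg (MC t)"
| "almost_neg (TC t)"
| "almost_neg a \<Longrightarrow> almost_neg b \<Longrightarrow> almost_neg (a \<^bold>\<and> b)"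
| "almost_neg a \<Longrightarrow> almost_neg b \<Longrightarrow> almost_neg (a \<^bold>\<longrightarrow> b)"
| "almost_neg a \<Longrightarrow> almost_neg (Uni a)"

text \<open>\<open>Cl a\<close> is the antecedent of V1 for \<open>x = Var 0\<close>, with the formula \<open>a\<close> (in the
  variable \<open>0\<close>) in place of \<open>VS\<close>.\<close>

definition Cl :: "fm \<Rightarrow> fm" where
  "Cl a = \<^bold>\<forall> \<^bold>\<exists> (App (Var 2) (Var 1) (Var 0) \<^bold>\<and> MC (Rgt (Var 0)) \<^bold>\<and>
                    (TC (Rgt (Var 0)) \<^bold>\<longrightarrow> sub [Lft (Var 0)] 3 a))"

text \<open>The parameter \<open>\<xi>\<close> is the function symbol for the coding \<open>\<Xi>\<close>. In \<open>ECT\<close>, \<open>n\<close> is the variable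
  \<open>0\<close> of \<open>a\<close>, and \<open>m\<close>, \<open>n\<close> are the variables \<open>0\<close>, \<open>1\<close> of \<open>b\<close>.\<close>

inductive axm :: "prim \<Rightarrow> fm \<Rightarrow> bool" for \<xi> :: prim where
  Succ_Zero: "axm \<xi> (Succ t \<^bold>= Zero \<^bold>\<longrightarrow> Fls)"
| Succ_inj: "axm \<xi> (Succ t \<^bold>= Succ u \<^bold>\<longrightarrow> t \<^bold>= u)"
| Zr: "axm \<xi> (Fn Zr ts \<^bold>= Zero)"
| Sc: "axm \<xi> (Fn Sc [t] \<^bold>= Succ t)"
| Pj: "i < length ts \<Longrightarrow> axm \<xi> (Fn (Pj i) ts \<^bold>= ts ! i)"
| Cn: "axm \<xi> (Fn (Cn f gs) ts \<^bold>= Fn f (map (\<lambda>g. Fn g ts) gs))"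
| Pr_Zero: "axm \<xi> (Fn (Pr f g) (Zero # ts) \<^bold>= Fn f ts)"
| Pr_Succ: "axm \<xi> (Fn (Pr f g) (Succ t # ts) \<^bold>= Fn g (t # Fn (Pr f g) (t # ts) # ts))"
| Ind: "axm \<xi> (sub [Zero] 0 a \<^bold>\<longrightarrow> \<^bold>\<forall> (a \<^bold>\<longrightarrow> sub [Succ (Var 0)] 1 a) \<^bold>\<longrightarrow> \<^bold>\<forall> a)"
| V1: "axm \<xi> (\<^bold>\<forall> (Cl (VS (Var 0)) \<^bold>\<longrightarrow> VS (Var 0)))"
| V2: "axm \<xi> (\<^bold>\<forall> (Cl a \<^bold>\<longrightarrow> a) \<^bold>\<longrightarrow> \<^bold>\<forall> (VS (Var 0) \<^bold>\<longrightarrow> a))"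
| X1: "axm \<xi> (\<^bold>\<forall> \<^bold>\<forall> (MC (Fn \<xi> [Var 1, Var 0]) \<^bold>\<longrightarrow>
        (TC (Fn \<xi> [Var 1, Var 0]) \<^bold>\<longleftrightarrow>
          \<^bold>\<forall> (\<^bold>\<exists> (App (Var 3) (Var 1) (Var 0) \<^bold>\<and> TC (Var 0)) \<^bold>\<longrightarrow>
             \<^bold>\<exists> (App (Var 2) (Var 1) (Var 0) \<^bold>\<and> TC (Var 0))))))"
| X2: "axm \<xi> (\<^bold>\<forall> \<^bold>\<forall> (\<^bold>\<forall> \<^bold>\<forall> (App (Var 3) (Var 1) (Var 0) \<^bold>\<longrightarrow> MC (Var 0)) \<^bold>\<longrightarrow>
        \<^bold>\<forall> \<^bold>\<forall> \<^bold>\<forall> (App (Var 4) (Var 2) (Var 1) \<^bold>\<and> App (Var 3) (Var 2) (Var 0) \<^bold>\<and> TC (Var 1)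
            \<^bold>\<longrightarrow> MC (Var 0)) \<^bold>\<longrightarrow>
        MC (Fn \<xi> [Var 1, Var 0])))"
| ECT: "almost_neg a \<Longrightarrow>
    axm \<xi> (\<^bold>\<forall> (a \<^bold>\<longrightarrow> \<^bold>\<exists> b) \<^bold>\<longrightarrow>
      \<^bold>\<exists> \<^bold>\<forall> (sub [Var 0] 2 a \<^bold>\<longrightarrow> \<^bold>\<exists> (App (Var 2) (Var 1) (Var 0) \<^bold>\<and> sub [Var 0, Var 1] 3 b)))"

section \<open>Intuitionistic provability\<close>

inductive prv :: "prim \<Rightarrow> fm set \<Rightarrow> fm \<Rightarrow> bool" for \<xi> :: prim where
  Axm: "axm \<xi> a \<Longrightarrow> prv \<xi> \<Gamma> a"
| Hyp: "a \<in> \<Gamma> \<Longrightarrow> prv \<xi> \<Gamma> a"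
| FlsE: "prv \<xi> \<Gamma> Fls \<Longrightarrow> prv \<xi> \<Gamma> a"
| ConjI: "prv \<xi> \<Gamma> a \<Longrightarrow> prv \<xi> \<Gamma> b \<Longrightarrow> prv \<xi> \<Gamma> (a \<^bold>\<and> b)"
| ConjE1: "prv \<xi> \<Gamma> (a \<^bold>\<and> b) \<Longrightarrow> prv \<xi> \<Gamma> a"
| ConjE2: "prv \<xi> \<Gamma> (a \<^bold>\<and> b) \<Longrightarrow> prv \<xi> \<Gamma> b"
| DisjI1: "prv \<xi> \<Gamma> a \<Longrightarrow> prv \<xi> \<Gamma> (a \<^bold>\<or> b)"
| DisjI2: "prv \<xi> \<Gamma> b \<Longrightarrow> prv \<xi> \<Gamma> (a \<^bold>\<or> b)"
| DisjE: "prv \<xi> \<Gamma> (a \<^bold>\<or> b) \<Longrightarrow> prv \<xi> (insert a \<Gamma>) c \<Longrightarrow> prv \<xi> (insert b \<Gamma>) c \<Longrightarrow> prv \<xi> \<Gamma> c"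
| ImplI: "prv \<xi> (insert a \<Gamma>) b \<Longrightarrow> prv \<xi> \<Gamma> (a \<^bold>\<longrightarrow> b)"
| ImplE: "prv \<xi> \<Gamma> (a \<^bold>\<longrightarrow> b) \<Longrightarrow> prv \<xi> \<Gamma> a \<Longrightarrow> prv \<xi> \<Gamma> b"
| AllI: "prv \<xi> (lift_fm ` \<Gamma>) a \<Longrightarrow> prv \<xi> \<Gamma> (Uni a)"
| AllE: "prv \<xi> \<Gamma> (Uni a) \<Longrightarrow> prv \<xi> \<Gamma> (sub [t] 0 a)"
| ExiI: "prv \<xi> \<Gamma> (sub [t] 0 a) \<Longrightarrow> prv \<xi> \<Gamma> (Exi a)"
| ExiE: "prv \<xi> \<Gamma> (Exi a) \<Longrightarrow> prv \<xi> (insert a (lift_fm ` \<Gamma>)) (lift_fm c) \<Longrightarrow> prv \<xi> \<Gamma> c"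
| EqI: "prv \<xi> \<Gamma> (t \<^bold>= t)"
| EqE: "prv \<xi> \<Gamma> (t \<^bold>= u) \<Longrightarrow> prv \<xi> \<Gamma> (sub [t] 0 a) \<Longrightarrow> prv \<xi> \<Gamma> (sub [u] 0 a)"

section \<open>The v-set interpretation of set theory\<close>

text \<open>The bound variable of a bounded quantifier is \<open>0\<close>; the index naming the bounding set is read
  outside the quantifier.\<close>

datatype sfm =
    SFls
  | SEq nat nat
  | SMem nat nat
  | SConj sfm sfm
  | SDisj sfm sfm
  | SImpl sfm sfm
  | SAll sfm
  | SExi sfm
  | SBAll nat sfm
  | SBExi nat sfm

primrec fv_sfm :: "sfm \<Rightarrow> nat set" where
  "fv_sfm SFls = {}"
| "fv_sfm (SEq i j) = {i, j}"
| "fv_sfm (SMem i j) = {i, j}"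
| "fv_sfm (SConj a b) = fv_sfm a \<union> fv_sfm b"
| "fv_sfm (SDisj a b) = fv_sfm a \<union> fv_sfm b"
| "fv_sfm (SImpl a b) = fv_sfm a \<union> fv_sfm b"
| "fv_sfm (SAll a) = {i. Suc i \<in> fv_sfm a}"
| "fv_sfm (SExi a) = {i. Suc i \<in> fv_sfm a}"
| "fv_sfm (SBAll j a) = insert j {i. Suc i \<in> fv_sfm a}"
| "fv_sfm (SBExi j a) = insert j {i. Suc i \<in> fv_sfm a}"

text \<open>\<open>El x n a\<close> states that \<open>T (cd\<^sub>x n)\<close> holds and \<open>a = el\<^sub>x n\<close>, and \<open>InEL a x\<close> states that
  \<open>a \<in> EL x\<close>.\<close>

definition El :: "tm \<Rightarrow> tm \<Rightarrow> tm \<Rightarrow> fm" where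
  "El x n a = \<^bold>\<exists> (App (lift_tm x) (lift_tm n) (Var 0) \<^bold>\<and> TC (Rgt (Var 0)) \<^bold>\<and>
                  lift_tm a \<^bold>= Lft (Var 0))"

definition InEL :: "tm \<Rightarrow> tm \<Rightarrow> fm" where
  "InEL a x = \<^bold>\<exists> El (lift_tm x) (Var 0) (lift_tm a)"

text \<open>Set equality is given by a formula \<open>eq\<close> in the variables \<open>0\<close> and \<open>1\<close> which satisfies, provably,
  the recursive characterization of extensional equality on v-sets. By V2 such a formula is
  determined up to provable equivalence on v-sets.\<close>

definition ext_equality :: "prim \<Rightarrow> fm \<Rightarrow> bool" where
  "ext_equality \<xi> eq \<longleftrightarrow> fv_fm eq \<subseteq> {0, 1} \<and>
     prv \<xi> {} (\<^bold>\<forall> \<^bold>\<forall> (VS (Var 1) \<^bold>\<and> VS (Var 0) \<^bold>\<longrightarrow>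
       (sub [Var 1, Var 0] 2 eq \<^bold>\<longleftrightarrow>
         \<^bold>\<forall> (InEL (Var 0) (Var 2) \<^bold>\<longrightarrow>
             \<^bold>\<exists> (InEL (Var 0) (Var 2) \<^bold>\<and> sub [Var 1, Var 0] 4 eq)) \<^bold>\<and>
         \<^bold>\<forall> (InEL (Var 0) (Var 1) \<^bold>\<longrightarrow>
             \<^bold>\<exists> (InEL (Var 0) (Var 3) \<^bold>\<and> sub [Var 1, Var 0] 4 eq)))))"

primrec interp :: "fm \<Rightarrow> sfm \<Rightarrow> fm" where
  "interp eq SFls = Fls"
| "interp eq (SEq i j) = sub [Var i, Var j] 0 eq"
| "interp eq (SMem i j) =
     \<^bold>\<exists> (InEL (Var 0) (Var (Suc j)) \<^bold>\<and> sub [Var (Suc i), Var 0] 0 eq)"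
| "interp eq (SConj a b) = (interp eq a \<^bold>\<and> interp eq b)"
| "interp eq (SDisj a b) = (interp eq a \<^bold>\<or> interp eq b)"
| "interp eq (SImpl a b) = (interp eq a \<^bold>\<longrightarrow> interp eq b)"
| "interp eq (SAll a) = \<^bold>\<forall> (VS (Var 0) \<^bold>\<longrightarrow> interp eq a)"
| "interp eq (SExi a) = \<^bold>\<exists> (VS (Var 0) \<^bold>\<and> interp eq a)"
| "interp eq (SBAll j a) = \<^bold>\<forall> (InEL (Var 0) (Var (Suc j)) \<^bold>\<longrightarrow> interp eq a)"
| "interp eq (SBExi j a) = \<^bold>\<exists> (InEL (Var 0) (Var (Suc j)) \<^bold>\<and> interp eq a)"

section \<open>Set-theoretic notions\<close>

definition is_empty :: "nat \<Rightarrow> sfm" where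
  "is_empty z = SBAll z SFls"

text \<open>\<open>s = n \<union> {n}\<close>\<close>

definition is_succ :: "nat \<Rightarrow> nat \<Rightarrow> sfm" where
  "is_succ s n = SConj (SMem n s) (SConj (SBAll n (SMem 0 (Suc s)))
     (SBAll s (SDisj (SMem 0 (Suc n)) (SEq 0 (Suc n)))))"

definition is_inductive :: "nat \<Rightarrow> sfm" where
  "is_inductive w = SConj (SBExi w (is_empty 0)) (SBAll w (SBExi (Suc w) (is_succ 0 1)))"

definition is_omega :: "nat \<Rightarrow> sfm" where
  "is_omega w = SConj (is_inductive w)
     (SAll (SImpl (is_inductive 0) (SBAll (Suc w) (SMem 0 1))))"

text \<open>\<open>u = {a, b}\<close>\<close>

definition is_upair :: "nat \<Rightarrow> nat \<Rightarrow> nat \<Rightarrow> sfm" where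
  "is_upair u a b = SConj (SMem a u) (SConj (SMem b u)
     (SBAll u (SDisj (SEq 0 (Suc a)) (SEq 0 (Suc b)))))"

text \<open>\<open>p = {{a}, {a, b}}\<close>\<close>

definition is_opair :: "nat \<Rightarrow> nat \<Rightarrow> nat \<Rightarrow> sfm" where
  "is_opair p a b = SConj (SBExi p (is_upair 0 (Suc a) (Suc a)))
     (SConj (SBExi p (is_upair 0 (Suc a) (Suc b)))
       (SBAll p (SDisj (is_upair 0 (Suc a) (Suc a)) (is_upair 0 (Suc a) (Suc b)))))"

text \<open>\<open>\<langle>a, b\<rangle> \<in> f\<close>\<close>

definition maps_to :: "nat \<Rightarrow> nat \<Rightarrow> nat \<Rightarrow> sfm" where
  "maps_to f a b = SBExi f (is_opair 0 (Suc a) (Suc b))"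

definition is_function_on :: "nat \<Rightarrow> nat \<Rightarrow> sfm" where
  "is_function_on f w =
     SConj (SBAll f (SBExi (Suc w) (SExi (is_opair 2 1 0))))
       (SBAll w (SConj (SExi (maps_to (f + 2) 1 0))
          (SAll (SAll (SImpl (SConj (maps_to (f + 3) 2 1) (maps_to (f + 3) 2 0)) (SEq 1 0))))))"

section \<open>Relativised dependent choices\<close>

text \<open>In the following, \<open>\<phi>\<close> is a formula of set theory with \<open>x\<close> as variable \<open>0\<close>, and \<open>\<psi>\<close> is a formula
  of the ambient system with \<open>x\<close>, \<open>y\<close> as variables \<open>0\<close>, \<open>1\<close>. Their other variables are parameters;
  those of \<open>\<phi>\<close> range over sets.\<close>

definition set_params :: "sfm \<Rightarrow> fm set" where
  "set_params \<phi> = {VS (Var j) |j. Suc j \<in> fv_sfm \<phi>}"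

definition rdc_hyp :: "fm \<Rightarrow> sfm \<Rightarrow> fm \<Rightarrow> fm" where
  "rdc_hyp eq \<phi> \<psi> =
     \<^bold>\<forall> (VS (Var 0) \<^bold>\<longrightarrow> interp eq \<phi> \<^bold>\<longrightarrow>
       \<^bold>\<exists> (VS (Var 0) \<^bold>\<and> sub [Var 0] 2 (interp eq \<phi>) \<^bold>\<and> sub [Var 1, Var 0] 2 \<psi>))"

text \<open>Since \<open>\<psi>\<close> need not respect set equality, \<open>\<psi> (f(n), f(n+1))\<close> has to be a statement about v-sets
  representing the values of \<open>f\<close>. The number \<open>r\<close> chooses them: for the element \<open>n = el\<^sub>w k\<close> of
  \<open>w = \<omega>\<close>, the v-set \<open>r k\<close> represents \<open>f(n)\<close>. In \<open>rdc_concl\<close> the variables \<open>x, f, w, r\<close> are \<open>3, 2, 1, 0\<close>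
  below the third existential quantifier. The first of the two last conjuncts then binds \<open>k, n, y\<close>
  and states \<open>\<langle>n, y\<rangle> \<in> f\<close>, \<open>\<phi> y\<close> and \<open>n = \<emptyset> \<longrightarrow> y = x\<close> for \<open>y = r k\<close>; the second one binds
  \<open>k, n, k', n', y, y'\<close> and states \<open>\<psi> (y, y')\<close> for \<open>y = r k\<close>, \<open>y' = r k'\<close> whenever
  \<open>n' = n \<union> {n}\<close>.\<close>

definition rdc_concl :: "fm \<Rightarrow> sfm \<Rightarrow> fm \<Rightarrow> fm" where
  "rdc_concl eq \<phi> \<psi> =
     \<^bold>\<forall> (VS (Var 0) \<^bold>\<longrightarrow> interp eq \<phi> \<^bold>\<longrightarrow>
       \<^bold>\<exists> (VS (Var 0) \<^bold>\<and> \<^bold>\<exists> (VS (Var 0) \<^bold>\<and>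
         interp eq (is_omega 0) \<^bold>\<and> interp eq (is_function_on 1 0) \<^bold>\<and>
         \<^bold>\<exists>
           (\<^bold>\<forall> \<^bold>\<forall> (El (Var 3) (Var 1) (Var 0) \<^bold>\<longrightarrow>
              \<^bold>\<exists> (App (Var 3) (Var 2) (Var 0) \<^bold>\<and> VS (Var 0) \<^bold>\<and>
                 interp eq (maps_to 5 1 0) \<^bold>\<and>
                 sub [Var 0] 7 (interp eq \<phi>) \<^bold>\<and>
                 interp eq (SImpl (is_empty 1) (SEq 0 6)))) \<^bold>\<and>
            \<^bold>\<forall> \<^bold>\<forall> \<^bold>\<forall> \<^bold>\<forall> (El (Var 5) (Var 3) (Var 2) \<^bold>\<and> El (Var 5) (Var 1) (Var 0) \<^bold>\<and>
              interp eq (is_succ 0 2) \<^bold>\<longrightarrow>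
              \<^bold>\<exists> \<^bold>\<exists> (App (Var 6) (Var 5) (Var 1) \<^bold>\<and> App (Var 6) (Var 3) (Var 0) \<^bold>\<and>
                 sub [Var 1, Var 0] 10 \<psi>))))))"

end

theory Submission
  imports Defs "HOL-Library.Countable"
begin

text \<open>
  By extended Church's thesis, \<open>\<phi> x\<close> is equivalent to \<open>\<exists>e. \<rho> e x\<close> with an almost negative \<open>\<rho>\<close>, the
  realizability of \<open>\<phi>\<close>. So Church's thesis applies to the hypothesis in the form \<open>V x \<and> \<rho> e x \<longrightarrow>
  (\<exists>y e'. V y \<and> \<rho> e' y \<and> \<psi> x y)\<close>, and the recursion theorem, itself obtained from Church's thesis,
  iterates the choice to a recursive sequence \<open>r\<close> of v-sets. Church's thesis also provides the indices
  of all v-sets needed: the von Neumann numerals, \<open>\<omega>\<close>, and the function \<open>f\<close> whose \<open>n\<close>-th element is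
  the ordered pair of the \<open>n\<close>-th numeral and \<open>r n\<close>. The only facts used about the machine are that
  final configurations are fixed points, so that application is single-valued, and that some index
  denotes the empty function, which gives the first meaningful conditions.

  Derivations are replaced by a Kripke-style semantics. A world is a deductively closed, consistent
  theory with the disjunction and the existence property, and a finite set of formulas proves whatever
  belongs to all worlds that contain it. Inside a world the positive connectives and \<open>\<exists>\<close> are
  those of the meta-logic; implications and universal statements hold at \<open>w\<close> iff they hold in all
  worlds that contain a suitable finite part of \<open>w\<close>. Only a finite part is kept, because a world uses
  up all variables and a larger world would have no fresh one left.
\<close>

section \<open>Substitution\<close>

text \<open>Two obstacles shape the construction. Church's thesis yields functions on numbers, which
  need not respect extensional equality, whereas \<open>f\<close> has to be single-valued up to
  \<simeq>. Since the arguments of \<open>f\<close> are numerals, it is enough that extensionally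
  equal numerals have equal indices; this follows from trichotomy and from the irreflexivity of
  membership, which is proved by V2. The same injectivity shows that if \<open>n'\<close> is the
  successor of \<open>n\<close> then its index is the successor of the index of \<open>n\<close>, so
  that \<psi> is asserted only of the very v-sets that were chosen.

  The other obstacle is that the choice of the next set depends on the evidence for \<phi>. The
  iteration therefore runs over pairs of a v-set and a realizer, and is projected to v-sets only at
  the end. No realizer of \<psi> is involved, because \<psi> occurs in the consequent of Church's
  thesis, which may be arbitrary.

  No s-m-n function of the machine is computed: two nested applications of Church's thesis give an
  index that depends effectively on a parameter.\<close>

definition scons :: "tm \<Rightarrow> (nat \<Rightarrow> tm) \<Rightarrow> nat \<Rightarrow> tm" (infixr \<open>\<bullet>\<close> 65) where
  "t \<bullet> \<sigma> = case_nat t \<sigma>"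

text \<open>Environments have the form \<open>t \<bullet> u \<bullet> \<sigma>\<close>; the numeral
  rules let the simplifier look up a concrete de Bruijn index.\<close>

lemma scons_simps [simp]:
  "(t \<bullet> \<sigma>) 0 = t"
  "(t \<bullet> \<sigma>) (Suc i) = \<sigma> i"
  "(t \<bullet> \<sigma>) (numeral k) = \<sigma> (pred_numeral k)"
  "(t \<bullet> \<sigma>) (i + numeral k) = \<sigma> (i + pred_numeral k)"
  by (simp_all add: scons_def numeral_eq_Suc)

lemma scons_ext: "\<sigma> 0 = t \<Longrightarrow> (\<And>i. \<sigma> (Suc i) = \<tau> i) \<Longrightarrow> \<sigma> = t \<bullet> \<tau>"
  by (auto simp: scons_def fun_eq_iff split: nat.split)

lemma subst_tm_scons: "(\<lambda>i. subst_tm \<sigma> ((t \<bullet> \<tau>) i)) = subst_tm \<sigma> t \<bullet> (\<lambda>i. subst_tm \<sigma> (\<tau> i))"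
  by (rule scons_ext) simp_all

lemma up_scons: "up \<sigma> = Var 0 \<bullet> (\<lambda>i. lift_tm (\<sigma> i))"
  by (simp add: up_def scons_def)

text \<open>Replaces the list lookup in \<open>sub\<close> by environments, for the two lengths that
  occur in the axioms and in the interpretation.\<close>

lemma sub_simps:
  "sub [t] d = subst_fm (t \<bullet> (\<lambda>i. Var (i + d)))"
  "sub [t, u] d = subst_fm (t \<bullet> u \<bullet> (\<lambda>i. Var (i + d)))"
proof -
  have "(\<lambda>i. if i < length [t] then [t] ! i else Var (i - length [t] + d)) = t \<bullet> (\<lambda>i. Var (i + d))"
    by (rule scons_ext) simp_all
  then show "sub [t] d = subst_fm (t \<bullet> (\<lambda>i. Var (i + d)))" unfolding sub_def by metis
  have "(\<lambda>i. if i < length [t, u] then [t, u] ! i else Var (i - length [t, u] + d))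
      = t \<bullet> u \<bullet> (\<lambda>i. Var (i + d))"
    by (auto simp: fun_eq_iff scons_def less_Suc_eq split: nat.split)
  then show "sub [t, u] d = subst_fm (t \<bullet> u \<bullet> (\<lambda>i. Var (i + d)))" unfolding sub_def by metis
qed

lemma subst_tm_comp: "subst_tm \<sigma> (subst_tm \<tau> t) = subst_tm (\<lambda>i. subst_tm \<sigma> (\<tau> i)) t"
  by (induction t) auto

lemma subst_tm_cong: "(\<And>i. i \<in> fv_tm t \<Longrightarrow> \<sigma> i = \<tau> i) \<Longrightarrow> subst_tm \<sigma> t = subst_tm \<tau> t"
  by (induction t) auto

lemma subst_tm_Var [simp]: "subst_tm Var t = t"
  by (induction t) (auto simp: map_idI)

lemma subst_tm_scons_lift [simp]: "subst_tm (t \<bullet> \<sigma>) (lift_tm u) = subst_tm \<sigma> u"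
  by (simp add: subst_tm_comp)

lemma up_comp: "(\<lambda>i. subst_tm (up \<sigma>) (up \<tau> i)) = up (\<lambda>i. subst_tm \<sigma> (\<tau> i))"
  unfolding up_scons by (rule scons_ext) (simp_all add: subst_tm_comp)

lemma subst_fm_comp: "subst_fm \<sigma> (subst_fm \<tau> a) = subst_fm (\<lambda>i. subst_tm \<sigma> (\<tau> i)) a"
  by (induction a arbitrary: \<sigma> \<tau>) (auto simp: subst_tm_comp up_comp)

lemma subst_fm_cong: "(\<And>i. i \<in> fv_fm a \<Longrightarrow> \<sigma> i = \<tau> i) \<Longrightarrow> subst_fm \<sigma> a = subst_fm \<tau> a"
proof (induction a arbitrary: \<sigma> \<tau>)
  case (Uni a)
  have "up \<sigma> i = up \<tau> i" if "i \<in> fv_fm a" for i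
    using that Uni.prems by (cases i) (auto simp: up_scons)
  then show ?case by (auto intro: Uni.IH)
next
  case (Exi a)
  have "up \<sigma> i = up \<tau> i" if "i \<in> fv_fm a" for i
    using that Exi.prems by (cases i) (auto simp: up_scons)
  then show ?case by (auto intro: Exi.IH)
next
  case (Conj a b)
  then show ?case by (metis UnCI fv_fm.simps(6) subst_fm.simps(6))
next
  case (Disj a b)
  then show ?case by (metis UnCI fv_fm.simps(7) subst_fm.simps(7))
next
  case (Impl a b)
  then show ?case by (metis UnCI fv_fm.simps(8) subst_fm.simps(8))
qed (auto intro: subst_tm_cong)

lemma up_Var: "up Var = Var"
  by (auto simp: up_def fun_eq_iff split: nat.split)

lemma subst_fm_Var [simp]: "subst_fm Var a = a"
  by (induction a) (auto simp: up_Var)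

lemma finite_fv_tm: "finite (fv_tm t)"
  by (induction t) auto

lemma finite_pred_set: "finite A \<Longrightarrow> finite {i. Suc i \<in> A}"
  by (rule finite_subset[of _ "(\<lambda>i. i - 1) ` A"]) force+

lemma finite_fv_fm: "finite (fv_fm a)"
  by (induction a) (auto simp: finite_fv_tm finite_pred_set)

lemma subst_App [simp]:
  "subst_fm \<sigma> (App e n m) = App (subst_tm \<sigma> e) (subst_tm \<sigma> n) (subst_tm \<sigma> m)"
  by (simp add: App_def up_scons subst_tm_comp)

lemma subst_El [simp]:
  "subst_fm \<sigma> (El x n a) = El (subst_tm \<sigma> x) (subst_tm \<sigma> n) (subst_tm \<sigma> a)"
  by (simp add: El_def up_scons subst_tm_comp)

lemma subst_InEL [simp]:
  "subst_fm \<sigma> (InEL a x) = InEL (subst_tm \<sigma> a) (subst_tm \<sigma> x)"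
  by (simp add: InEL_def up_scons subst_tm_comp)

lemma up_simps [simp]:
  "up \<sigma> 0 = Var 0" "up \<sigma> (Suc i) = lift_tm (\<sigma> i)"
  "up \<sigma> (numeral k) = lift_tm (\<sigma> (pred_numeral k))"
  "up \<sigma> (i + numeral k) = lift_tm (\<sigma> (i + pred_numeral k))"
  by (simp_all add: up_scons)

text \<open>\<open>Cl\<close> places its argument below two binders and with a projection for
  variable 0; commuting a substitution past this is what makes V1 and V2 stable under
  substitution.\<close>

lemma subst_Cl: "subst_fm (up \<sigma>) (Cl a) = Cl (subst_fm (up \<sigma>) a)"
proof -
  have "(\<lambda>i. subst_tm (up (up (up \<sigma>))) ((Lft (Var 0) \<bullet> (\<lambda>i. Var (i + 3))) i))
    = (\<lambda>i. subst_tm (Lft (Var 0) \<bullet> (\<lambda>i. Var (i + 3))) (up \<sigma> i))"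
    by (rule trans[OF _ scons_ext[symmetric]]) (simp_all add: subst_tm_scons subst_tm_comp numeral_eq_Suc)
  then show ?thesis
    by (simp add: Cl_def sub_simps subst_fm_comp numeral_eq_Suc)
qed

lemma qfree_subst: "qfree a \<Longrightarrow> qfree (subst_fm \<sigma> a)"
  by (induction rule: qfree.induct) (auto intro: qfree.intros)

lemma sigma1_subst: "sigma1 a \<Longrightarrow> sigma1 (subst_fm \<sigma> a)"
  by (induction arbitrary: \<sigma> rule: sigma1.induct) (auto intro: sigma1.intros qfree_subst)

lemma almost_neg_subst: "almost_neg a \<Longrightarrow> almost_neg (subst_fm \<sigma> a)"
  by (induction arbitrary: \<sigma> rule: almost_neg.induct)
    (auto intro: almost_neg.intros sigma1_subst)

text \<open>Axioms may contain parameters, so provability is closed under substitution only if each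
  substituted axiom is an axiom again.\<close>

lemma axm_subst: "axm \<xi> a \<Longrightarrow> axm \<xi> (subst_fm \<sigma> a)"
proof (induction rule: axm.induct)
  case (Pj i ts)
  then show ?case using axm.Pj[of i "map (subst_tm \<sigma>) ts" \<xi>] by simp
next
  case (Cn f gs ts)
  then show ?case using axm.Cn[of \<xi> f gs "map (subst_tm \<sigma>) ts"] by (simp add: comp_def)
next
  case (Ind a)
  have 1: "subst_fm \<sigma> (sub [Zero] 0 a) = sub [Zero] 0 (subst_fm (up \<sigma>) a)"
    by (simp add: sub_simps subst_fm_comp subst_tm_scons up_scons)
  have 2: "subst_fm (up \<sigma>) (sub [Succ (Var 0)] 1 a) = sub [Succ (Var 0)] 1 (subst_fm (up \<sigma>) a)"
    by (simp add: sub_simps subst_fm_comp subst_tm_scons up_scons subst_tm_comp)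
  show ?case using axm.Ind[of \<xi> "subst_fm (up \<sigma>) a"] by (simp add: 1 2[simplified])
next
  case V1
  then show ?case using axm.V1[of \<xi>] by (simp add: subst_Cl)
next
  case (V2 a)
  then show ?case using axm.V2[of \<xi> "subst_fm (up \<sigma>) a"] by (simp add: subst_Cl)
next
  case X1
  then show ?case using axm.X1[of \<xi>] by (simp add: numeral_eq_Suc)
next
  case X2
  then show ?case using axm.X2[of \<xi>] by (simp add: numeral_eq_Suc)
next
  case (ECT a b)
  have 1: "subst_fm (up (up \<sigma>)) (sub [Var 0] 2 a) = sub [Var 0] 2 (subst_fm (up \<sigma>) a)"
    by (simp add: sub_simps subst_fm_comp subst_tm_scons up_scons subst_tm_comp)
  have 2: "subst_fm (up (up (up \<sigma>))) (sub [Var 0, Var 1] 3 b)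
      = sub [Var 0, Var 1] 3 (subst_fm (up (up \<sigma>)) b)"
    by (simp add: sub_simps subst_fm_comp subst_tm_scons up_scons subst_tm_comp numeral_eq_Suc)
  show ?case
    using axm.ECT[OF almost_neg_subst[OF ECT], of \<xi> "up \<sigma>" "subst_fm (up (up \<sigma>)) b"]
    by (simp add: 1 2[simplified] flip: numeral_2_eq_2)
qed (auto intro: axm.intros)

section \<open>Structural properties of provability\<close>

lemma prv_weaken: "prv \<xi> \<Gamma> a \<Longrightarrow> \<Gamma> \<subseteq> \<Delta> \<Longrightarrow> prv \<xi> \<Delta> a"
proof (induction arbitrary: \<Delta> rule: prv.induct)
  case (DisjE \<Gamma> a b c)
  then show ?case by (meson insert_mono prv.DisjE)
next
  case (ImplI a \<Gamma> b)
  then show ?case by (meson insert_mono prv.ImplI)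
next
  case (AllI \<Gamma> a)
  then show ?case by (simp add: image_mono prv.AllI)
next
  case (ExiE \<Gamma> a c)
  show ?case
    by (rule prv.ExiE[OF ExiE.IH(1)[OF ExiE.prems] ExiE.IH(2)])
      (use ExiE.prems in auto)
next
  case (EqE \<Gamma> t u a)
  then show ?case by (meson prv.EqE)
qed (auto intro: prv.intros)

lemma prv_subst: "prv \<xi> \<Gamma> a \<Longrightarrow> prv \<xi> (subst_fm \<sigma> ` \<Gamma>) (subst_fm \<sigma> a)"
proof (induction arbitrary: \<sigma> rule: prv.induct)
  case (AllI \<Gamma> a)
  have "subst_fm (up \<sigma>) ` lift_fm ` \<Gamma> = lift_fm ` subst_fm \<sigma> ` \<Gamma>"
    by (simp add: image_image subst_fm_comp)
  with AllI.IH[of "up \<sigma>"] show ?case by (simp add: prv.AllI)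
next
  case (AllE \<Gamma> a t)
  have "subst_fm \<sigma> (sub [t] 0 a) = sub [subst_tm \<sigma> t] 0 (subst_fm (up \<sigma>) a)"
    by (simp add: sub_simps subst_fm_comp subst_tm_scons up_scons)
  then show ?case using prv.AllE[of \<xi> "subst_fm \<sigma> ` \<Gamma>" "subst_fm (up \<sigma>) a"] AllE.IH[of \<sigma>] by simp
next
  case (ExiI \<Gamma> t a)
  have "subst_fm \<sigma> (sub [t] 0 a) = sub [subst_tm \<sigma> t] 0 (subst_fm (up \<sigma>) a)"
    by (simp add: sub_simps subst_fm_comp subst_tm_scons up_scons)
  then show ?case using ExiI.IH[of \<sigma>] by (auto intro: prv.ExiI)
next
  case (ExiE \<Gamma> a c)
  have 1: "subst_fm (up \<sigma>) ` lift_fm ` \<Gamma> = lift_fm ` subst_fm \<sigma> ` \<Gamma>"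
    by (simp add: image_image subst_fm_comp)
  have 2: "subst_fm (up \<sigma>) (lift_fm c) = lift_fm (subst_fm \<sigma> c)"
    by (simp add: subst_fm_comp)
  show ?case using ExiE.IH(1)[of \<sigma>] ExiE.IH(2)[of "up \<sigma>"]
    by (simp add: 1 2) (rule prv.ExiE)
next
  case (EqE \<Gamma> t u a)
  have *: "subst_fm \<sigma> (sub [t] 0 a) = sub [subst_tm \<sigma> t] 0 (subst_fm (up \<sigma>) a)" for t
    by (simp add: sub_simps subst_fm_comp subst_tm_scons up_scons)
  show ?case using EqE.IH(1)[of \<sigma>] EqE.IH(2)[of \<sigma>] unfolding * by (auto intro: prv.EqE)
next
  case (DisjE \<Gamma> a b c)
  show ?case using DisjE.IH(1)[of \<sigma>] DisjE.IH(2,3)[of \<sigma>] by (auto intro: prv.DisjE)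
next
  case (ConjE1 \<Gamma> a b)
  show ?case using ConjE1.IH[of \<sigma>] by (auto intro: prv.ConjE1)
next
  case (ConjE2 \<Gamma> a b)
  show ?case using ConjE2.IH[of \<sigma>] by (auto intro: prv.ConjE2)
next
  case (ImplE \<Gamma> a b)
  show ?case using ImplE.IH[of \<sigma>] by (auto intro: prv.ImplE)
qed (auto intro: prv.intros axm_subst)

text \<open>Worlds are infinite contexts, whereas the choice of a fresh variable needs a finite
  one.\<close>

lemma prv_compact: "prv \<xi> \<Gamma> a \<Longrightarrow> \<exists>\<Delta>\<subseteq>\<Gamma>. finite \<Delta> \<and> prv \<xi> \<Delta> a"
proof (induction rule: prv.induct)
  case (Hyp a \<Gamma>)
  then show ?case by (intro exI[of _ "{a}"]) (auto intro: prv.Hyp)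
next
  case (ConjI \<Gamma> a b)
  then obtain D1 D2 where "D1 \<subseteq> \<Gamma>" "finite D1" "prv \<xi> D1 a" "D2 \<subseteq> \<Gamma>" "finite D2" "prv \<xi> D2 b"
    by blast
  then show ?case
    by (intro exI[of _ "D1 \<union> D2"]) (auto intro!: prv.ConjI intro: prv_weaken)
next
  case (DisjE \<Gamma> a b c)
  then obtain D1 D2 D3 where D: "D1 \<subseteq> \<Gamma>" "finite D1" "prv \<xi> D1 (a \<^bold>\<or> b)"
      "D2 \<subseteq> insert a \<Gamma>" "finite D2" "prv \<xi> D2 c" "D3 \<subseteq> insert b \<Gamma>" "finite D3" "prv \<xi> D3 c"
    by blast
  let ?D = "D1 \<union> (D2 - {a}) \<union> (D3 - {b})"
  have "prv \<xi> ?D (a \<^bold>\<or> b)" using D(3) by (rule prv_weaken) auto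
  moreover have "prv \<xi> (insert a ?D) c" using D(6) by (rule prv_weaken) auto
  moreover have "prv \<xi> (insert b ?D) c" using D(9) by (rule prv_weaken) auto
  ultimately have "prv \<xi> ?D c" by (rule prv.DisjE)
  then show ?case using D by (intro exI[of _ ?D]) auto
next
  case (ImplI a \<Gamma> b)
  then obtain D where D: "D \<subseteq> insert a \<Gamma>" "finite D" "prv \<xi> D b" by blast
  have "prv \<xi> (insert a (D - {a})) b" using D(3) by (rule prv_weaken) auto
  then show ?case using D by (intro exI[of _ "D - {a}"]) (auto intro: prv.ImplI)
next
  case (ImplE \<Gamma> a b)
  then obtain D1 D2 where "D1 \<subseteq> \<Gamma>" "finite D1" "prv \<xi> D1 (a \<^bold>\<longrightarrow> b)"
      "D2 \<subseteq> \<Gamma>" "finite D2" "prv \<xi> D2 a"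
    by blast
  then show ?case
    by (intro exI[of _ "D1 \<union> D2"]) (auto intro: prv.ImplE[OF prv_weaken prv_weaken])
next
  case (AllI \<Gamma> a)
  then obtain D where D: "D \<subseteq> lift_fm ` \<Gamma>" "finite D" "prv \<xi> D a" by blast
  then obtain D' where "D' \<subseteq> \<Gamma>" "finite D'" "D = lift_fm ` D'"
    by (meson finite_subset_image)
  then show ?case using D by (auto intro: prv.AllI)
next
  case (ExiE \<Gamma> a c)
  then obtain D1 D2 where D: "D1 \<subseteq> \<Gamma>" "finite D1" "prv \<xi> D1 (Exi a)"
      "D2 \<subseteq> insert a (lift_fm ` \<Gamma>)" "finite D2" "prv \<xi> D2 (lift_fm c)"
    by blast
  then have "D2 - {a} \<subseteq> lift_fm ` \<Gamma>" "finite (D2 - {a})" by auto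
  then obtain D' where D': "D' \<subseteq> \<Gamma>" "finite D'" "D2 - {a} = lift_fm ` D'"
    by (meson finite_subset_image)
  have "prv \<xi> (D1 \<union> D') (Exi a)" using D(3) by (rule prv_weaken) auto
  moreover have "prv \<xi> (insert a (lift_fm ` (D1 \<union> D'))) (lift_fm c)"
    using D(6) by (rule prv_weaken) (use D'(3) in auto)
  ultimately have "prv \<xi> (D1 \<union> D') c" by (rule prv.ExiE)
  then show ?case using D D' by (intro exI[of _ "D1 \<union> D'"]) auto
next
  case (EqE \<Gamma> t u a)
  then obtain D1 D2 where "D1 \<subseteq> \<Gamma>" "finite D1" "prv \<xi> D1 (t \<^bold>= u)"
      "D2 \<subseteq> \<Gamma>" "finite D2" "prv \<xi> D2 (sub [t] 0 a)"
    by blast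
  then show ?case
    by (intro exI[of _ "D1 \<union> D2"]) (auto intro: prv.EqE[OF prv_weaken prv_weaken])
qed (auto intro: prv.intros)

text \<open>Renames the eigenvariable \<open>k\<close> to the bound variable 0 and lifts everything
  else, in one simultaneous substitution. It turns a derivation about \<open>k\<close> into a
  premise of \<open>AllI\<close> or \<open>ExiE\<close>.\<close>

definition fresh_subst :: "nat \<Rightarrow> nat \<Rightarrow> tm" where
  "fresh_subst k i = (if i = k then Var 0 else Var (Suc i))"

lemma subst_fresh: "k \<notin> fv_fm a \<Longrightarrow> subst_fm (fresh_subst k) a = lift_fm a"
  by (rule subst_fm_cong) (auto simp: fresh_subst_def)

lemma subst_fresh_inst:
  assumes "Suc k \<notin> fv_fm a"
  shows "subst_fm (fresh_subst k) (sub [Var k] 0 a) = a"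
proof -
  have "subst_fm (fresh_subst k) (sub [Var k] 0 a) = subst_fm Var a"
    unfolding sub_simps subst_fm_comp
  proof (rule subst_fm_cong)
    fix i assume "i \<in> fv_fm a"
    then show "subst_tm (fresh_subst k) ((Var k \<bullet> (\<lambda>i. Var (i + 0))) i) = Var i"
      using assms by (cases i) (auto simp: fresh_subst_def)
  qed
  then show ?thesis by simp
qed

text \<open>Both indices matter: the outer variable \<open>k\<close> appears as \<open>k\<close> in
  a context formula and as \<open>Suc k\<close> in the body of a quantifier.\<close>

lemma ex_fresh:
  assumes "finite A"
  shows "\<exists>k. (\<forall>a\<in>A. k \<notin> fv_fm a \<and> Suc k \<notin> fv_fm a)"
proof -
  let ?S = "\<Union>a\<in>A. fv_fm a \<union> {i. Suc i \<in> fv_fm a}"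
  have "finite ?S" using assms by (auto simp: finite_fv_fm finite_pred_set)
  then obtain k where "k \<notin> ?S" using ex_new_if_finite infinite_UNIV_nat by blast
  then show ?thesis by blast
qed

text \<open>Among the term instances is the one for a variable fresh for \<Gamma> and
  \<open>a\<close>, and this instance is generic.\<close>

lemma prv_AllI_terms:
  assumes "finite \<Gamma>" "\<And>t. prv \<xi> \<Gamma> (sub [t] 0 a)"
  shows "prv \<xi> \<Gamma> (Uni a)"
proof -
  obtain k where k: "\<forall>b\<in>insert a \<Gamma>. k \<notin> fv_fm b \<and> Suc k \<notin> fv_fm b"
    using ex_fresh[of "insert a \<Gamma>"] assms(1) by auto
  have "prv \<xi> (subst_fm (fresh_subst k) ` \<Gamma>) (subst_fm (fresh_subst k) (sub [Var k] 0 a))"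
    by (rule prv_subst) (rule assms(2))
  moreover have "subst_fm (fresh_subst k) ` \<Gamma> = lift_fm ` \<Gamma>"
    using k by (intro image_cong) (auto simp: subst_fresh)
  ultimately show ?thesis using k by (auto simp: subst_fresh_inst intro: prv.AllI)
qed

text \<open>Fresh variables serve as Henkin witnesses, so the language needs no new
  constants.\<close>

lemma prv_ExiE_fresh:
  assumes "prv \<xi> \<Gamma> (Exi a)" "prv \<xi> (insert (sub [Var k] 0 a) \<Gamma>) c"
    and "\<forall>b\<in>insert a (insert c \<Gamma>). k \<notin> fv_fm b \<and> Suc k \<notin> fv_fm b"
  shows "prv \<xi> \<Gamma> c"
proof -
  have "prv \<xi> (subst_fm (fresh_subst k) ` insert (sub [Var k] 0 a) \<Gamma>) (subst_fm (fresh_subst k) c)"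
    by (rule prv_subst) (rule assms(2))
  moreover have "subst_fm (fresh_subst k) ` \<Gamma> = lift_fm ` \<Gamma>"
    using assms(3) by (intro image_cong) (auto simp: subst_fresh)
  ultimately have "prv \<xi> (insert a (lift_fm ` \<Gamma>)) (lift_fm c)"
    using assms(3) by (simp add: subst_fresh_inst subst_fresh)
  with assms(1) show ?thesis by (rule prv.ExiE)
qed

section \<open>Saturated theories\<close>

instance prim :: countable by countable_datatype
instance tm :: countable by countable_datatype
instance fm :: countable by countable_datatype

definition sat :: "prim \<Rightarrow> fm set \<Rightarrow> bool" where
  "sat \<xi> w \<longleftrightarrow> (\<forall>a. prv \<xi> w a \<longrightarrow> a \<in> w) \<and> Fls \<notin> w \<and>
     (\<forall>a b. (a \<^bold>\<or> b) \<in> w \<longrightarrow> a \<in> w \<or> b \<in> w) \<and>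
     (\<forall>a. Exi a \<in> w \<longrightarrow> (\<exists>t. sub [t] 0 a \<in> w))"

text \<open>A Lindenbaum construction relative to \<open>c\<close>: the formulas are enumerated, and
  each is added, together with a witness if it is existential, provided that \<open>c\<close> stays
  unprovable. Maximality with respect to not proving \<open>c\<close> then gives deductive closure
  and the disjunction property.\<close>

lemma saturation:
  assumes "finite \<Gamma>" "\<not> prv \<xi> \<Gamma> c"
  shows "\<exists>w. sat \<xi> w \<and> \<Gamma> \<subseteq> w \<and> c \<notin> w"
proof -
  \<comment> \<open>Stages stay finite so that a fresh variable remains available for the next
    witness.\<close>
  define ok where "ok \<Delta> \<longleftrightarrow> finite \<Delta> \<and> \<not> prv \<xi> \<Delta> c" for \<Delta>
  have step: "\<exists>\<Delta>'. ok \<Delta>' \<and> \<Delta> \<subseteq> \<Delta>' \<and> (\<not> prv \<xi> (insert a \<Delta>) c \<longrightarrow>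
      a \<in> \<Delta>' \<and> (\<forall>b. a = Exi b \<longrightarrow> (\<exists>t. sub [t] 0 b \<in> \<Delta>')))" if "ok \<Delta>" for \<Delta> a
  proof (cases "prv \<xi> (insert a \<Delta>) c")
    case True
    then show ?thesis using that by auto
  next
    case False
    show ?thesis
    proof (cases "\<exists>b. a = Exi b")
      case True
      then obtain b where b: "a = Exi b" by blast
      obtain k where k: "\<forall>d\<in>insert b (insert c (insert a \<Delta>)). k \<notin> fv_fm d \<and> Suc k \<notin> fv_fm d"
        using ex_fresh[of "insert b (insert c (insert a \<Delta>))"] \<open>ok \<Delta>\<close> by (auto simp: ok_def)
      have "\<not> prv \<xi> (insert (sub [Var k] 0 b) (insert a \<Delta>)) c"
        using False prv_ExiE_fresh[of \<xi> "insert a \<Delta>" b k c] k b by (auto intro: prv.Hyp)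
      then show ?thesis using that b
        by (intro exI[of _ "insert (sub [Var k] 0 b) (insert a \<Delta>)"]) (auto simp: ok_def)
    next
      case 2: False
      then show ?thesis using that False by (intro exI[of _ "insert a \<Delta>"]) (auto simp: ok_def)
    qed
  qed
  have "ok \<Gamma>" using assms by (simp add: ok_def)
  have "\<exists>G. \<forall>n. ok (G n) \<and> \<Gamma> \<subseteq> G n \<and> (G n \<subseteq> G (Suc n) \<and>
      (\<not> prv \<xi> (insert (from_nat n) (G n)) c \<longrightarrow> from_nat n \<in> G (Suc n) \<and>
        (\<forall>b. from_nat n = Exi b \<longrightarrow> (\<exists>t. sub [t] 0 b \<in> G (Suc n)))))"
    using dependent_nat_choice[of "\<lambda>n \<Delta>. ok \<Delta> \<and> \<Gamma> \<subseteq> \<Delta>" "\<lambda>n \<Delta> \<Delta>'. \<Delta> \<subseteq> \<Delta>' \<and>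
      (\<not> prv \<xi> (insert (from_nat n) \<Delta>) c \<longrightarrow> from_nat n \<in> \<Delta>' \<and>
        (\<forall>b. from_nat n = Exi b \<longrightarrow> (\<exists>t. sub [t] 0 b \<in> \<Delta>')))"] \<open>ok \<Gamma>\<close> step
    by (smt (verit) order_refl subset_trans)
  then obtain G where G: "\<And>n. ok (G n)" "\<And>n. \<Gamma> \<subseteq> G n" "\<And>n. G n \<subseteq> G (Suc n)"
    "\<And>n. \<not> prv \<xi> (insert (from_nat n) (G n)) c \<Longrightarrow> from_nat n \<in> G (Suc n) \<and>
        (\<forall>b. from_nat n = Exi b \<longrightarrow> (\<exists>t. sub [t] 0 b \<in> G (Suc n)))"
    by blast
  define w where "w = (\<Union>n. G n)"
  have mono: "G m \<subseteq> G n" if "m \<le> n" for m n using G(3) that by (rule lift_Suc_mono_le)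
  have fin: "\<exists>n. \<Delta> \<subseteq> G n" if "finite \<Delta>" "\<Delta> \<subseteq> w" for \<Delta>
    using that
  proof (induction rule: finite_induct)
    case (insert x F)
    then obtain m n where "F \<subseteq> G m" "x \<in> G n" by (auto simp: w_def)
    then have "insert x F \<subseteq> G (max m n)" using mono[of m "max m n"] mono[of n "max m n"] by auto
    then show ?case by blast
  qed auto
  have notc: "\<not> prv \<xi> w c"
  proof
    assume "prv \<xi> w c"
    from prv_compact[OF this] obtain D where "D \<subseteq> w" "finite D" "prv \<xi> D c" by metis
    then obtain n where "D \<subseteq> G n" using fin by meson
    with \<open>prv \<xi> D c\<close> have "prv \<xi> (G n) c" by (rule prv_weaken)
    with G(1) show False by (simp add: ok_def)
  qed
  have cut: "prv \<xi> w c" if "prv \<xi> w a" "prv \<xi> (insert a w) c" for a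
    using prv.ImplE[OF prv.ImplI[OF that(2)] that(1)] .
  \<comment> \<open>A formula that is harmless for the limit was harmless at its own stage
    \<open>to_nat a\<close>, where it was therefore added.\<close>
  have into: "a \<in> w \<and> (\<forall>b. a = Exi b \<longrightarrow> (\<exists>t. sub [t] 0 b \<in> w))" if "\<not> prv \<xi> (insert a w) c" for a
  proof -
    have "\<not> prv \<xi> (insert a (G (to_nat a))) c"
      using that prv_weaken[of \<xi> "insert a (G (to_nat a))" c "insert a w"] by (auto simp: w_def)
    then show ?thesis using G(4)[of "to_nat a"] by (auto simp: w_def) blast
  qed
  have closed: "a \<in> w" if "prv \<xi> w a" for a
    using that cut into notc by blast
  have "sat \<xi> w"
    unfolding sat_def
  proof (intro conjI allI impI)
    show "Fls \<notin> w" using notc by (auto intro: prv.Hyp prv.FlsE)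
    \<comment> \<open>If neither disjunct belonged to \<open>w\<close>, each would prove
      \<open>c\<close> over \<open>w\<close>, and so would the disjunction.\<close>
    show "a \<in> w \<or> b \<in> w" if "(a \<^bold>\<or> b) \<in> w" for a b
      using that into[of a] into[of b] notc prv.DisjE[OF prv.Hyp[OF that], of \<xi> c] by blast
    show "\<exists>t. sub [t] 0 a \<in> w" if "Exi a \<in> w" for a
      using that into[of "Exi a"] notc by (auto simp: insert_absorb)
  qed (rule closed)
  moreover have "\<Gamma> \<subseteq> w" using G(2) by (auto simp: w_def)
  moreover have "c \<notin> w" using notc by (auto intro: prv.Hyp)
  ultimately show ?thesis by blast
qed

section \<open>Kripke semantics in the saturated theories\<close>

locale heyting =
  fixes \<xi> :: prim
begin

abbreviation world :: "fm set \<Rightarrow> bool" where "world \<equiv> sat \<xi>"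

text \<open>Terms are the individuals of every world, which is why a valuation is a
  substitution.\<close>

definition holds :: "fm set \<Rightarrow> (nat \<Rightarrow> tm) \<Rightarrow> fm \<Rightarrow> bool" where
  "holds w \<sigma> a \<longleftrightarrow> subst_fm \<sigma> a \<in> w"

definition box :: "fm set \<Rightarrow> (fm set \<Rightarrow> bool) \<Rightarrow> bool" where
  "box w P \<longleftrightarrow> (\<exists>F\<subseteq>w. finite F \<and> (\<forall>w'. world w' \<longrightarrow> F \<subseteq> w' \<longrightarrow> P w'))"

definition pers :: "(fm set \<Rightarrow> bool) \<Rightarrow> bool" where
  "pers P \<longleftrightarrow> (\<forall>w. world w \<longrightarrow> P w \<longrightarrow> box w P)"

lemma prv_if_worlds:
  assumes "finite \<Gamma>" "\<And>w. world w \<Longrightarrow> \<Gamma> \<subseteq> w \<Longrightarrow> c \<in> w"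
  shows "prv \<xi> \<Gamma> c"
  using assms saturation by blast

lemma world_closed: "world w \<Longrightarrow> prv \<xi> w a \<Longrightarrow> a \<in> w"
  by (simp add: sat_def)

lemma world_prv: "world w \<Longrightarrow> \<Gamma> \<subseteq> w \<Longrightarrow> prv \<xi> \<Gamma> a \<Longrightarrow> a \<in> w"
  by (rule world_closed) (auto intro: prv_weaken)

lemma axm_world: "world w \<Longrightarrow> axm \<xi> a \<Longrightarrow> a \<in> w"
  by (auto intro: world_closed prv.Axm)

lemma world_mp: "world w \<Longrightarrow> (a \<^bold>\<longrightarrow> b) \<in> w \<Longrightarrow> a \<in> w \<Longrightarrow> b \<in> w"
  by (rule world_closed) (auto intro: prv.ImplE prv.Hyp)

text \<open>Nearly all rewrite rules for worlds are conditional on \<open>world\<close>; this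
  congruence provides that condition under a box.\<close>

lemma box_cong [cong]:
  "w = v \<Longrightarrow> (\<And>w'. world w' \<Longrightarrow> P w' = Q w') \<Longrightarrow> box w P = box v Q"
  unfolding box_def by metis

lemma boxD: "box w P \<Longrightarrow> world w \<Longrightarrow> P w"
  by (auto simp: box_def)

lemma box_mono: "box w P \<Longrightarrow> (\<And>w'. world w' \<Longrightarrow> P w' \<Longrightarrow> Q w') \<Longrightarrow> box w Q"
  unfolding box_def by meson

lemma box_conj: "box w (\<lambda>w'. P w' \<and> Q w') \<longleftrightarrow> box w P \<and> box w Q"
proof
  assume "box w P \<and> box w Q"
  then obtain F G where "F \<subseteq> w" "finite F" "\<forall>w'. world w' \<longrightarrow> F \<subseteq> w' \<longrightarrow> P w'"
    "G \<subseteq> w" "finite G" "\<forall>w'. world w' \<longrightarrow> G \<subseteq> w' \<longrightarrow> Q w'"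
    by (auto simp: box_def)
  then show "box w (\<lambda>w'. P w' \<and> Q w')"
    unfolding box_def by (intro exI[of _ "F \<union> G"]) auto
qed (auto intro: box_mono)

text \<open>The main way to enter a box: \<open>R\<close> collects the facts about \<open>w\<close>
  that the argument inside may use, and persistence carries them along. When the rule is applied
  with \<open>goal_cases\<close> and only \<open>R\<close> given, goal 4 is the argument
  itself.\<close>

lemma boxI:
  "pers R \<Longrightarrow> R w \<Longrightarrow> world w \<Longrightarrow> (\<And>w'. world w' \<Longrightarrow> R w' \<Longrightarrow> P w') \<Longrightarrow> box w P"
  by (auto simp: pers_def intro: box_mono)

lemma box_necessitation: "(\<And>w'. world w' \<Longrightarrow> P w') \<Longrightarrow> box w P"
  by (auto simp: box_def)

named_theorems pers_intros

lemma pers_mem [pers_intros]: "pers (\<lambda>w. a \<in> w)"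
  unfolding pers_def box_def by (intro allI impI exI[of _ "{a}"] conjI) auto

lemma pers_holds [pers_intros]: "pers (\<lambda>w. holds w \<sigma> a)"
  unfolding holds_def by (rule pers_mem)

lemma pers_conj [pers_intros]: "pers P \<Longrightarrow> pers Q \<Longrightarrow> pers (\<lambda>w. P w \<and> Q w)"
  by (auto simp: pers_def box_conj)

lemma pers_disj [pers_intros]: "pers P \<Longrightarrow> pers Q \<Longrightarrow> pers (\<lambda>w. P w \<or> Q w)"
  unfolding pers_def box_def by meson

lemma pers_ex [pers_intros]: "(\<And>t. pers (P t)) \<Longrightarrow> pers (\<lambda>w. \<exists>t. P t w)"
  unfolding pers_def box_def by meson

lemma pers_box [pers_intros]: "pers (\<lambda>w. box w P)"
  unfolding pers_def box_def by blast

lemma world_Fls [simp]: "world w \<Longrightarrow> Fls \<notin> w"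
  by (simp add: sat_def)

lemma world_Conj: "world w \<Longrightarrow> (a \<^bold>\<and> b) \<in> w \<longleftrightarrow> a \<in> w \<and> b \<in> w"
  by (meson world_closed prv.ConjE1 prv.ConjE2 prv.ConjI prv.Hyp)

lemma world_Disj: "world w \<Longrightarrow> (a \<^bold>\<or> b) \<in> w \<longleftrightarrow> a \<in> w \<or> b \<in> w"
  by (meson sat_def prv.DisjI1 prv.DisjI2 prv.Hyp)

text \<open>Right to left, the finite part \<open>F\<close> behind the box makes
  \<open>insert a F\<close> finite, so that completeness turns truth in all worlds into a derivation
  of \<open>b\<close>.\<close>

lemma world_Impl: "world w \<Longrightarrow> (a \<^bold>\<longrightarrow> b) \<in> w \<longleftrightarrow> box w (\<lambda>w'. a \<in> w' \<longrightarrow> b \<in> w')"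
proof
  assume w: "world w" "(a \<^bold>\<longrightarrow> b) \<in> w"
  show "box w (\<lambda>w'. a \<in> w' \<longrightarrow> b \<in> w')"
    by (rule boxI[OF pers_mem w(2,1)]) (auto intro: world_mp)
next
  assume w: "world w" "box w (\<lambda>w'. a \<in> w' \<longrightarrow> b \<in> w')"
  then obtain F where F: "F \<subseteq> w" "finite F" "\<forall>w'. world w' \<longrightarrow> F \<subseteq> w' \<longrightarrow> a \<in> w' \<longrightarrow> b \<in> w'"
    by (auto simp: box_def)
  have "prv \<xi> (insert a F) b" by (rule prv_if_worlds) (use F in auto)
  then show "(a \<^bold>\<longrightarrow> b) \<in> w" using w F(1) by (auto intro: world_prv prv.ImplI)
qed

lemma sub_subst_up: "sub [t] 0 (subst_fm (up \<sigma>) a) = subst_fm (t \<bullet> \<sigma>) a"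
  by (simp add: sub_simps subst_fm_comp up_scons subst_tm_scons)

lemma holds_Fls [simp]: "world w \<Longrightarrow> \<not> holds w \<sigma> Fls"
  by (simp add: holds_def)

lemma holds_Conj [simp]: "world w \<Longrightarrow> holds w \<sigma> (a \<^bold>\<and> b) \<longleftrightarrow> holds w \<sigma> a \<and> holds w \<sigma> b"
  by (simp add: holds_def world_Conj)

lemma holds_Disj [simp]: "world w \<Longrightarrow> holds w \<sigma> (a \<^bold>\<or> b) \<longleftrightarrow> holds w \<sigma> a \<or> holds w \<sigma> b"
  by (simp add: holds_def world_Disj)

lemma holds_Impl:
  "world w \<Longrightarrow> holds w \<sigma> (a \<^bold>\<longrightarrow> b) \<longleftrightarrow> box w (\<lambda>w'. holds w' \<sigma> a \<longrightarrow> holds w' \<sigma> b)"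
  by (simp add: holds_def world_Impl)

lemma holds_mp: "world w \<Longrightarrow> holds w \<sigma> (a \<^bold>\<longrightarrow> b) \<Longrightarrow> holds w \<sigma> a \<Longrightarrow> holds w \<sigma> b"
  by (auto simp: holds_def intro: world_mp)

lemma holds_Exi [simp]: "world w \<Longrightarrow> holds w \<sigma> (Exi a) \<longleftrightarrow> (\<exists>t. holds w (t \<bullet> \<sigma>) a)"
proof
  assume w: "world w" "holds w \<sigma> (Exi a)"
  then obtain t where "sub [t] 0 (subst_fm (up \<sigma>) a) \<in> w"
    by (auto simp: holds_def sat_def)
  then show "\<exists>t. holds w (t \<bullet> \<sigma>) a" by (auto simp: holds_def sub_subst_up)
next
  assume w: "world w" "\<exists>t. holds w (t \<bullet> \<sigma>) a"
  then obtain t where "sub [t] 0 (subst_fm (up \<sigma>) a) \<in> w" by (auto simp: holds_def sub_subst_up)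
  then show "holds w \<sigma> (Exi a)" using w(1)
    by (auto simp: holds_def intro: world_closed prv.ExiI prv.Hyp)
qed

lemma holds_spec: "world w \<Longrightarrow> holds w \<sigma> (Uni a) \<Longrightarrow> holds w (t \<bullet> \<sigma>) a"
  unfolding holds_def sub_subst_up[symmetric]
  by (rule world_closed) (auto intro: prv.AllE prv.Hyp)

text \<open>Right to left, the finite part \<open>F\<close> has a fresh variable, so the term
  instances derived from it generalize by \<open>prv_AllI_terms\<close>.\<close>

lemma holds_Uni: "world w \<Longrightarrow> holds w \<sigma> (Uni a) \<longleftrightarrow> box w (\<lambda>w'. \<forall>t. holds w' (t \<bullet> \<sigma>) a)"
proof
  assume w: "world w" "holds w \<sigma> (Uni a)"
  show "box w (\<lambda>w'. \<forall>t. holds w' (t \<bullet> \<sigma>) a)"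
    by (rule boxI[OF pers_holds w(2,1)]) (auto intro: holds_spec)
next
  assume w: "world w" "box w (\<lambda>w'. \<forall>t. holds w' (t \<bullet> \<sigma>) a)"
  then obtain F where F: "F \<subseteq> w" "finite F" "\<forall>w'. world w' \<longrightarrow> F \<subseteq> w' \<longrightarrow> (\<forall>t. holds w' (t \<bullet> \<sigma>) a)"
    by (auto simp: box_def)
  have "prv \<xi> F (Uni (subst_fm (up \<sigma>) a))"
  proof (rule prv_AllI_terms[OF F(2)])
    fix t show "prv \<xi> F (sub [t] 0 (subst_fm (up \<sigma>) a))"
      by (rule prv_if_worlds[OF F(2)]) (use F(3) in \<open>auto simp: sub_subst_up holds_def\<close>)
  qed
  then show "holds w \<sigma> (Uni a)" using w F(1) by (auto simp: holds_def intro: world_prv)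
qed

text \<open>A quantified implication would unfold to two nested boxes; one suffices, because a box
  persists with the finite set that witnesses it.\<close>

lemma holds_Uni_Impl:
  assumes "world w"
  shows "holds w \<sigma> (Uni (a \<^bold>\<longrightarrow> b)) \<longleftrightarrow>
     box w (\<lambda>w'. \<forall>t. holds w' (t \<bullet> \<sigma>) a \<longrightarrow> holds w' (t \<bullet> \<sigma>) b)"
proof
  assume *: "holds w \<sigma> (Uni (a \<^bold>\<longrightarrow> b))"
  show "box w (\<lambda>w'. \<forall>t. holds w' (t \<bullet> \<sigma>) a \<longrightarrow> holds w' (t \<bullet> \<sigma>) b)"
    by (rule boxI[OF pers_holds * assms]) (auto intro: holds_mp holds_spec)
next
  assume *: "box w (\<lambda>w'. \<forall>t. holds w' (t \<bullet> \<sigma>) a \<longrightarrow> holds w' (t \<bullet> \<sigma>) b)"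
  have "box w (\<lambda>w'. \<forall>t. holds w' (t \<bullet> \<sigma>) (a \<^bold>\<longrightarrow> b))"
  proof (rule boxI[OF pers_box * assms], intro allI)
    fix w' t assume w': "world w'"
      and **: "box w' (\<lambda>w'. \<forall>t. holds w' (t \<bullet> \<sigma>) a \<longrightarrow> holds w' (t \<bullet> \<sigma>) b)"
    show "holds w' (t \<bullet> \<sigma>) (a \<^bold>\<longrightarrow> b)"
      unfolding holds_Impl[OF w'] using ** by (rule box_mono) blast
  qed
  then show "holds w \<sigma> (Uni (a \<^bold>\<longrightarrow> b))" using assms by (simp add: holds_Uni)
qed

lemma holds_Uni2_Impl:
  assumes "world w"
  shows "holds w \<sigma> (Uni (Uni (a \<^bold>\<longrightarrow> b))) \<longleftrightarrow>
     box w (\<lambda>w'. \<forall>s t. holds w' (t \<bullet> s \<bullet> \<sigma>) a \<longrightarrow> holds w' (t \<bullet> s \<bullet> \<sigma>) b)"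
proof -
  let ?P = "\<lambda>w'. \<forall>s t. holds w' (t \<bullet> s \<bullet> \<sigma>) a \<longrightarrow> holds w' (t \<bullet> s \<bullet> \<sigma>) b"
  have "holds w \<sigma> (Uni (Uni (a \<^bold>\<longrightarrow> b))) \<longleftrightarrow>
      box w (\<lambda>w'. \<forall>s. box w' (\<lambda>w'. \<forall>t. holds w' (t \<bullet> s \<bullet> \<sigma>) a \<longrightarrow> holds w' (t \<bullet> s \<bullet> \<sigma>) b))"
    (is "_ = box w ?Q")
    using assms by (simp add: holds_Uni[of _ _ "Uni _"] holds_Uni_Impl)
  also have "\<dots> \<longleftrightarrow> box w ?P"
  proof
    assume "box w ?Q"
    then show "box w ?P" by (rule box_mono) (use boxD in fastforce)
  next
    assume "box w ?P"
    then show "box w ?Q"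
      by (rule boxI[OF pers_box _ assms]) (blast intro: box_mono)
  qed
  finally show ?thesis .
qed

lemma holds_atoms [simp]:
  "holds w \<sigma> (t \<^bold>= u) \<longleftrightarrow> (subst_tm \<sigma> t \<^bold>= subst_tm \<sigma> u) \<in> w"
  "holds w \<sigma> (VS t) \<longleftrightarrow> VS (subst_tm \<sigma> t) \<in> w"
  "holds w \<sigma> (MC t) \<longleftrightarrow> MC (subst_tm \<sigma> t) \<in> w"
  "holds w \<sigma> (TC t) \<longleftrightarrow> TC (subst_tm \<sigma> t) \<in> w"
  "holds w \<sigma> (App t u v) \<longleftrightarrow> App (subst_tm \<sigma> t) (subst_tm \<sigma> u) (subst_tm \<sigma> v) \<in> w"
  "holds w \<sigma> (El t u v) \<longleftrightarrow> El (subst_tm \<sigma> t) (subst_tm \<sigma> u) (subst_tm \<sigma> v) \<in> w"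
  "holds w \<sigma> (InEL t u) \<longleftrightarrow> InEL (subst_tm \<sigma> t) (subst_tm \<sigma> u) \<in> w"
  by (simp_all add: holds_def)

lemma holds_subst [simp]:
  "holds w \<sigma> (subst_fm \<tau> a) \<longleftrightarrow> holds w (\<lambda>i. subst_tm \<sigma> (\<tau> i)) a"
  by (simp add: holds_def subst_fm_comp)

lemma holds_sub [simp]:
  "holds w \<sigma> (sub [t] d a) \<longleftrightarrow> holds w (subst_tm \<sigma> t \<bullet> (\<lambda>i. \<sigma> (i + d))) a"
  "holds w \<sigma> (sub [t, u] d a) \<longleftrightarrow>
     holds w (subst_tm \<sigma> t \<bullet> subst_tm \<sigma> u \<bullet> (\<lambda>i. \<sigma> (i + d))) a"
  by (simp_all add: sub_simps subst_tm_scons)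

section \<open>Terms up to provable equality\<close>

text \<open>Choosing representatives turns provable equality in a world into equality of the meta-logic, so
  that the simplifier can compute with primitive recursive functions.\<close>

definition norm :: "fm set \<Rightarrow> tm \<Rightarrow> tm" where
  "norm w t = (SOME u. (t \<^bold>= u) \<in> w)"

lemma world_refl: "world w \<Longrightarrow> (t \<^bold>= t) \<in> w"
  by (auto intro: world_closed prv.EqI)

lemma world_Leibniz:
  assumes "world w" "(t \<^bold>= u) \<in> w" "holds w (t \<bullet> \<sigma>) a"
  shows "holds w (u \<bullet> \<sigma>) a"
proof -
  have "prv \<xi> w (sub [u] 0 (subst_fm (up \<sigma>) a))"
    by (rule prv.EqE[of _ _ t]) (use assms in \<open>auto simp: holds_def sub_subst_up intro: prv.Hyp\<close>)
  then show ?thesis using assms(1) by (auto simp: holds_def sub_subst_up intro: world_closed)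
qed

lemma world_sym: "world w \<Longrightarrow> (t \<^bold>= u) \<in> w \<Longrightarrow> (u \<^bold>= t) \<in> w"
  using world_Leibniz[of w t u "t \<bullet> Var" "Var 0 \<^bold>= Var 1"] by (simp add: world_refl)

lemma world_trans: "world w \<Longrightarrow> (t \<^bold>= u) \<in> w \<Longrightarrow> (u \<^bold>= v) \<in> w \<Longrightarrow> (t \<^bold>= v) \<in> w"
  using world_Leibniz[of w u v "t \<bullet> Var" "Var 1 \<^bold>= Var 0"] by simp

lemma norm_spec: "world w \<Longrightarrow> (t \<^bold>= norm w t) \<in> w"
  unfolding norm_def by (rule someI) (rule world_refl)

lemma world_Eq [simp]: "world w \<Longrightarrow> (t \<^bold>= u) \<in> w \<longleftrightarrow> norm w t = norm w u"
proof
  assume w: "world w" "(t \<^bold>= u) \<in> w"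
  then have "(t \<^bold>= v) \<in> w \<longleftrightarrow> (u \<^bold>= v) \<in> w" for v
    by (meson world_sym world_trans)
  then show "norm w t = norm w u" by (simp add: norm_def)
next
  assume w: "world w" "norm w t = norm w u"
  from norm_spec[OF w(1)] show "(t \<^bold>= u) \<in> w" using w by (metis world_sym world_trans)
qed

lemma norm_norm [simp]: "world w \<Longrightarrow> norm w (norm w t) = norm w t"
  using norm_spec[of w t] by simp

lemma holds_cong:
  "world w \<Longrightarrow> norm w t = norm w u \<Longrightarrow> holds w (t \<bullet> \<sigma>) a \<longleftrightarrow> holds w (u \<bullet> \<sigma>) a"
  by (metis world_Eq world_Leibniz)

lemma holds_cong2:
  assumes "world w" "norm w t = norm w t'" "norm w u = norm w u'"
  shows "holds w (t \<bullet> u \<bullet> \<sigma>) a \<longleftrightarrow> holds w (t' \<bullet> u' \<bullet> \<sigma>) a"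
proof -
  \<comment> \<open>Swapping the variables 0 and 1 brings the second term to the front, where
    Leibniz's rule acts.\<close>
  let ?a = "subst_fm (Var 1 \<bullet> Var 0 \<bullet> (\<lambda>i. Var (i + 2))) a"
  have *: "holds w (t \<bullet> u \<bullet> \<sigma>) a \<longleftrightarrow> holds w (u \<bullet> t \<bullet> \<sigma>) ?a" for t u
    by (simp add: subst_tm_scons)
  have "holds w (t \<bullet> u \<bullet> \<sigma>) a \<longleftrightarrow> holds w (t' \<bullet> u \<bullet> \<sigma>) a" by (rule holds_cong[OF assms(1,2)])
  also have "\<dots> \<longleftrightarrow> holds w (u \<bullet> t' \<bullet> \<sigma>) ?a" by (rule *)
  also have "\<dots> \<longleftrightarrow> holds w (u' \<bullet> t' \<bullet> \<sigma>) ?a" by (rule holds_cong[OF assms(1,3)])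
  also have "\<dots> \<longleftrightarrow> holds w (t' \<bullet> u' \<bullet> \<sigma>) a" by (rule *[symmetric])
  finally show ?thesis .
qed

lemma VS_cong: "world w \<Longrightarrow> norm w t = norm w u \<Longrightarrow> VS t \<in> w \<longleftrightarrow> VS u \<in> w"
  using holds_cong[of w t u Var "VS (Var 0)"] by simp

lemma MC_cong: "world w \<Longrightarrow> norm w t = norm w u \<Longrightarrow> MC t \<in> w \<longleftrightarrow> MC u \<in> w"
  using holds_cong[of w t u Var "MC (Var 0)"] by simp

lemma TC_cong: "world w \<Longrightarrow> norm w t = norm w u \<Longrightarrow> TC t \<in> w \<longleftrightarrow> TC u \<in> w"
  using holds_cong[of w t u Var "TC (Var 0)"] by simp

lemma App_cong:
  assumes "world w" "norm w e = norm w e'" "norm w n = norm w n'" "norm w m = norm w m'"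
  shows "App e n m \<in> w \<longleftrightarrow> App e' n' m' \<in> w"
  using holds_cong[OF assms(1,2), of "n \<bullet> m \<bullet> Var" "App (Var 0) (Var 1) (Var 2)"]
    holds_cong2[OF assms(1,3,4), of "e' \<bullet> Var" "App (Var 2) (Var 0) (Var 1)"]
  by simp

lemma InEL_cong:
  assumes "world w" "norm w t = norm w t'" "norm w u = norm w u'"
  shows "InEL t u \<in> w \<longleftrightarrow> InEL t' u' \<in> w"
  using holds_cong2[OF assms, of Var "InEL (Var 0) (Var 1)"] by simp

text \<open>Leibniz's rule replaces one argument at a time; \<open>vs\<close> accumulates those
  already replaced.\<close>

lemma norm_Fn_aux:
  assumes "world w" "length ts = length us" "\<And>i. i < length ts \<Longrightarrow> norm w (ts ! i) = norm w (us ! i)"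
  shows "norm w (Fn f (vs @ ts)) = norm w (Fn f (vs @ us))"
  using assms(2,3)
proof (induction ts us arbitrary: vs rule: list_induct2)
  case (Cons t ts u us)
  have "norm w (Fn f (vs @ t # ts)) = norm w (Fn f (vs @ u # ts))"
    using world_Leibniz[of w t u Var "Fn f (map lift_tm (vs @ t # ts)) \<^bold>=
        Fn f (map lift_tm vs @ Var 0 # map lift_tm ts)"] Cons.prems[of 0] assms(1)
    by (simp add: comp_def)
  also have "\<dots> = norm w (Fn f ((vs @ [u]) @ us))"
    using Cons.IH[of "vs @ [u]"] Cons.prems[of "Suc _"] by fastforce
  finally show ?case by simp
qed simp

text \<open>With \<open>Sq\<close> and \<open>Zq\<close>, the operations of the quotient of the
  terms by provable equality in \<open>w\<close>, acting on representatives.\<close>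

definition Fq :: "fm set \<Rightarrow> prim \<Rightarrow> tm list \<Rightarrow> tm" where "Fq w f ts = norm w (Fn f ts)"
definition Sq :: "fm set \<Rightarrow> tm \<Rightarrow> tm" where "Sq w t = norm w (Succ t)"
definition Zq :: "fm set \<Rightarrow> tm" where "Zq w = norm w Zero"

lemma Fq_norm_map: "world w \<Longrightarrow> Fq w f (map (norm w) ts) = Fq w f ts"
  using norm_Fn_aux[of w "map (norm w) ts" ts f "[]"] by (simp add: Fq_def)

text \<open>Dropping inner normalizations gives equal arguments the same shape, for the arities that
  occur in the computations.\<close>

lemma Fq_absorb [simp]:
  "world w \<Longrightarrow> Fq w f [norm w x] = Fq w f [x]"
  "world w \<Longrightarrow> Fq w f [norm w x, y] = Fq w f [x, y]"
  "world w \<Longrightarrow> Fq w f [x, norm w y] = Fq w f [x, y]"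
  "world w \<Longrightarrow> Fq w f [norm w x, y, z] = Fq w f [x, y, z]"
  "world w \<Longrightarrow> Fq w f [x, norm w y, z] = Fq w f [x, y, z]"
  "world w \<Longrightarrow> Fq w f [x, y, norm w z] = Fq w f [x, y, z]"
  by (subst (1 2) Fq_norm_map[symmetric]; simp)+

lemma norm_Succ: "world w \<Longrightarrow> norm w (Succ t) = Sq w (norm w t)"
  using world_Leibniz[of w t "norm w t" Var "Succ (lift_tm t) \<^bold>= Succ (Var 0)"] by (simp add: Sq_def)

lemma norm_simps [simp]:
  "world w \<Longrightarrow> norm w (Fn f ts) = Fq w f (map (norm w) ts)"
  "world w \<Longrightarrow> norm w (Succ t) = Sq w (norm w t)"
  "world w \<Longrightarrow> norm w Zero = Zq w"
  "world w \<Longrightarrow> Sq w (norm w t) = Sq w t"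
  "world w \<Longrightarrow> norm w (Fq w f ts) = Fq w f ts"
  "world w \<Longrightarrow> norm w (Sq w t) = Sq w t"
  "world w \<Longrightarrow> norm w (Zq w) = Zq w"
  using norm_Succ[of w t] by (simp_all only: Fq_norm_map) (simp_all only: Fq_def Sq_def Zq_def norm_norm)

lemma Sq_Zq [simp]: "world w \<Longrightarrow> Sq w t \<noteq> Zq w" "world w \<Longrightarrow> Zq w \<noteq> Sq w t"
  using axm_world[OF _ axm.Succ_Zero, of w t] world_mp[of w "Succ t \<^bold>= Zero" Fls] by auto

lemma Sq_Sq [simp]: "world w \<Longrightarrow> Sq w t = Sq w u \<longleftrightarrow> norm w t = norm w u"
  using axm_world[OF _ axm.Succ_inj, of w t u] world_mp[of w "Succ t \<^bold>= Succ u" "t \<^bold>= u"]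
  by auto (metis norm_simps(4))

lemma Fq_Zr [simp]: "world w \<Longrightarrow> Fq w Zr ts = Zq w"
  using axm_world[OF _ axm.Zr, of w ts] by (simp add: Fq_norm_map)

lemma Fq_Sc [simp]: "world w \<Longrightarrow> Fq w Sc [t] = Sq w t"
  using axm_world[OF _ axm.Sc, of w t] by (simp add: Fq_norm_map)

lemma Fq_Pj [simp]: "world w \<Longrightarrow> i < length ts \<Longrightarrow> Fq w (Pj i) ts = norm w (ts ! i)"
  using axm_world[OF _ axm.Pj, of w i ts] by (simp add: Fq_norm_map)

lemma Fq_Cn [simp]: "world w \<Longrightarrow> Fq w (Cn f gs) ts = Fq w f (map (\<lambda>g. Fq w g ts) gs)"
  using axm_world[OF _ axm.Cn, of w f gs ts] by (simp add: Fq_norm_map comp_def)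

lemma Fq_Pr_Zq: "world w \<Longrightarrow> Fq w (Pr f g) (Zq w # ts) = Fq w f ts"
  using axm_world[OF _ axm.Pr_Zero, of w f g ts]
    Fq_norm_map[of w "Pr f g" "Zero # ts"] Fq_norm_map[of w "Pr f g" "Zq w # ts"]
  by (simp add: Fq_norm_map)

lemma Fq_Pr_Sq:
  "world w \<Longrightarrow> Fq w (Pr f g) (Sq w t # ts) = Fq w g (t # Fq w (Pr f g) (t # ts) # ts)"
  using axm_world[OF _ axm.Pr_Succ, of w f g t ts]
    Fq_norm_map[of w "Pr f g" "Sq w t # ts"] Fq_norm_map[of w "Pr f g" "t # ts"]
    Fq_norm_map[of w g "t # Fq w (Pr f g) (t # ts) # ts"]
  by simp

text \<open>The step must hold under a box because the induction axiom has a universally quantified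
  implication as its premise.\<close>

lemma induct_world:
  assumes w: "world w" and "holds w (Zero \<bullet> \<sigma>) a"
    and "box w (\<lambda>w'. \<forall>t. holds w' (t \<bullet> \<sigma>) a \<longrightarrow> holds w' (Succ t \<bullet> \<sigma>) a)"
  shows "holds w (t \<bullet> \<sigma>) a"
proof -
  have "subst_fm \<sigma> (sub [Zero] 0 a \<^bold>\<longrightarrow> \<^bold>\<forall> (a \<^bold>\<longrightarrow> sub [Succ (Var 0)] 1 a) \<^bold>\<longrightarrow> \<^bold>\<forall> a) \<in> w"
    by (intro axm_world[OF w] axm_subst axm.Ind)
  then have "holds w \<sigma> (sub [Zero] 0 a \<^bold>\<longrightarrow> \<^bold>\<forall> (a \<^bold>\<longrightarrow> sub [Succ (Var 0)] 1 a) \<^bold>\<longrightarrow> \<^bold>\<forall> a)"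
    by (simp add: holds_def)
  moreover have "holds w \<sigma> (sub [Zero] 0 a)" using assms by simp
  moreover have "holds w \<sigma> (\<^bold>\<forall> (a \<^bold>\<longrightarrow> sub [Succ (Var 0)] 1 a))"
    using assms by (simp add: holds_Uni_Impl)
  ultimately have "holds w \<sigma> (\<^bold>\<forall> a)" using w by (meson holds_mp)
  then show ?thesis using w by (rule holds_spec[rotated])
qed

lemma induct_worlds:
  assumes "world w" "\<And>w. world w \<Longrightarrow> holds w (Zero \<bullet> \<sigma>) a"
    and "\<And>w t. world w \<Longrightarrow> holds w (t \<bullet> \<sigma>) a \<Longrightarrow> holds w (Succ t \<bullet> \<sigma>) a"
  shows "holds w (t \<bullet> \<sigma>) a"
  by (rule induct_world[OF assms(1) assms(2)[OF assms(1)] box_necessitation])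
    (use assms(3) in blast)

section \<open>Arithmetic\<close>

lemma pAdd_simps [simp]:
  "world w \<Longrightarrow> Fq w pAdd [Zq w, y] = norm w y"
  "world w \<Longrightarrow> Fq w pAdd [Sq w x, y] = Sq w (Fq w pAdd [x, y])"
  by (simp_all add: pAdd_def Fq_Pr_Zq Fq_Pr_Sq)

lemma pAdd_Zq_right [simp]: "world w \<Longrightarrow> Fq w pAdd [x, Zq w] = norm w x"
proof -
  assume w: "world w"
  have "holds w (x \<bullet> Var) (Fn pAdd [Var 0, Zero] \<^bold>= Var 0)"
    by (rule induct_worlds[OF w]) simp_all
  then show ?thesis using w by simp
qed

lemma pAdd_Sq_right [simp]: "world w \<Longrightarrow> Fq w pAdd [x, Sq w y] = Sq w (Fq w pAdd [x, y])"
proof -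
  assume w: "world w"
  have "holds w (x \<bullet> y \<bullet> Var) (Fn pAdd [Var 0, Succ (Var 1)] \<^bold>= Succ (Fn pAdd [Var 0, Var 1]))"
    by (rule induct_worlds[OF w]) simp_all
  then show ?thesis using w by simp
qed

lemma pAdd_comm: "world w \<Longrightarrow> Fq w pAdd [x, y] = Fq w pAdd [y, x]"
proof -
  assume w: "world w"
  have "holds w (x \<bullet> y \<bullet> Var) (Fn pAdd [Var 0, Var 1] \<^bold>= Fn pAdd [Var 1, Var 0])"
    by (rule induct_worlds[OF w]) simp_all
  then show ?thesis using w by simp
qed

lemma pPred_simps [simp]:
  "world w \<Longrightarrow> Fq w pPred [Zq w] = Zq w"
  "world w \<Longrightarrow> Fq w pPred [Sq w x] = norm w x"
  by (simp_all add: pPred_def Fq_Pr_Zq Fq_Pr_Sq)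

lemma pMonus_simps [simp]:
  "world w \<Longrightarrow> Fq w pMonus [x, Zq w] = norm w x"
  "world w \<Longrightarrow> Fq w pMonus [x, Sq w y] = Fq w pPred [Fq w pMonus [x, y]]"
  by (simp_all add: pMonus_def Fq_Pr_Zq Fq_Pr_Sq)

lemma pMonus_Sq_Sq: "world w \<Longrightarrow> Fq w pMonus [Sq w x, Sq w y] = Fq w pMonus [x, y]"
proof -
  assume w: "world w"
  have "holds w (y \<bullet> x \<bullet> Var) (Fn pMonus [Succ (Var 1), Succ (Var 0)] \<^bold>= Fn pMonus [Var 1, Var 0])"
    by (rule induct_worlds[OF w]) simp_all
  then show ?thesis using w by simp
qed

lemma pMonus_cancel: "world w \<Longrightarrow> Fq w pMonus [Fq w pAdd [z, x], Fq w pAdd [z, y]] = Fq w pMonus [x, y]"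
proof -
  assume w: "world w"
  have "holds w (z \<bullet> x \<bullet> y \<bullet> Var)
      (Fn pMonus [Fn pAdd [Var 0, Var 1], Fn pAdd [Var 0, Var 2]] \<^bold>= Fn pMonus [Var 1, Var 2])"
    by (rule induct_worlds[OF w]) (simp_all add: pMonus_Sq_Sq del: pMonus_simps(2))
  then show ?thesis using w by simp
qed

lemma pMonus_add_left: "world w \<Longrightarrow> Fq w pMonus [Fq w pAdd [x, y], x] = norm w y"
  using pMonus_cancel[of w x y "Zq w"] by simp

lemma pTri_simps [simp]:
  "world w \<Longrightarrow> Fq w pTri [Zq w] = Zq w"
  "world w \<Longrightarrow> Fq w pTri [Sq w x] = Sq w (Fq w pAdd [x, Fq w pTri [x]])"
  by (simp_all add: pTri_def Fq_Pr_Zq Fq_Pr_Sq)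

lemma pIfz_simps [simp]:
  "world w \<Longrightarrow> Fq w pIfz [Zq w, x, y] = norm w x"
  "world w \<Longrightarrow> Fq w pIfz [Sq w z, x, y] = norm w y"
  by (simp_all add: pIfz_def Fq_Pr_Zq Fq_Pr_Sq)

section \<open>Inverting the Cantor pairing inside the theory\<close>

lemma pDiag_simps:
  "world w \<Longrightarrow> Fq w pDiag [Zq w] = Zq w"
  "world w \<Longrightarrow> Fq w pDiag [Sq w x] =
    Fq w pIfz [Fq w pMonus [Fq w pTri [Sq w (Fq w pDiag [x])], Sq w x],
      Sq w (Fq w pDiag [x]), Fq w pDiag [x]]"
  by (simp_all add: pDiag_def Fq_Pr_Zq Fq_Pr_Sq)

text \<open>The number is at position \<open>x\<close> of diagonal \<open>d\<close> with
  \<open>y\<close> steps left. After cancelling the triangle, the test in \<open>pDiag\<close>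
  computes \<open>d - x = y\<close>, so the successor leaves the diagonal exactly when
  \<open>y\<close> is zero.\<close>

lemma pDiag_step:
  assumes w: "world w" and d: "Fq w pDiag [Fq w pAdd [Fq w pTri [d], x]] = norm w d"
    and xy: "Fq w pAdd [x, y] = norm w d"
  shows "Fq w pDiag [Sq w (Fq w pAdd [Fq w pTri [d], x])] = Fq w pIfz [y, Sq w d, d]"
proof -
  have "Fq w pMonus [Fq w pTri [Sq w d], Sq w (Fq w pAdd [Fq w pTri [d], x])]
      = Fq w pMonus [Fq w pAdd [Fq w pTri [d], d], Fq w pAdd [Fq w pTri [d], x]]"
    using w pMonus_Sq_Sq[OF w] pAdd_comm[OF w, of d] by (simp del: pMonus_simps)
  also have "\<dots> = Fq w pMonus [Fq w pAdd [x, y], x]"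
    using w xy by (simp add: pMonus_cancel)
  also have "\<dots> = norm w y" using w by (rule pMonus_add_left)
  finally show ?thesis using w d by (simp add: pDiag_simps del: pMonus_simps pTri_simps)
qed

text \<open>Induction along the diagonal. The distance \<open>y\<close> to its end shrinks as
  \<open>x\<close> grows, hence the quantifier over \<open>y\<close> in the induction
  formula.\<close>

lemma pDiag_row:
  assumes w: "world w" and d: "Fq w pDiag [Fq w pTri [d]] = norm w d"
    and xy: "Fq w pAdd [x, y] = norm w d"
  shows "Fq w pDiag [Fq w pAdd [Fq w pTri [d], x]] = norm w d"
proof -
  let ?a = "\<^bold>\<forall> (Fn pAdd [Var 1, Var 0] \<^bold>= Var 2 \<^bold>\<longrightarrow> Fn pDiag [Fn pAdd [Fn pTri [Var 2], Var 1]] \<^bold>= Var 2)"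
  have "holds w (x \<bullet> d \<bullet> Var) ?a"
  proof (rule induct_world[OF w])
    have "box w (\<lambda>w. \<forall>y. Fq w pAdd [Zq w, y] = norm w d \<longrightarrow> Fq w pDiag [Fq w pTri [d]] = norm w d)"
      by (rule boxI[of "\<lambda>w. (Fn pDiag [Fn pTri [d]] \<^bold>= d) \<in> w"])
        (use w d in \<open>auto intro: pers_intros\<close>)
    then show "holds w (Zero \<bullet> d \<bullet> Var) ?a" using w by (simp add: holds_Uni_Impl)
  next
    show "box w (\<lambda>w. \<forall>x. holds w (x \<bullet> d \<bullet> Var) ?a \<longrightarrow> holds w (Succ x \<bullet> d \<bullet> Var) ?a)"
    proof (rule box_necessitation, intro allI impI)
      fix w x assume w: "world w" and IH: "holds w (x \<bullet> d \<bullet> Var) ?a"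
      have "box w (\<lambda>w. \<forall>y. Fq w pAdd [Sq w x, y] = norm w d \<longrightarrow>
          Fq w pDiag [Fq w pAdd [Fq w pTri [d], Sq w x]] = norm w d)"
      proof (rule boxI[OF pers_holds IH w], intro allI impI)
        fix w y assume w: "world w" and IH: "holds w (x \<bullet> d \<bullet> Var) ?a"
          and y: "Fq w pAdd [Sq w x, y] = norm w d"
        \<comment> \<open>One position earlier the distance to the end was larger by one, hence not
          zero, and \<open>pDiag_step\<close> stays on the diagonal.\<close>
        have *: "Fq w pAdd [x, Sq w y] = norm w d" using w y by simp
        moreover have "Fq w pDiag [Fq w pAdd [Fq w pTri [d], x]] = norm w d"
          using holds_mp[OF w holds_spec[OF w IH, of "Sq w y"]] w * by simp
        ultimately show "Fq w pDiag [Fq w pAdd [Fq w pTri [d], Sq w x]] = norm w d"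
          using w pDiag_step[OF w, of d x "Sq w y"] by simp
      qed
      then show "holds w (Succ x \<bullet> d \<bullet> Var) ?a" using w by (simp add: holds_Uni_Impl)
    qed
  qed
  from holds_mp[OF w holds_spec[OF w this, of y]] show ?thesis using w xy by simp
qed

text \<open>The start of diagonal \<open>d + 1\<close> is the successor of the last position of
  diagonal \<open>d\<close>, the one with \<open>x = d\<close> and \<open>y = 0\<close>.\<close>

lemma pDiag_pTri: "world w \<Longrightarrow> Fq w pDiag [Fq w pTri [d]] = norm w d"
proof -
  assume w: "world w"
  have "holds w (d \<bullet> Var) (Fn pDiag [Fn pTri [Var 0]] \<^bold>= Var 0)"
  proof (rule induct_worlds[OF w])
    fix w d assume w: "world w" and "holds w (d \<bullet> Var) (Fn pDiag [Fn pTri [Var 0]] \<^bold>= Var 0)"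
    then have "Fq w pDiag [Fq w pTri [d]] = norm w d" by simp
    then have "Fq w pDiag [Fq w pAdd [Fq w pTri [d], d]] = norm w d"
      by (rule pDiag_row[OF w, of _ _ "Zq w"]) (simp add: w)
    from pDiag_step[OF w this, of "Zq w"] show "holds w (Succ d \<bullet> Var) (Fn pDiag [Fn pTri [Var 0]] \<^bold>= Var 0)"
      using w pAdd_comm[OF w, of d] by simp
  qed (simp add: pDiag_simps)
  then show ?thesis using w by simp
qed

lemma pPair_Fq: "world w \<Longrightarrow> Fq w pPair [x, y] = Fq w pAdd [Fq w pTri [Fq w pAdd [x, y]], x]"
  by (simp add: pPair_def)

lemma pDiag_pPair: "world w \<Longrightarrow> Fq w pDiag [Fq w pPair [x, y]] = Fq w pAdd [x, y]"
  using pDiag_row[of w "Fq w pAdd [x, y]" x y] by (simp add: pDiag_pTri pPair_Fq)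

lemma pLeft_pPair [simp]: "world w \<Longrightarrow> Fq w pLeft [Fq w pPair [x, y]] = norm w x"
  by (simp add: pLeft_def pDiag_pPair) (simp add: pPair_Fq pMonus_add_left)

lemma pRight_pPair [simp]: "world w \<Longrightarrow> Fq w pRight [Fq w pPair [x, y]] = norm w y"
  by (simp add: pRight_def pDiag_pPair pMonus_add_left)

abbreviation Pair :: "tm \<Rightarrow> tm \<Rightarrow> tm" where "Pair t u \<equiv> Fn pPair [t, u]"

section \<open>Case distinction and comparison of numbers\<close>

lemma zero_or_succ: "world w \<Longrightarrow> norm w t = Zq w \<or> (\<exists>s. norm w t = Sq w s)"
proof -
  assume w: "world w"
  have "holds w (t \<bullet> Var) (Var 0 \<^bold>= Zero \<^bold>\<or> \<^bold>\<exists> (Var 1 \<^bold>= Succ (Var 0)))"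
    by (rule induct_worlds[OF w]) auto
  then show ?thesis using w by simp
qed

text \<open>Order is expressed by differences, so the comparison of two numerals later becomes an
  induction on the difference.\<close>

lemma le_or_greater:
  "world w \<Longrightarrow> (\<exists>d. norm w j = Fq w pAdd [k, d]) \<or> (\<exists>d. norm w k = Fq w pAdd [j, Sq w d])"
proof -
  assume w: "world w"
  let ?a = "\<^bold>\<exists> (Var 2 \<^bold>= Fn pAdd [Var 1, Var 0]) \<^bold>\<or> \<^bold>\<exists> (Var 1 \<^bold>= Fn pAdd [Var 2, Succ (Var 0)])"
  have "holds w (k \<bullet> j \<bullet> Var) ?a"
  proof (rule induct_worlds[OF w])
    fix w k assume w: "world w" and "holds w (k \<bullet> j \<bullet> Var) ?a"
    then consider d where "norm w j = Fq w pAdd [k, d]" | d where "norm w k = Fq w pAdd [j, Sq w d]"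
      by auto
    then show "holds w (Succ k \<bullet> j \<bullet> Var) ?a"
    proof cases
      case 1
      consider "norm w d = Zq w" | s where "norm w d = Sq w s" using zero_or_succ[OF w] by blast
      then show ?thesis
      proof cases
        case d: 1
        have "norm w j = norm w k" using 1 w d Fq_absorb(3)[OF w, of pAdd k d] by simp
        then have "norm w k = Fq w pAdd [j, Zq w]" using w by simp
        then show ?thesis using w by (simp del: pAdd_Zq_right) blast
      next
        case d: 2
        have "norm w j = norm w (Fn pAdd [Succ k, s])"
          using 1 w d Fq_absorb(3)[OF w, of pAdd k d] by simp
        then show ?thesis using w by auto
      qed
    next
      case 2
      then have "holds w (Sq w d \<bullet> Succ k \<bullet> j \<bullet> Var) (Var 1 \<^bold>= Fn pAdd [Var 2, Succ (Var 0)])"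
        using w by simp
      then show ?thesis using holds_Disj[OF w] holds_Exi[OF w] by blast
    qed
  qed auto
  then show ?thesis using w by simp
qed

section \<open>Kleene application\<close>

lemma App_iff: "world w \<Longrightarrow> App e n m \<in> w \<longleftrightarrow> (\<exists>k. Fq w pRun [k, e, n] = Fq w pFinal [m])"
proof -
  assume w: "world w"
  have "App e n m \<in> w \<longleftrightarrow> holds w Var (App e n m)" by (simp add: holds_def)
  also have "\<dots> \<longleftrightarrow> (\<exists>k. Fq w pRun [k, e, n] = Fq w pFinal [m])"
    unfolding App_def using w by simp
  finally show ?thesis .
qed

lemma Fq_ifz_Zq: "world w \<Longrightarrow> Fq w f ts = Zq w \<Longrightarrow> Fq w (ifz' f g h) ts = Fq w g ts"
  by simp

lemma Fq_ifz_Sq: "world w \<Longrightarrow> Fq w f ts = Sq w k \<Longrightarrow> Fq w (ifz' f g h) ts = Fq w h ts"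
  by simp

text \<open>A tag equal to the number of cases skips them all. The eight cases of
  \<open>pCallStep\<close> make 8 the first tag without an instruction.\<close>

lemma Fq_switch_default:
  "world w \<Longrightarrow> Fq w f ts = (Sq w ^^ length gs) (Zq w) \<Longrightarrow> Fq w (switch' f gs d) ts = Fq w d ts"
proof (induction gs arbitrary: f)
  case (Cons g gs)
  have "norm w ((Sq w ^^ length gs) (Zq w)) = (Sq w ^^ length gs) (Zq w)"
    using Cons.prems by (cases "length gs") simp_all
  with Cons show ?case by (simp add: Fq_ifz_Sq del: Fq_Cn) simp
qed simp

lemma pRun_simps [simp]:
  "world w \<Longrightarrow> Fq w pRun [Zq w, e, n] = Fq w pPair [Zq w, Fq w pPair [e, Fq w pPair [n, Zq w]]]"
  "world w \<Longrightarrow> Fq w pRun [Sq w k, e, n] = Fq w pStep [Fq w pRun [k, e, n]]"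
  by (simp_all add: pRun_def Fq_Pr_Zq Fq_Pr_Sq call'_def)

lemma pFinal_simp: "world w \<Longrightarrow> Fq w pFinal [m] = Fq w pPair [Sq w (Zq w), Fq w pPair [m, Zq w]]"
  by (simp add: pFinal_def ret'_def)

lemma pStep_pFinal [simp]: "world w \<Longrightarrow> Fq w pStep [Fq w pFinal [m]] = Fq w pFinal [m]"
proof -
  assume w: "world w"
  \<comment> \<open>The stack is empty, so the first test returns the configuration unchanged;
    rewriting by \<open>Fq_ifz_Zq\<close> leaves the other branch unexpanded.\<close>
  have "Fq w pRetStep [Fq w pFinal [m]] = Fq w pFinal [m]"
    unfolding pRetStep_def Let_def
    by (subst Fq_ifz_Zq[OF w]) (simp_all add: w pFinal_simp)
  then show ?thesis using w by (simp add: pStep_def pFinal_simp)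
qed

lemma pRun_add:
  assumes w: "world w" and "Fq w pRun [k, e, n] = Fq w pFinal [m]"
  shows "Fq w pRun [Fq w pAdd [j, k], e, n] = Fq w pFinal [m]"
proof -
  have "holds w (j \<bullet> k \<bullet> e \<bullet> n \<bullet> m \<bullet> Var)
      (Fn pRun [Fn pAdd [Var 0, Var 1], Var 2, Var 3] \<^bold>= Fn pFinal [Var 4])"
    by (rule induct_world[OF w _ box_necessitation]) (use assms in auto)
  then show ?thesis using w by simp
qed

text \<open>If the two runs halt after \<open>k\<close> and \<open>k'\<close> steps, both have
  halted after \<open>k + k'\<close> steps, where their final configurations coincide. Projections
  recover the values.\<close>

lemma App_functional:
  assumes w: "world w" and "App e n m \<in> w" "App e n m' \<in> w"
  shows "norm w m = norm w m'"
proof -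
  obtain k k' where k: "Fq w pRun [k, e, n] = Fq w pFinal [m]" "Fq w pRun [k', e, n] = Fq w pFinal [m']"
    using assms App_iff[OF w] by blast
  have "Fq w pFinal [m] = Fq w pFinal [m']"
    using pRun_add[OF w k(1), of k'] pRun_add[OF w k(2), of k] pAdd_comm[OF w, of k k'] by simp
  then have "Fq w pLeft [Fq w pRight [Fq w pFinal [m]]] = Fq w pLeft [Fq w pRight [Fq w pFinal [m']]]"
    by simp
  then show ?thesis using w by (simp add: pFinal_simp)
qed

text \<open>The tag \<open>8\<close> is not used by any constructor of indices.\<close>

definition empty_index :: tm where
  "empty_index = Pair ((Succ ^^ 8) Zero) Zero"

lemma subst_empty_index [simp]: "subst_tm \<sigma> empty_index = empty_index"
  by (simp add: empty_index_def numeral_eq_Suc)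

text \<open>The initial configuration is a fixed point of the machine. Its tag is 0, while final
  configurations have tag 1.\<close>

lemma App_empty_index: "world w \<Longrightarrow> App empty_index n m \<notin> w"
proof
  assume w: "world w" and "App empty_index n m \<in> w"
  then obtain k where k: "Fq w pRun [k, empty_index, n] = Fq w pFinal [m]" using App_iff by blast
  have step: "Fq w pStep [Fq w pRun [Zq w, empty_index, n]] = Fq w pRun [Zq w, empty_index, n]"
    if w: "world w" for w n
  proof -
    let ?c = "Fq w pRun [Zq w, empty_index, n]"
    have "Fq w (left' (left' (right' (Pj 0)))) [?c] = (Sq w ^^ 8) (Zq w)"
      using w by (simp add: empty_index_def numeral_eq_Suc)
    then have "Fq w pCallStep [?c] = ?c"
      unfolding pCallStep_def Let_def
      by (subst Fq_switch_default[OF w]) (simp_all add: w numeral_eq_Suc)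
    then show ?thesis using w by (simp add: pStep_def)
  qed
  have "holds w (k \<bullet> n \<bullet> Var) (Fn pRun [Var 0, empty_index, Var 1] \<^bold>= Fn pRun [Zero, empty_index, Var 1])"
    by (rule induct_worlds[OF w])
      (simp_all add: step del: pRun_simps(1))
  then have "Fq w pRun [Zq w, empty_index, n] = Fq w pFinal [m]"
    using w k by (simp del: pRun_simps(1))
  then have "Fq w pLeft [Fq w pRun [Zq w, empty_index, n]] = Fq w pLeft [Fq w pFinal [m]]" by simp
  then show False using w by (simp add: pFinal_simp)
qed

section \<open>Church's thesis and its consequences\<close>

text \<open>Collapses the nested boxes that iterated universal quantifiers produce.\<close>

lemma box_all_box:
  assumes "world w"
  shows "box w (\<lambda>w'. \<forall>t. box w' (P t)) \<longleftrightarrow> box w (\<lambda>w'. \<forall>t. P t w')"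
proof
  assume "box w (\<lambda>w'. \<forall>t. box w' (P t))"
  then show "box w (\<lambda>w'. \<forall>t. P t w')" by (rule box_mono) (blast intro: boxD)
next
  assume "box w (\<lambda>w'. \<forall>t. P t w')"
  then show "box w (\<lambda>w'. \<forall>t. box w' (P t))"
    by (rule boxI[OF pers_box _ assms]) (blast intro: box_mono)
qed

lemma ECT_world:
  assumes w: "world w" and "almost_neg a"
    and b: "box w (\<lambda>w'. \<forall>n. holds w' (n \<bullet> \<sigma>) a \<longrightarrow> (\<exists>m. holds w' (m \<bullet> n \<bullet> \<sigma>) b))"
  obtains e where
    "box w (\<lambda>w'. \<forall>n. holds w' (n \<bullet> \<sigma>) a \<longrightarrow> (\<exists>m. App e n m \<in> w' \<and> holds w' (m \<bullet> n \<bullet> \<sigma>) b))"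
proof -
  let ?c = "\<^bold>\<exists> \<^bold>\<forall> (sub [Var 0] 2 a \<^bold>\<longrightarrow> \<^bold>\<exists> (App (Var 2) (Var 1) (Var 0) \<^bold>\<and> sub [Var 0, Var 1] 3 b))"
  have "subst_fm \<sigma> (\<^bold>\<forall> (a \<^bold>\<longrightarrow> \<^bold>\<exists> b) \<^bold>\<longrightarrow> ?c) \<in> w"
    by (intro axm_world[OF w] axm_subst axm.ECT assms)
  then have "holds w \<sigma> (\<^bold>\<forall> (a \<^bold>\<longrightarrow> \<^bold>\<exists> b) \<^bold>\<longrightarrow> ?c)" by (simp add: holds_def)
  moreover have "holds w \<sigma> (\<^bold>\<forall> (a \<^bold>\<longrightarrow> \<^bold>\<exists> b))" using w b by (simp add: holds_Uni_Impl)
  ultimately have "holds w \<sigma> ?c" by (rule holds_mp[OF w])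
  then show ?thesis using w that by (auto simp: holds_Uni_Impl)
qed

lemma almost_neg_Eq: "almost_neg (t \<^bold>= u)"
  by (intro almost_neg.intros sigma1.intros qfree.intros)

text \<open>Church's thesis with the trivial domain \<open>Zero = Zero\<close>.\<close>

lemma ECT_total:
  assumes w: "world w" and b: "box w (\<lambda>w'. \<forall>n. \<exists>m. holds w' (m \<bullet> n \<bullet> \<sigma>) b)"
  obtains e where "box w (\<lambda>w'. \<forall>n. \<exists>m. App e n m \<in> w' \<and> holds w' (m \<bullet> n \<bullet> \<sigma>) b)"
  using ECT_world[OF w almost_neg_Eq[of Zero Zero], of \<sigma> b] w b by auto

lemma App_defined_iff:
  assumes w: "world w"
  shows "(\<exists>m. App f n m \<in> w) \<and> box w (\<lambda>w'. \<forall>m. App f n m \<in> w' \<longrightarrow> holds w' (m \<bullet> \<sigma>) b) \<longleftrightarrow>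
    (\<exists>m. App f n m \<in> w \<and> holds w (m \<bullet> \<sigma>) b)"
proof
  assume "(\<exists>m. App f n m \<in> w) \<and> box w (\<lambda>w'. \<forall>m. App f n m \<in> w' \<longrightarrow> holds w' (m \<bullet> \<sigma>) b)"
  then show "\<exists>m. App f n m \<in> w \<and> holds w (m \<bullet> \<sigma>) b" using boxD[OF _ w] by blast
next
  assume "\<exists>m. App f n m \<in> w \<and> holds w (m \<bullet> \<sigma>) b"
  then obtain m where m: "App f n m \<in> w" "holds w (m \<bullet> \<sigma>) b" by blast
  have "box w (\<lambda>w'. \<forall>m. App f n m \<in> w' \<longrightarrow> holds w' (m \<bullet> \<sigma>) b)"
  proof (rule boxI[of "\<lambda>w. App f n m \<in> w \<and> holds w (m \<bullet> \<sigma>) b"], goal_cases)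
    case (4 w')
    then show ?case using App_functional holds_cong by metis
  qed (use m w in \<open>auto intro!: pers_intros\<close>)
  with m show "(\<exists>m. App f n m \<in> w) \<and> box w (\<lambda>w'. \<forall>m. App f n m \<in> w' \<longrightarrow> holds w' (m \<bullet> \<sigma>) b)"
    by blast
qed

section \<open>Almost negative formulas and realizability\<close>

lemma almost_neg_Exi_App: "almost_neg (\<^bold>\<exists> (App e n m))" "almost_neg (App e n m)"
  unfolding App_def by (intro almost_neg.intros(1) sigma1.intros qfree.intros)+

lemma almost_neg_Fls: "almost_neg Fls"
  by (intro almost_neg.intros(1) sigma1.intros qfree.intros)

lemma almost_neg_sub: "almost_neg a \<Longrightarrow> almost_neg (sub ts d a)"
  by (simp add: sub_def almost_neg_subst)

lemmas almost_neg_intros = almost_neg_Eq almost_neg_Exi_App almost_neg_Fls almost_neg_sub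
  almost_neg.intros(2-7)

text \<open>An almost negative formula serves as its own realizability, with a dummy realizer that
  does not occur in it.\<close>

lemma realizer_almost_neg:
  assumes "almost_neg \<phi>"
  shows "\<exists>\<rho>. almost_neg \<rho> \<and> (\<forall>w \<sigma>. world w \<longrightarrow> holds w \<sigma> \<phi> \<longleftrightarrow> (\<exists>e. holds w (e \<bullet> \<sigma>) \<rho>))"
  by (rule exI[of _ "lift_fm \<phi>"]) (simp add: assms almost_neg_subst)

text \<open>By extended Church's thesis, every formula is equivalent to its own realizability.\<close>

lemma realizer:
  "\<exists>\<rho>. almost_neg \<rho> \<and> (\<forall>w \<sigma>. world w \<longrightarrow> holds w \<sigma> \<phi> \<longleftrightarrow> (\<exists>e. holds w (e \<bullet> \<sigma>) \<rho>))"
proof (induction \<phi>)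
  case (Conj a b)
  then obtain \<rho>1 \<rho>2 where \<rho>: "almost_neg \<rho>1" "almost_neg \<rho>2"
    "\<And>w \<sigma>. world w \<Longrightarrow> holds w \<sigma> a \<longleftrightarrow> (\<exists>e. holds w (e \<bullet> \<sigma>) \<rho>1)"
    "\<And>w \<sigma>. world w \<Longrightarrow> holds w \<sigma> b \<longleftrightarrow> (\<exists>e. holds w (e \<bullet> \<sigma>) \<rho>2)" by blast
  have "holds w \<sigma> (a \<^bold>\<and> b) \<longleftrightarrow>
      (\<exists>e. holds w (e \<bullet> \<sigma>) (sub [Lft (Var 0)] 1 \<rho>1 \<^bold>\<and> sub [Rgt (Var 0)] 1 \<rho>2))"
    if w: "world w" for w \<sigma>
  proof -
    have "holds w (Lft (Pair e1 e2) \<bullet> \<sigma>) \<rho>1 \<longleftrightarrow> holds w (e1 \<bullet> \<sigma>) \<rho>1"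
      "holds w (Rgt (Pair e1 e2) \<bullet> \<sigma>) \<rho>2 \<longleftrightarrow> holds w (e2 \<bullet> \<sigma>) \<rho>2" for e1 e2
      by (rule holds_cong[OF w]; simp add: w)+
    then show ?thesis using w \<rho>(3,4)[OF w] by simp metis
  qed
  then show ?case using \<rho>(1,2) by (blast intro: almost_neg_intros)
next
  case (Disj a b)
  then obtain \<rho>1 \<rho>2 where \<rho>: "almost_neg \<rho>1" "almost_neg \<rho>2"
    "\<And>w \<sigma>. world w \<Longrightarrow> holds w \<sigma> a \<longleftrightarrow> (\<exists>e. holds w (e \<bullet> \<sigma>) \<rho>1)"
    "\<And>w \<sigma>. world w \<Longrightarrow> holds w \<sigma> b \<longleftrightarrow> (\<exists>e. holds w (e \<bullet> \<sigma>) \<rho>2)" by blast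
  \<comment> \<open>A disjunction is not an almost negative connective; the left component of the
    realizer says which disjunct holds, zero standing for the first.\<close>
  let ?\<rho> = "(Lft (Var 0) \<^bold>= Zero \<^bold>\<longrightarrow> sub [Rgt (Var 0)] 1 \<rho>1) \<^bold>\<and>
    ((Lft (Var 0) \<^bold>= Zero \<^bold>\<longrightarrow> Fls) \<^bold>\<longrightarrow> sub [Rgt (Var 0)] 1 \<rho>2)"
  have "holds w \<sigma> (a \<^bold>\<or> b) \<longleftrightarrow> (\<exists>e. holds w (e \<bullet> \<sigma>) ?\<rho>)" if w: "world w" for w \<sigma>
  proof
    assume "holds w \<sigma> (a \<^bold>\<or> b)"
    then consider e where "holds w (e \<bullet> \<sigma>) \<rho>1" | e where "holds w (e \<bullet> \<sigma>) \<rho>2"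
      using w \<rho>(3,4) by auto
    then show "\<exists>e. holds w (e \<bullet> \<sigma>) ?\<rho>"
    proof cases
      case 1
      have "box w (\<lambda>w. holds w (Rgt (Pair Zero e) \<bullet> \<sigma>) \<rho>1)"
        by (rule boxI[OF pers_holds 1 w]) (subst holds_cong, auto)
      then have "holds w (Pair Zero e \<bullet> \<sigma>) ?\<rho>"
        using w by (auto simp: holds_Impl dest: boxD intro!: box_necessitation)
      then show ?thesis ..
    next
      case 2
      have "box w (\<lambda>w. holds w (Rgt (Pair (Succ Zero) e) \<bullet> \<sigma>) \<rho>2)"
        by (rule boxI[OF pers_holds 2 w]) (subst holds_cong, auto)
      then have "holds w (Pair (Succ Zero) e \<bullet> \<sigma>) ?\<rho>"
        using w by (simp add: holds_Impl box_necessitation)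
      then show ?thesis ..
    qed
  next
    assume "\<exists>e. holds w (e \<bullet> \<sigma>) ?\<rho>"
    then obtain e where e: "holds w (e \<bullet> \<sigma>) ?\<rho>" ..
    consider "norm w (Lft e) = Zq w" | s where "norm w (Lft e) = Sq w s"
      using zero_or_succ[OF w] by blast
    then show "holds w \<sigma> (a \<^bold>\<or> b)"
    proof cases
      case 1
      then have "holds w (Rgt e \<bullet> \<sigma>) \<rho>1"
        using e w by (auto simp: holds_Impl dest!: boxD)
      then show ?thesis using w \<rho>(3) by auto
    next
      case 2
      \<comment> \<open>Being different from zero is made persistent through the equation with a
        successor.\<close>
      have "box w (\<lambda>w. Fq w pLeft [e] \<noteq> Zq w)"
        by (rule boxI[of "\<lambda>w. (Lft e \<^bold>= Succ s) \<in> w"]) (use 2 w in \<open>auto intro!: pers_intros\<close>)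
      moreover have "box w (\<lambda>w. box w (\<lambda>w. Fq w pLeft [e] \<noteq> Zq w) \<longrightarrow> holds w (Rgt e \<bullet> \<sigma>) \<rho>2)"
        using e w by (simp add: holds_Impl)
      ultimately have "holds w (Rgt e \<bullet> \<sigma>) \<rho>2" using boxD[OF _ w] by fast
      then show ?thesis using w \<rho>(4) by auto
    qed
  qed
  moreover have "almost_neg ?\<rho>" using \<rho>(1,2) by (intro almost_neg_intros)
  ultimately show ?case by blast
next
  case (Impl a b)
  then obtain \<rho>1 \<rho>2 where \<rho>: "almost_neg \<rho>1" "almost_neg \<rho>2"
    "\<And>w \<sigma>. world w \<Longrightarrow> holds w \<sigma> a \<longleftrightarrow> (\<exists>e. holds w (e \<bullet> \<sigma>) \<rho>1)"
    "\<And>w \<sigma>. world w \<Longrightarrow> holds w \<sigma> b \<longleftrightarrow> (\<exists>e. holds w (e \<bullet> \<sigma>) \<rho>2)" by blast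
  let ?\<rho> = "\<^bold>\<forall> (sub [Var 0] 2 \<rho>1 \<^bold>\<longrightarrow> \<^bold>\<exists> (App (Var 2) (Var 1) (Var 0)) \<^bold>\<and>
      \<^bold>\<forall> (App (Var 2) (Var 1) (Var 0) \<^bold>\<longrightarrow> sub [Var 0] 3 \<rho>2))"
  have "holds w \<sigma> (a \<^bold>\<longrightarrow> b) \<longleftrightarrow> (\<exists>e. holds w (e \<bullet> \<sigma>) ?\<rho>)" if w: "world w" for w \<sigma>
  proof -
    have iff: "holds w (f \<bullet> \<sigma>) ?\<rho> \<longleftrightarrow> box w (\<lambda>w. \<forall>e. holds w (e \<bullet> \<sigma>) \<rho>1 \<longrightarrow>
        (\<exists>m. App f e m \<in> w \<and> holds w (m \<bullet> \<sigma>) \<rho>2))" for f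
      using w by (simp add: holds_Uni_Impl App_defined_iff)
    show ?thesis
    proof
      assume "holds w \<sigma> (a \<^bold>\<longrightarrow> b)"
      then have "box w (\<lambda>w. (\<exists>e. holds w (e \<bullet> \<sigma>) \<rho>1) \<longrightarrow> (\<exists>e. holds w (e \<bullet> \<sigma>) \<rho>2))"
        using w by (simp add: holds_Impl \<rho>(3,4))
      then have "box w (\<lambda>w. \<forall>e. holds w (e \<bullet> \<sigma>) \<rho>1 \<longrightarrow> (\<exists>m. holds w (m \<bullet> e \<bullet> \<sigma>) (sub [Var 0] 2 \<rho>2)))"
        by (rule box_mono) (auto; blast)
      \<comment> \<open>Church's thesis applies because the antecedent \<open>\<rho>1\<close> is
        almost negative by the induction hypothesis.\<close>
      then obtain f where "box w (\<lambda>w. \<forall>e. holds w (e \<bullet> \<sigma>) \<rho>1 \<longrightarrow>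
          (\<exists>m. App f e m \<in> w \<and> holds w (m \<bullet> e \<bullet> \<sigma>) (sub [Var 0] 2 \<rho>2)))"
        by (rule ECT_world[OF w \<rho>(1)])
      then show "\<exists>f. holds w (f \<bullet> \<sigma>) ?\<rho>" unfolding iff by (auto simp: w)
    next
      assume "\<exists>f. holds w (f \<bullet> \<sigma>) ?\<rho>"
      then obtain f where "box w (\<lambda>w. \<forall>e. holds w (e \<bullet> \<sigma>) \<rho>1 \<longrightarrow>
        (\<exists>m. App f e m \<in> w \<and> holds w (m \<bullet> \<sigma>) \<rho>2))" unfolding iff ..
      then show "holds w \<sigma> (a \<^bold>\<longrightarrow> b)" unfolding holds_Impl[OF w]
        by (rule box_mono) (auto simp: \<rho>(3,4))
    qed
  qed
  moreover have "almost_neg ?\<rho>" using \<rho>(1,2) by (intro almost_neg_intros)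
  ultimately show ?case by blast
next
  case (Uni a)
  then obtain \<rho> where \<rho>: "almost_neg \<rho>"
    "\<And>w \<sigma>. world w \<Longrightarrow> holds w \<sigma> a \<longleftrightarrow> (\<exists>e. holds w (e \<bullet> \<sigma>) \<rho>)" by blast
  let ?\<rho> = "\<^bold>\<forall> (\<^bold>\<exists> (App (Var 2) (Var 1) (Var 0)) \<^bold>\<and>
      \<^bold>\<forall> (App (Var 2) (Var 1) (Var 0) \<^bold>\<longrightarrow> sub [Var 0, Var 1] 3 \<rho>))"
  have "holds w \<sigma> (Uni a) \<longleftrightarrow> (\<exists>e. holds w (e \<bullet> \<sigma>) ?\<rho>)" if w: "world w" for w \<sigma>
  proof -
    have iff: "holds w (f \<bullet> \<sigma>) ?\<rho> \<longleftrightarrow>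
        box w (\<lambda>w. \<forall>n. \<exists>m. App f n m \<in> w \<and> holds w (m \<bullet> n \<bullet> \<sigma>) \<rho>)" for f
      using w by (simp add: holds_Uni_Impl holds_Uni[of _ _ "Conj _ _"] App_defined_iff)
    show ?thesis
    proof
      assume "holds w \<sigma> (Uni a)"
      then have "box w (\<lambda>w. \<forall>n. \<exists>m. holds w (m \<bullet> n \<bullet> \<sigma>) \<rho>)"
        using w by (simp add: holds_Uni \<rho>(2))
      then show "\<exists>f. holds w (f \<bullet> \<sigma>) ?\<rho>" unfolding iff by (rule ECT_total[OF w]) blast
    next
      assume "\<exists>f. holds w (f \<bullet> \<sigma>) ?\<rho>"
      then obtain f where "box w (\<lambda>w. \<forall>n. \<exists>m. App f n m \<in> w \<and> holds w (m \<bullet> n \<bullet> \<sigma>) \<rho>)"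
        unfolding iff ..
      then show "holds w \<sigma> (Uni a)" unfolding holds_Uni[OF w]
        by (rule box_mono) (auto simp: \<rho>(2))
    qed
  qed
  moreover have "almost_neg ?\<rho>" using \<rho>(1) by (intro almost_neg_intros)
  ultimately show ?case by blast
next
  case (Exi a)
  then obtain \<rho> where \<rho>: "almost_neg \<rho>"
    "\<And>w \<sigma>. world w \<Longrightarrow> holds w \<sigma> a \<longleftrightarrow> (\<exists>e. holds w (e \<bullet> \<sigma>) \<rho>)" by blast
  have "holds w \<sigma> (Exi a) \<longleftrightarrow> (\<exists>e. holds w (e \<bullet> \<sigma>) (sub [Rgt (Var 0), Lft (Var 0)] 1 \<rho>))"
    if w: "world w" for w \<sigma>
  proof -
    \<comment> \<open>A realizer of an existential statement is the pair of a witness and a realizer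
      for it.\<close>
    have "holds w (Rgt (Pair t e) \<bullet> Lft (Pair t e) \<bullet> \<sigma>) \<rho> \<longleftrightarrow> holds w (e \<bullet> t \<bullet> \<sigma>) \<rho>" for t e
      by (rule holds_cong2[OF w]; simp add: w)
    then show ?thesis using w \<rho>(2)[OF w] by simp metis
  qed
  then show ?case using \<rho>(1) by (blast intro: almost_neg_intros)
qed (rule realizer_almost_neg; rule almost_neg_intros)+

text \<open>The sequence is \<open>r = u u\<close>, where \<open>u x\<close> is an index of the function that maps \<open>0\<close> to \<open>p0\<close> and \<open>j + 1\<close>
  to a choice for \<open>x x j\<close>. The formula \<open>a\<close> expresses that \<open>x x\<close> is defined and supplies a
  suitable argument for the choice, \<open>b\<close> is the graph of this function, and \<open>c\<close> defines \<open>u\<close>.\<close>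

lemma number_rdc:
  assumes w: "world w" and A: "almost_neg A" and init: "holds w (p0 \<bullet> \<sigma>) A"
    and step: "box w (\<lambda>w. \<forall>p. holds w (p \<bullet> \<sigma>) A \<longrightarrow>
      (\<exists>q. holds w (q \<bullet> \<sigma>) A \<and> holds w (q \<bullet> p \<bullet> \<sigma>) B))"
  obtains r where "App r Zero p0 \<in> w"
    "box w (\<lambda>w. \<forall>k. \<exists>p q. App r k p \<in> w \<and> App r (Succ k) q \<in> w \<and>
       holds w (p \<bullet> \<sigma>) A \<and> holds w (q \<bullet> \<sigma>) A \<and> holds w (q \<bullet> p \<bullet> \<sigma>) B)"
proof -
  \<comment> \<open>Extending the environment by \<open>p0\<close> gives the initial value a
    variable, so that \<open>b\<close> can mention it.\<close>
  define \<tau> where "\<tau> = p0 \<bullet> \<sigma>"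
  \<comment> \<open>This is the domain in an application of Church's thesis, so the existence of
    values is phrased as in \<open>App_defined_iff\<close> to keep it almost negative.\<close>
  define a where "a = \<^bold>\<exists> (App (Var 2) (Var 2) (Var 0)) \<^bold>\<and>
    \<^bold>\<forall> \<^bold>\<forall> (App (Var 3) (Var 3) (Var 1) \<^bold>\<and> Var 2 \<^bold>= Succ (Var 0) \<^bold>\<longrightarrow>
      \<^bold>\<exists> (App (Var 2) (Var 1) (Var 0)) \<^bold>\<and> \<^bold>\<forall> (App (Var 2) (Var 1) (Var 0) \<^bold>\<longrightarrow> sub [Var 0] 6 A))"
  define b where "b = (Var 1 \<^bold>= Zero \<^bold>\<and> Var 0 \<^bold>= Var 3) \<^bold>\<or>
    \<^bold>\<exists> \<^bold>\<exists> \<^bold>\<exists> (Var 4 \<^bold>= Succ (Var 2) \<^bold>\<and> App (Var 5) (Var 5) (Var 1) \<^bold>\<and> App (Var 1) (Var 2) (Var 0) \<^bold>\<and>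
      sub [Var 3] 7 A \<^bold>\<and> sub [Var 0] 7 A \<^bold>\<and> sub [Var 3, Var 0] 7 B)"
  have aneg: "almost_neg a" unfolding a_def using A by (intro almost_neg_intros)
  have a: "holds w (k \<bullet> x \<bullet> \<tau>) a \<longleftrightarrow> (\<exists>y. App x x y \<in> w) \<and>
      box w (\<lambda>w. \<forall>y j. App x x y \<in> w \<and> norm w k = Sq w j \<longrightarrow>
        (\<exists>q. App y j q \<in> w \<and> holds w (q \<bullet> \<sigma>) A))" if "world w" for w k x
    using that by (simp add: a_def \<tau>_def holds_Uni2_Impl holds_Uni_Impl App_defined_iff)
  have b: "holds w (m \<bullet> k \<bullet> x \<bullet> \<tau>) b \<longleftrightarrow> norm w k = Zq w \<and> norm w m = norm w p0 \<or>
      (\<exists>j y q. norm w k = Sq w j \<and> App x x y \<in> w \<and> App y j q \<in> w \<and>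
        holds w (m \<bullet> \<sigma>) A \<and> holds w (q \<bullet> \<sigma>) A \<and> holds w (m \<bullet> q \<bullet> \<sigma>) B)" if "world w" for w m k x
    using that by (simp add: b_def \<tau>_def)
  define c where "c = \<^bold>\<forall> (sub [Var 0, Var 2] 3 a \<^bold>\<longrightarrow> \<^bold>\<exists> (App (Var 2) (Var 1) (Var 0) \<^bold>\<and>
    subst_fm (Var 0 \<bullet> Var 1 \<bullet> Var 3 \<bullet> (\<lambda>i. Var (i + 4))) b))"
  have c: "holds w (e \<bullet> x \<bullet> \<tau>) c \<longleftrightarrow> box w (\<lambda>w. \<forall>k. holds w (k \<bullet> x \<bullet> \<tau>) a \<longrightarrow>
      (\<exists>m. App e k m \<in> w \<and> holds w (m \<bullet> k \<bullet> x \<bullet> \<tau>) b))" if "world w" for w e x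
    using that by (simp add: c_def holds_Uni_Impl subst_tm_scons)
  have "box w (\<lambda>w. \<forall>x. \<exists>e. holds w (e \<bullet> x \<bullet> \<tau>) c)"
  proof (rule boxI[OF pers_box step w], intro allI)
    fix w x
    assume w: "world w" and step: "box w (\<lambda>w. \<forall>p. holds w (p \<bullet> \<sigma>) A \<longrightarrow>
      (\<exists>q. holds w (q \<bullet> \<sigma>) A \<and> holds w (q \<bullet> p \<bullet> \<sigma>) B))"
    have "box w (\<lambda>w. \<forall>k. holds w (k \<bullet> x \<bullet> \<tau>) a \<longrightarrow> (\<exists>m. holds w (m \<bullet> k \<bullet> x \<bullet> \<tau>) b))"
    proof (rule boxI[OF pers_box step w], intro allI impI)
      fix w k
      assume w: "world w" and step: "box w (\<lambda>w. \<forall>p. holds w (p \<bullet> \<sigma>) A \<longrightarrow>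
        (\<exists>q. holds w (q \<bullet> \<sigma>) A \<and> holds w (q \<bullet> p \<bullet> \<sigma>) B))" and k: "holds w (k \<bullet> x \<bullet> \<tau>) a"
      consider "norm w k = Zq w" | j where "norm w k = Sq w j" using zero_or_succ[OF w] by blast
      then show "\<exists>m. holds w (m \<bullet> k \<bullet> x \<bullet> \<tau>) b"
      proof cases
        case 1
        then show ?thesis using b[OF w] by blast
      next
        case (2 j)
        obtain y where y: "App x x y \<in> w" using k a[OF w] by blast
        have "box w (\<lambda>w. \<forall>y j. App x x y \<in> w \<and> norm w k = Sq w j \<longrightarrow>
            (\<exists>q. App y j q \<in> w \<and> holds w (q \<bullet> \<sigma>) A))"
          using k a[OF w] by blast
        from boxD[OF this w] obtain q where q: "App y j q \<in> w" "holds w (q \<bullet> \<sigma>) A"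
          using y 2 by blast
        then obtain m where "holds w (m \<bullet> \<sigma>) A" "holds w (m \<bullet> q \<bullet> \<sigma>) B"
          using boxD[OF step w] by blast
        then show ?thesis using b[OF w] 2 y q by blast
      qed
    qed
    \<comment> \<open>Church's thesis in \<open>k\<close> for a fixed \<open>x\<close>. The next
      application, in \<open>x\<close>, makes the resulting index an effective function of
      \<open>x\<close>.\<close>
    from ECT_world[OF w aneg this] show "\<exists>e. holds w (e \<bullet> x \<bullet> \<tau>) c" unfolding c[OF w] by blast
  qed
  then obtain u where "box w (\<lambda>w. \<forall>x. \<exists>e. App u x e \<in> w \<and> holds w (e \<bullet> x \<bullet> \<tau>) c)"
    by (rule ECT_total[OF w])
  from boxD[OF this w] obtain r where u: "App u u r \<in> w" and "holds w (r \<bullet> u \<bullet> \<tau>) c" by blast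
  then have r: "box w (\<lambda>w. \<forall>k. holds w (k \<bullet> u \<bullet> \<tau>) a \<longrightarrow>
      (\<exists>m. App r k m \<in> w \<and> holds w (m \<bullet> k \<bullet> u \<bullet> \<tau>) b))" (is "box w ?R")
    using c[OF w] by blast
  \<comment> \<open>At zero the clause about predecessors is vacuous; what remains is that
    \<open>u\<close> applied to itself is defined.\<close>
  have a_Zero: "holds w (Zero \<bullet> u \<bullet> \<tau>) a" if w: "world w" and "App u u r \<in> w" for w
    unfolding a[OF w] using that by (auto intro: box_necessitation)
  have a_Succ: "holds w (Succ k \<bullet> u \<bullet> \<tau>) a"
    if w: "world w" and k: "App u u r \<in> w" "App r k p \<in> w" "holds w (p \<bullet> \<sigma>) A" for w k p
  proof -
    have "box w (\<lambda>w. \<forall>y j. App u u y \<in> w \<and> norm w (Succ k) = Sq w j \<longrightarrow>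
        (\<exists>q. App y j q \<in> w \<and> holds w (q \<bullet> \<sigma>) A))"
    proof (rule boxI[of "\<lambda>w. App u u r \<in> w \<and> App r k p \<in> w \<and> holds w (p \<bullet> \<sigma>) A"], goal_cases)
      case (4 w)
      show ?case
      proof (intro allI impI)
        fix y j assume y: "App u u y \<in> w \<and> norm w (Succ k) = Sq w j"
        have "norm w r = norm w y" using App_functional[OF 4(1)] 4(2) y by blast
        moreover have "norm w k = norm w j" using y 4(1) by simp
        ultimately have "App y j p \<in> w" using 4(2) App_cong[OF 4(1), of r y k j p p] by simp
        then show "\<exists>q. App y j q \<in> w \<and> holds w (q \<bullet> \<sigma>) A" using 4 by blast
      qed
    qed (use k w in \<open>auto intro!: pers_intros\<close>)
    with k show ?thesis unfolding a[OF w] by blast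
  qed
  have succ: "\<exists>p q. App r k p \<in> w \<and> App r (Succ k) q \<in> w \<and> holds w (p \<bullet> \<sigma>) A \<and>
      holds w (q \<bullet> \<sigma>) A \<and> holds w (q \<bullet> p \<bullet> \<sigma>) B"
    if w: "world w" and u: "App u u r \<in> w" and r: "?R w"
      and p: "App r k p \<in> w" "holds w (p \<bullet> \<sigma>) A" for w k p
  proof -
    obtain m where m: "App r (Succ k) m \<in> w" "holds w (m \<bullet> Succ k \<bullet> u \<bullet> \<tau>) b"
      using r a_Succ[OF w u p] by blast
    \<comment> \<open>Here \<open>y\<close> is a value of \<open>u\<close> at \<open>u\<close>,
      hence equal to \<open>r\<close>, and \<open>q\<close> is therefore the value of
      \<open>r\<close> at \<open>k\<close>.\<close>
    then obtain j y q where *: "norm w k = norm w j" "App u u y \<in> w" "App y j q \<in> w"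
        "holds w (m \<bullet> \<sigma>) A" "holds w (q \<bullet> \<sigma>) A" "holds w (m \<bullet> q \<bullet> \<sigma>) B"
      using w b[OF w] by auto
    then have "App r k q \<in> w"
      using App_cong[OF w App_functional[OF w u *(2)] *(1) refl, of q] by blast
    then show ?thesis using * m by blast
  qed
  obtain m where m: "App r Zero m \<in> w" "holds w (m \<bullet> Zero \<bullet> u \<bullet> \<tau>) b"
    using boxD[OF r w] a_Zero[OF w u] by blast
  then have m0: "norm w m = norm w p0" using w b[OF w] by auto
  then have r0: "App r Zero p0 \<in> w" using m App_cong[OF w] by blast
  \<comment> \<open>Definedness and \<open>A\<close> are proved together: \<open>a_Succ\<close>
    needs both at \<open>k\<close> to enter the domain at the successor of \<open>k\<close>.\<close>
  let ?d = "\<^bold>\<exists> (App (Var 2) (Var 1) (Var 0) \<^bold>\<and> sub [Var 0] 3 A)"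
  have d: "holds w (k \<bullet> r \<bullet> \<sigma>) ?d \<longleftrightarrow> (\<exists>p. App r k p \<in> w \<and> holds w (p \<bullet> \<sigma>) A)"
    if "world w" for w k using that by simp
  have "box w (\<lambda>w. \<forall>k. \<exists>p q. App r k p \<in> w \<and> App r (Succ k) q \<in> w \<and>
       holds w (p \<bullet> \<sigma>) A \<and> holds w (q \<bullet> \<sigma>) A \<and> holds w (q \<bullet> p \<bullet> \<sigma>) B)"
  proof (rule boxI[of "\<lambda>w. App u u r \<in> w \<and> App r Zero p0 \<in> w \<and> holds w (p0 \<bullet> \<sigma>) A \<and> box w ?R"], goal_cases)
    case (4 w)
    then have w: "world w" and u: "App u u r \<in> w" and r: "box w ?R" and r0: "App r Zero p0 \<in> w"
      and init: "holds w (p0 \<bullet> \<sigma>) A" by blast+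
    have "holds w (k \<bullet> r \<bullet> \<sigma>) ?d" for k
    proof (rule induct_world[OF w])
      show "holds w (Zero \<bullet> r \<bullet> \<sigma>) ?d" unfolding d[OF w] using r0 init by blast
      show "box w (\<lambda>w. \<forall>k. holds w (k \<bullet> r \<bullet> \<sigma>) ?d \<longrightarrow> holds w (Succ k \<bullet> r \<bullet> \<sigma>) ?d)"
      proof (rule boxI[of "\<lambda>w. App u u r \<in> w \<and> box w ?R"], goal_cases)
        case (4 w)
        then show ?case using succ[of w] boxD[of w ?R] unfolding d[OF 4(1)] by blast
      qed (use u r w in \<open>auto intro!: pers_intros\<close>)
    qed
    then show ?case using succ[OF w u boxD[OF r w]] unfolding d[OF w] by blast
  qed (use u r r0 init w in \<open>auto intro!: pers_intros\<close>)
  with r0 show ?thesis using that by blast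
qed

section \<open>Conditions and v-sets\<close>

lemma holds_Var: "holds w Var a \<longleftrightarrow> a \<in> w"
  by (simp only: holds_def subst_fm_Var)

lemma norm_Fn1_cong: "world w \<Longrightarrow> norm w m = norm w m' \<Longrightarrow> norm w (Fn f [m]) = norm w (Fn f [m'])"
  by (simp only: norm_simps list.map)

lemma MC_Xi:
  assumes w: "world w" and "box w (\<lambda>w. \<forall>n m. App f n m \<in> w \<longrightarrow> MC m \<in> w)"
    and "box w (\<lambda>w. \<forall>n k m. App f n k \<in> w \<and> App g n m \<in> w \<and> TC k \<in> w \<longrightarrow> MC m \<in> w)"
  shows "MC (Fn \<xi> [f, g]) \<in> w"
proof -
  let ?a = "\<^bold>\<forall> \<^bold>\<forall> (App (Var 3) (Var 1) (Var 0) \<^bold>\<longrightarrow> MC (Var 0))"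
  let ?b = "\<^bold>\<forall> \<^bold>\<forall> \<^bold>\<forall> (App (Var 4) (Var 2) (Var 1) \<^bold>\<and> App (Var 3) (Var 2) (Var 0) \<^bold>\<and> TC (Var 1)
            \<^bold>\<longrightarrow> MC (Var 0))"
  have "holds w Var (\<^bold>\<forall> \<^bold>\<forall> (?a \<^bold>\<longrightarrow> ?b \<^bold>\<longrightarrow> MC (Fn \<xi> [Var 1, Var 0])))"
    unfolding holds_Var by (rule axm_world[OF w axm.X2])
  then have "holds w (g \<bullet> f \<bullet> Var) (?a \<^bold>\<longrightarrow> ?b \<^bold>\<longrightarrow> MC (Fn \<xi> [Var 1, Var 0]))"
    by (intro holds_spec[OF w])
  moreover have "holds w (g \<bullet> f \<bullet> Var) ?a" using assms by (simp add: holds_Uni2_Impl)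
  moreover have "holds w (g \<bullet> f \<bullet> Var) ?b"
    using assms by (simp add: holds_Uni[of _ _ "Uni (Uni _)"] holds_Uni2_Impl box_all_box)
  ultimately have "holds w (g \<bullet> f \<bullet> Var) (MC (Fn \<xi> [Var 1, Var 0]))" by (meson holds_mp[OF w])
  then show ?thesis by simp
qed

lemma TC_Xi:
  assumes w: "world w" and "MC (Fn \<xi> [f, g]) \<in> w"
  shows "TC (Fn \<xi> [f, g]) \<in> w \<longleftrightarrow>
    box w (\<lambda>w. \<forall>n. (\<exists>m. App f n m \<in> w \<and> TC m \<in> w) \<longrightarrow> (\<exists>m. App g n m \<in> w \<and> TC m \<in> w))"
proof -
  let ?c = "\<^bold>\<forall> (\<^bold>\<exists> (App (Var 3) (Var 1) (Var 0) \<^bold>\<and> TC (Var 0)) \<^bold>\<longrightarrow>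
             \<^bold>\<exists> (App (Var 2) (Var 1) (Var 0) \<^bold>\<and> TC (Var 0)))"
  have "holds w Var (\<^bold>\<forall> \<^bold>\<forall> (MC (Fn \<xi> [Var 1, Var 0]) \<^bold>\<longrightarrow> (TC (Fn \<xi> [Var 1, Var 0]) \<^bold>\<longleftrightarrow> ?c)))"
    unfolding holds_Var by (rule axm_world[OF w axm.X1])
  then have "holds w (g \<bullet> f \<bullet> Var) (MC (Fn \<xi> [Var 1, Var 0]) \<^bold>\<longrightarrow> (TC (Fn \<xi> [Var 1, Var 0]) \<^bold>\<longleftrightarrow> ?c))"
    by (intro holds_spec[OF w])
  moreover have "holds w (g \<bullet> f \<bullet> Var) (MC (Fn \<xi> [Var 1, Var 0]))" using assms by simp
  ultimately have "holds w (g \<bullet> f \<bullet> Var) (TC (Fn \<xi> [Var 1, Var 0]) \<^bold>\<longleftrightarrow> ?c)" by (rule holds_mp[OF w])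
  then have "holds w (g \<bullet> f \<bullet> Var) (TC (Fn \<xi> [Var 1, Var 0])) \<longleftrightarrow> holds w (g \<bullet> f \<bullet> Var) ?c"
    using w by (auto intro: holds_mp simp del: holds_atoms)
  then show ?thesis using w by (simp add: holds_Uni_Impl)
qed

text \<open>With a nowhere defined first component, the premises of X2 and the implication in X1 all
  hold vacuously.\<close>

definition true_code :: tm where "true_code = Fn \<xi> [empty_index, empty_index]"

lemma true_code: "world w \<Longrightarrow> MC true_code \<in> w" "world w \<Longrightarrow> TC true_code \<in> w"
proof -
  show *: "MC true_code \<in> w" if "world w" for w
    unfolding true_code_def
    by (rule MC_Xi[OF that]; rule box_necessitation; simp add: App_empty_index)
  show "TC true_code \<in> w" if "world w"
    using TC_Xi[OF that *[OF that, unfolded true_code_def]]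
    by (simp add: true_code_def App_empty_index box_necessitation that)
qed

text \<open>For \<open>f\<close> constantly \<open>true_code\<close>, the condition \<Xi>(f, g) with
  \<open>g\<close> the empty function has a true antecedent and an undefined consequent. The
  constant function comes from Church's thesis instead of an explicit index.\<close>

lemma ex_false_code:
  assumes w: "world w"
  obtains c where "MC c \<in> w" "box w (\<lambda>w. TC c \<notin> w)"
proof -
  obtain f where "box w (\<lambda>w. \<forall>n. \<exists>m. App f n m \<in> w \<and> holds w (m \<bullet> n \<bullet> true_code \<bullet> Var) (Var 0 \<^bold>= Var 2))"
    by (rule ECT_total[OF w, of "true_code \<bullet> Var" "Var 0 \<^bold>= Var 2"]) (auto intro!: box_necessitation)
  then have f: "box w (\<lambda>w. \<forall>n. App f n true_code \<in> w)"
  proof (rule box_mono, intro allI)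
    fix w n assume w: "world w"
      and "\<forall>n. \<exists>m. App f n m \<in> w \<and> holds w (m \<bullet> n \<bullet> true_code \<bullet> Var) (Var 0 \<^bold>= Var 2)"
    then obtain m where "App f n m \<in> w" "norm w m = norm w true_code" by auto
    then show "App f n true_code \<in> w" using App_cong[OF w refl refl] by blast
  qed
  let ?c = "Fn \<xi> [f, empty_index]"
  have "box w (\<lambda>w. \<forall>n m. App f n m \<in> w \<longrightarrow> MC m \<in> w)"
  proof (rule box_mono[OF f], intro allI impI)
    fix w n m assume w: "world w" and "\<forall>n. App f n true_code \<in> w" "App f n m \<in> w"
    then have "norm w true_code = norm w m" using App_functional[OF w] by blast
    then show "MC m \<in> w" using MC_cong[OF w] true_code(1)[OF w] by blast
  qed
  then have c: "MC ?c \<in> w"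
    by (rule MC_Xi[OF w]) (simp add: App_empty_index box_necessitation)
  moreover have "box w (\<lambda>w. TC ?c \<notin> w)"
  proof (rule boxI[of "\<lambda>w. MC ?c \<in> w \<and> box w (\<lambda>w. \<forall>n. App f n true_code \<in> w)"], goal_cases)
    case (4 w)
    then show ?case
      using TC_Xi[of w f empty_index] boxD[of w] true_code(2)[of w] App_empty_index[of w] by blast
  qed (use c f w in \<open>auto intro!: pers_intros\<close>)
  ultimately show ?thesis by (rule that)
qed

section \<open>Closure and induction for v-sets\<close>

lemma holds_Cl:
  "world w \<Longrightarrow> holds w (x \<bullet> \<sigma>) (Cl a) \<longleftrightarrow> box w (\<lambda>w. \<forall>n. \<exists>m. App x n m \<in> w \<and> MC (Rgt m) \<in> w \<and>
     box w (\<lambda>w. TC (Rgt m) \<in> w \<longrightarrow> holds w (Lft m \<bullet> \<sigma>) a))"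
  by (simp add: Cl_def holds_Uni holds_Impl)

lemma El_iff: "world w \<Longrightarrow> El x n a \<in> w \<longleftrightarrow>
    (\<exists>m. App x n m \<in> w \<and> TC (Rgt m) \<in> w \<and> norm w a = norm w (Lft m))"
proof -
  assume w: "world w"
  have "El x n a \<in> w \<longleftrightarrow> holds w Var (El x n a)" by (simp add: holds_def)
  also have "\<dots> \<longleftrightarrow> (\<exists>m. App x n m \<in> w \<and> TC (Rgt m) \<in> w \<and> norm w a = norm w (Lft m))"
    unfolding El_def using w by simp
  finally show ?thesis .
qed

lemma InEL_iff: "world w \<Longrightarrow> InEL a x \<in> w \<longleftrightarrow> (\<exists>n. El x n a \<in> w)"
proof -
  assume w: "world w"
  have "InEL a x \<in> w \<longleftrightarrow> holds w Var (InEL a x)" by (simp add: holds_def)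
  also have "\<dots> \<longleftrightarrow> (\<exists>n. El x n a \<in> w)" unfolding InEL_def using w by simp
  finally show ?thesis .
qed

lemma App_InEL: "world w \<Longrightarrow> App x n m \<in> w \<Longrightarrow> TC (Rgt m) \<in> w \<Longrightarrow> InEL (Lft m) x \<in> w"
  by (auto simp: InEL_iff El_iff)

lemma El_functional:
  "world w \<Longrightarrow> El x n a \<in> w \<Longrightarrow> El x n a' \<in> w \<Longrightarrow> norm w a = norm w a'"
  unfolding El_iff by (metis App_functional norm_Fn1_cong)

lemma VS_intro:
  assumes w: "world w" and "box w (\<lambda>w. \<forall>n. \<exists>m. App x n m \<in> w \<and> MC (Rgt m) \<in> w \<and>
     box w (\<lambda>w. TC (Rgt m) \<in> w \<longrightarrow> VS (Lft m) \<in> w))"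
  shows "VS x \<in> w"
proof -
  have "holds w Var (\<^bold>\<forall> (Cl (VS (Var 0)) \<^bold>\<longrightarrow> VS (Var 0)))"
    unfolding holds_Var by (rule axm_world[OF w axm.V1])
  then have "holds w (x \<bullet> Var) (Cl (VS (Var 0)) \<^bold>\<longrightarrow> VS (Var 0))" by (rule holds_spec[OF w])
  moreover have "holds w (x \<bullet> Var) (Cl (VS (Var 0)))" using assms by (simp add: holds_Cl)
  ultimately have "holds w (x \<bullet> Var) (VS (Var 0))" by (rule holds_mp[OF w])
  then show ?thesis by simp
qed

lemma VS_least:
  assumes w: "world w" and "VS x \<in> w"
    and cl: "\<And>w x. world w \<Longrightarrow> holds w (x \<bullet> \<sigma>) (Cl a) \<Longrightarrow> holds w (x \<bullet> \<sigma>) a"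
  shows "holds w (x \<bullet> \<sigma>) a"
proof -
  have "subst_fm \<sigma> (\<^bold>\<forall> (Cl a \<^bold>\<longrightarrow> a) \<^bold>\<longrightarrow> \<^bold>\<forall> (VS (Var 0) \<^bold>\<longrightarrow> a)) \<in> w"
    by (intro axm_world[OF w] axm_subst axm.V2)
  then have "holds w \<sigma> (\<^bold>\<forall> (Cl a \<^bold>\<longrightarrow> a) \<^bold>\<longrightarrow> \<^bold>\<forall> (VS (Var 0) \<^bold>\<longrightarrow> a))" by (simp add: holds_def)
  moreover have "holds w \<sigma> (\<^bold>\<forall> (Cl a \<^bold>\<longrightarrow> a))"
    unfolding holds_Uni_Impl[OF w] by (rule box_necessitation) (use cl in blast)
  ultimately have "holds w \<sigma> (\<^bold>\<forall> (VS (Var 0) \<^bold>\<longrightarrow> a))" by (rule holds_mp[OF w])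
  then have "holds w (x \<bullet> \<sigma>) (VS (Var 0) \<^bold>\<longrightarrow> a)" by (rule holds_spec[OF w])
  then show ?thesis by (rule holds_mp[OF w]) (simp add: assms)
qed

text \<open>The converse of V1, by the usual argument for least fixed points: V2 is applied to the
  closure condition itself, which is closed because V1 holds.\<close>

lemma VS_unfold:
  assumes w: "world w" and "VS x \<in> w"
  shows "box w (\<lambda>w. \<forall>n. \<exists>m. App x n m \<in> w \<and> MC (Rgt m) \<in> w \<and>
     box w (\<lambda>w. TC (Rgt m) \<in> w \<longrightarrow> VS (Lft m) \<in> w))"
proof -
  have "holds w (x \<bullet> Var) (Cl (VS (Var 0)))"
  proof (rule VS_least[OF assms])
    fix w x assume w: "world w" and cl: "holds w (x \<bullet> Var) (Cl (Cl (VS (Var 0))))"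
    show "holds w (x \<bullet> Var) (Cl (VS (Var 0)))"
      unfolding holds_Cl[OF w]
    proof (rule box_mono[OF cl[unfolded holds_Cl[OF w]]], intro allI)
      fix w n assume "world w" and "\<forall>n. \<exists>m. App x n m \<in> w \<and> MC (Rgt m) \<in> w \<and>
        box w (\<lambda>w. TC (Rgt m) \<in> w \<longrightarrow> holds w (Lft m \<bullet> Var) (Cl (VS (Var 0))))"
      then obtain m where m: "App x n m \<in> w" "MC (Rgt m) \<in> w"
        "box w (\<lambda>w. TC (Rgt m) \<in> w \<longrightarrow> holds w (Lft m \<bullet> Var) (Cl (VS (Var 0))))" by blast
      have "box w (\<lambda>w. TC (Rgt m) \<in> w \<longrightarrow> holds w (Lft m \<bullet> Var) (VS (Var 0)))"
        using m(3) by (rule box_mono) (use VS_intro in \<open>auto simp: holds_Cl\<close>)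
      with m show "\<exists>m. App x n m \<in> w \<and> MC (Rgt m) \<in> w \<and>
        box w (\<lambda>w. TC (Rgt m) \<in> w \<longrightarrow> holds w (Lft m \<bullet> Var) (VS (Var 0)))" by blast
    qed
  qed
  then show ?thesis using w by (simp add: holds_Cl)
qed

lemma Cl_InEL:
  assumes w: "world w" and cl: "holds w (x \<bullet> \<sigma>) (Cl a)" and y: "InEL y x \<in> w"
  shows "holds w (y \<bullet> \<sigma>) a"
proof -
  obtain n m where m: "App x n m \<in> w" "TC (Rgt m) \<in> w" "norm w y = norm w (Lft m)"
    using y InEL_iff[OF w] El_iff[OF w] by blast
  obtain m' where m': "App x n m' \<in> w" "box w (\<lambda>w. TC (Rgt m') \<in> w \<longrightarrow> holds w (Lft m' \<bullet> \<sigma>) a)"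
    using boxD[OF cl[unfolded holds_Cl[OF w]] w] by blast
  have eq: "norm w m = norm w m'" using App_functional[OF w m(1) m'(1)] .
  then have "TC (Rgt m') \<in> w" using m(2) TC_cong[OF w norm_Fn1_cong[OF w eq]] by blast
  then have "holds w (Lft m' \<bullet> \<sigma>) a" using boxD[OF m'(2) w] by blast
  moreover have "norm w y = norm w (Lft m')" using m(3) norm_Fn1_cong[OF w eq] by metis
  ultimately show ?thesis using holds_cong[OF w] by blast
qed

lemma VS_InEL: "world w \<Longrightarrow> VS x \<in> w \<Longrightarrow> InEL a x \<in> w \<Longrightarrow> VS a \<in> w"
  using Cl_InEL[of w x Var "VS (Var 0)" a] VS_unfold[of w x] by (simp add: holds_Cl)

text \<open>Conjoining \<open>VS\<close> to the induction formula makes it available for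
  \<open>x\<close> in the step; the conditions and indices of \<open>Cl\<close> disappear in favour
  of \<open>InEL\<close>.\<close>

lemma VS_induct:
  assumes w: "world w" and "VS x \<in> w"
    and step: "\<And>w x. world w \<Longrightarrow> VS x \<in> w \<Longrightarrow>
      box w (\<lambda>w. \<forall>y. InEL y x \<in> w \<longrightarrow> holds w (y \<bullet> \<sigma>) a) \<Longrightarrow> holds w (x \<bullet> \<sigma>) a"
  shows "holds w (x \<bullet> \<sigma>) a"
proof -
  have "holds w (x \<bullet> \<sigma>) (VS (Var 0) \<^bold>\<and> a)"
  proof (rule VS_least[OF assms(1,2)])
    fix w x assume w: "world w" and cl: "holds w (x \<bullet> \<sigma>) (Cl (VS (Var 0) \<^bold>\<and> a))"
    have "VS x \<in> w"
      by (rule VS_intro[OF w], rule box_mono[OF cl[unfolded holds_Cl[OF w]]])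
        (force elim: box_mono)
    moreover have "box w (\<lambda>w. \<forall>y. InEL y x \<in> w \<longrightarrow> holds w (y \<bullet> \<sigma>) a)"
      by (rule boxI[OF pers_holds cl w]) (use Cl_InEL in fastforce)
    ultimately show "holds w (x \<bullet> \<sigma>) (VS (Var 0) \<^bold>\<and> a)" using w step by simp
  qed
  then show ?thesis using w by simp
qed

section \<open>Existence of v-sets with a prescribed description\<close>

lemma ex_v_set:
  assumes w: "world w" and "box w (\<lambda>w. \<forall>n. \<exists>m. MC (Rgt m) \<in> w \<and>
    box w (\<lambda>w. TC (Rgt m) \<in> w \<longrightarrow> VS (Lft m) \<in> w) \<and> holds w (m \<bullet> n \<bullet> \<sigma>) b)"
  obtains x where "VS x \<in> w" "box w (\<lambda>w. \<forall>n. \<exists>m. App x n m \<in> w \<and> holds w (m \<bullet> n \<bullet> \<sigma>) b)"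
proof -
  let ?b = "MC (Rgt (Var 0)) \<^bold>\<and> (TC (Rgt (Var 0)) \<^bold>\<longrightarrow> VS (Lft (Var 0))) \<^bold>\<and> b"
  have "box w (\<lambda>w. \<forall>n. \<exists>m. holds w (m \<bullet> n \<bullet> \<sigma>) ?b)" using assms by (simp add: holds_Impl)
  then obtain x where x: "box w (\<lambda>w. \<forall>n. \<exists>m. App x n m \<in> w \<and> holds w (m \<bullet> n \<bullet> \<sigma>) ?b)"
    by (rule ECT_total[OF w])
  have "VS x \<in> w"
    by (rule VS_intro[OF w], rule box_mono[OF x]) (auto simp: holds_Impl; blast)
  moreover have "box w (\<lambda>w. \<forall>n. \<exists>m. App x n m \<in> w \<and> holds w (m \<bullet> n \<bullet> \<sigma>) b)"
    using x by (rule box_mono) (auto; blast)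
  ultimately show ?thesis by (rule that)
qed

text \<open>Sets listed by a total enumeration: every condition is \<open>true_code\<close>. This
  covers unordered pairs, \<omega> and the graph of the function.\<close>

lemma ex_v_set_enumerated:
  assumes w: "world w" and b: "box w (\<lambda>w. \<forall>n. \<exists>a. VS a \<in> w \<and> holds w (a \<bullet> n \<bullet> \<sigma>) b)"
  obtains x where "VS x \<in> w" "box w (\<lambda>w. \<forall>n. \<exists>a. El x n a \<in> w \<and> holds w (a \<bullet> n \<bullet> \<sigma>) b)"
proof -
  let ?b = "TC (Rgt (Var 0)) \<^bold>\<and> sub [Lft (Var 0), Var 1] 2 b"
  have "box w (\<lambda>w. \<forall>n. \<exists>m. MC (Rgt m) \<in> w \<and>
    box w (\<lambda>w. TC (Rgt m) \<in> w \<longrightarrow> VS (Lft m) \<in> w) \<and> holds w (m \<bullet> n \<bullet> \<sigma>) ?b)"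
  proof (rule boxI[OF pers_box b w], intro allI)
    fix w n assume w: "world w" and b: "box w (\<lambda>w. \<forall>n. \<exists>a. VS a \<in> w \<and> holds w (a \<bullet> n \<bullet> \<sigma>) b)"
    obtain a where a: "VS a \<in> w" "holds w (a \<bullet> n \<bullet> \<sigma>) b" using boxD[OF b w] by blast
    let ?m = "Pair a true_code"
    have R: "norm w (Rgt ?m) = norm w true_code" and L: "norm w (Lft ?m) = norm w a" if "world w" for w
      using that by simp_all
    have "MC (Rgt ?m) \<in> w" "TC (Rgt ?m) \<in> w"
      using MC_cong[OF w R[OF w]] TC_cong[OF w R[OF w]] true_code[OF w] by blast+
    moreover have "box w (\<lambda>w. TC (Rgt ?m) \<in> w \<longrightarrow> VS (Lft ?m) \<in> w)"
      by (rule boxI[OF pers_mem a(1) w]) (use VS_cong[OF _ L] in blast)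
    moreover have "holds w (Lft ?m \<bullet> n \<bullet> \<sigma>) b" using a(2) holds_cong[OF w L[OF w]] by blast
    ultimately show "\<exists>m. MC (Rgt m) \<in> w \<and>
        box w (\<lambda>w. TC (Rgt m) \<in> w \<longrightarrow> VS (Lft m) \<in> w) \<and> holds w (m \<bullet> n \<bullet> \<sigma>) ?b"
      by (intro exI[of _ ?m]) (simp add: w)
  qed
  then obtain x where x: "VS x \<in> w" "box w (\<lambda>w. \<forall>n. \<exists>m. App x n m \<in> w \<and> holds w (m \<bullet> n \<bullet> \<sigma>) ?b)"
    by (rule ex_v_set[OF w])
  have "box w (\<lambda>w. \<forall>n. \<exists>a. El x n a \<in> w \<and> holds w (a \<bullet> n \<bullet> \<sigma>) b)"
  proof (rule box_mono[OF x(2)], intro allI)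
    fix w n assume w: "world w" and "\<forall>n. \<exists>m. App x n m \<in> w \<and> holds w (m \<bullet> n \<bullet> \<sigma>) ?b"
    then obtain m where "App x n m \<in> w" "TC (Rgt m) \<in> w" "holds w (Lft m \<bullet> n \<bullet> \<sigma>) b" by auto
    then show "\<exists>a. El x n a \<in> w \<and> holds w (a \<bullet> n \<bullet> \<sigma>) b" using El_iff[OF w] by blast
  qed
  with x(1) show ?thesis by (rule that)
qed

lemma enumerated_InEL:
  assumes w: "world w" and x: "\<forall>n. \<exists>a. El x n a \<in> w \<and> holds w (a \<bullet> n \<bullet> \<sigma>) b" and a: "InEL a x \<in> w"
  shows "\<exists>n. holds w (a \<bullet> n \<bullet> \<sigma>) b"
  using a x unfolding InEL_iff[OF w] by (metis El_functional[OF w] holds_cong[OF w])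

end

section \<open>Sets\<close>

locale vset_model = heyting +
  fixes eq :: fm
  assumes ext_equality: "ext_equality \<xi> eq"
begin

section \<open>Set-theoretic notions in a world\<close>

definition ext_eq :: "fm set \<Rightarrow> tm \<Rightarrow> tm \<Rightarrow> bool" where
  "ext_eq w x y \<longleftrightarrow> holds w (x \<bullet> y \<bullet> Var) eq"

definition mem :: "fm set \<Rightarrow> tm \<Rightarrow> tm \<Rightarrow> bool" where
  "mem w a y \<longleftrightarrow> (\<exists>b. InEL b y \<in> w \<and> ext_eq w a b)"

definition incl :: "fm set \<Rightarrow> tm \<Rightarrow> tm \<Rightarrow> bool" where
  "incl w x y \<longleftrightarrow> box w (\<lambda>w. \<forall>a. InEL a x \<in> w \<longrightarrow> mem w a y)"

definition empty_set :: "fm set \<Rightarrow> tm \<Rightarrow> bool" where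
  "empty_set w z \<longleftrightarrow> box w (\<lambda>w. \<forall>a. InEL a z \<notin> w)"

definition succ_set :: "fm set \<Rightarrow> tm \<Rightarrow> tm \<Rightarrow> bool" where
  "succ_set w s n \<longleftrightarrow> mem w n s \<and> incl w n s \<and>
     box w (\<lambda>w. \<forall>a. InEL a s \<in> w \<longrightarrow> mem w a n \<or> ext_eq w a n)"

definition upair_set :: "fm set \<Rightarrow> tm \<Rightarrow> tm \<Rightarrow> tm \<Rightarrow> bool" where
  "upair_set w u a b \<longleftrightarrow> mem w a u \<and> mem w b u \<and>
     box w (\<lambda>w. \<forall>c. InEL c u \<in> w \<longrightarrow> ext_eq w c a \<or> ext_eq w c b)"

definition opair_set :: "fm set \<Rightarrow> tm \<Rightarrow> tm \<Rightarrow> tm \<Rightarrow> bool" where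
  "opair_set w p a b \<longleftrightarrow> (\<exists>u. InEL u p \<in> w \<and> upair_set w u a a) \<and>
     (\<exists>u. InEL u p \<in> w \<and> upair_set w u a b) \<and>
     box w (\<lambda>w. \<forall>u. InEL u p \<in> w \<longrightarrow> upair_set w u a a \<or> upair_set w u a b)"

definition maps :: "fm set \<Rightarrow> tm \<Rightarrow> tm \<Rightarrow> tm \<Rightarrow> bool" where
  "maps w f a b \<longleftrightarrow> (\<exists>p. InEL p f \<in> w \<and> opair_set w p a b)"

definition inductive_vset :: "fm set \<Rightarrow> tm \<Rightarrow> bool" where
  "inductive_vset w v \<longleftrightarrow> (\<exists>z. InEL z v \<in> w \<and> empty_set w z) \<and>
     box w (\<lambda>w. \<forall>n. InEL n v \<in> w \<longrightarrow> (\<exists>s. InEL s v \<in> w \<and> succ_set w s n))"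

lemma pers_sets [pers_intros]:
  "pers (\<lambda>w. ext_eq w x y)"
  "pers (\<lambda>w. mem w x y)"
  "pers (\<lambda>w. incl w x y)"
  "pers (\<lambda>w. empty_set w x)"
  "pers (\<lambda>w. succ_set w x y)"
  "pers (\<lambda>w. upair_set w x y z)"
  "pers (\<lambda>w. opair_set w x y z)"
  "pers (\<lambda>w. inductive_vset w x)"
  unfolding ext_eq_def mem_def incl_def empty_set_def succ_set_def upair_set_def opair_set_def
    inductive_vset_def
  by (intro pers_intros)+

lemma holds_eq [simp]: "holds w (x \<bullet> y \<bullet> \<sigma>) eq \<longleftrightarrow> ext_eq w x y"
proof -
  have "subst_fm (x \<bullet> y \<bullet> \<sigma>) eq = subst_fm (x \<bullet> y \<bullet> Var) eq"
    using ext_equality by (intro subst_fm_cong) (auto simp: ext_equality_def)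
  then show ?thesis by (simp add: holds_def ext_eq_def)
qed

lemma holds_interp:
  "holds w \<sigma> (interp eq (SEq i j)) \<longleftrightarrow> ext_eq w (\<sigma> i) (\<sigma> j)"
  "world w \<Longrightarrow> holds w \<sigma> (interp eq (SMem i j)) \<longleftrightarrow> mem w (\<sigma> i) (\<sigma> j)"
  "world w \<Longrightarrow> holds w \<sigma> (interp eq (is_empty i)) \<longleftrightarrow> empty_set w (\<sigma> i)"
  by (simp_all add: mem_def is_empty_def empty_set_def holds_Uni_Impl)

lemma holds_succ_set:
  "world w \<Longrightarrow> holds w \<sigma> (interp eq (is_succ i j)) \<longleftrightarrow> succ_set w (\<sigma> i) (\<sigma> j)"
  by (simp add: is_succ_def succ_set_def incl_def mem_def holds_Uni_Impl)

lemma holds_upair_set: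
  "world w \<Longrightarrow> holds w \<sigma> (interp eq (is_upair i j k)) \<longleftrightarrow> upair_set w (\<sigma> i) (\<sigma> j) (\<sigma> k)"
  by (simp add: is_upair_def upair_set_def mem_def holds_Uni_Impl)

lemma holds_opair_set:
  "world w \<Longrightarrow> holds w \<sigma> (interp eq (is_opair i j k)) \<longleftrightarrow> opair_set w (\<sigma> i) (\<sigma> j) (\<sigma> k)"
  by (simp add: is_opair_def opair_set_def holds_Uni_Impl holds_upair_set)

lemma holds_maps:
  "world w \<Longrightarrow> holds w \<sigma> (interp eq (maps_to i j k)) \<longleftrightarrow> maps w (\<sigma> i) (\<sigma> j) (\<sigma> k)"
  by (simp add: maps_to_def maps_def holds_opair_set)

lemma holds_inductive_vset:
  "world w \<Longrightarrow> holds w \<sigma> (interp eq (is_inductive i)) \<longleftrightarrow> inductive_vset w (\<sigma> i)"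
  by (simp add: is_inductive_def inductive_vset_def holds_Uni_Impl holds_succ_set holds_interp(3))

section \<open>Extensional equality and membership\<close>

lemma ext_eq_iff:
  assumes w: "world w" and "VS x \<in> w" "VS y \<in> w"
  shows "ext_eq w x y \<longleftrightarrow> incl w x y \<and> incl w y x"
proof -
  let ?c = "sub [Var 1, Var 0] 2 eq"
  let ?d = "\<^bold>\<forall> (InEL (Var 0) (Var 2) \<^bold>\<longrightarrow> \<^bold>\<exists> (InEL (Var 0) (Var 2) \<^bold>\<and> sub [Var 1, Var 0] 4 eq)) \<^bold>\<and>
         \<^bold>\<forall> (InEL (Var 0) (Var 1) \<^bold>\<longrightarrow> \<^bold>\<exists> (InEL (Var 0) (Var 3) \<^bold>\<and> sub [Var 1, Var 0] 4 eq))"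
  have "holds w Var (\<^bold>\<forall> \<^bold>\<forall> (VS (Var 1) \<^bold>\<and> VS (Var 0) \<^bold>\<longrightarrow> (?c \<^bold>\<longleftrightarrow> ?d)))"
    unfolding holds_Var
    by (rule world_prv[OF w, of "{}"]) (use ext_equality in \<open>simp_all add: ext_equality_def\<close>)
  then have "holds w (y \<bullet> x \<bullet> Var) (VS (Var 1) \<^bold>\<and> VS (Var 0) \<^bold>\<longrightarrow> (?c \<^bold>\<longleftrightarrow> ?d))"
    by (intro holds_spec[OF w])
  moreover have "holds w (y \<bullet> x \<bullet> Var) (VS (Var 1) \<^bold>\<and> VS (Var 0))" using assms by simp
  ultimately have "holds w (y \<bullet> x \<bullet> Var) (?c \<^bold>\<longleftrightarrow> ?d)" by (rule holds_mp[OF w])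
  then have "holds w (y \<bullet> x \<bullet> Var) (?c \<^bold>\<longrightarrow> ?d)" "holds w (y \<bullet> x \<bullet> Var) (?d \<^bold>\<longrightarrow> ?c)"
    unfolding holds_Conj[OF w] by blast+
  then have "holds w (y \<bullet> x \<bullet> Var) ?c \<longleftrightarrow> holds w (y \<bullet> x \<bullet> Var) ?d"
    using holds_mp[OF w] by blast
  then show ?thesis using w by (simp add: holds_Uni_Impl incl_def mem_def)
qed

lemma ext_eq_sym: "world w \<Longrightarrow> VS x \<in> w \<Longrightarrow> VS y \<in> w \<Longrightarrow> ext_eq w x y \<Longrightarrow> ext_eq w y x"
  by (simp add: ext_eq_iff)

lemma ext_eq_refl:
  assumes "world w" "VS x \<in> w"
  shows "ext_eq w x x"
proof -
  have "holds w (x \<bullet> Var) (sub [Var 0, Var 0] 1 eq)"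
  proof (rule VS_induct[OF assms])
    fix w x assume w: "world w" and x: "VS x \<in> w"
      and "box w (\<lambda>w. \<forall>y. InEL y x \<in> w \<longrightarrow> holds w (y \<bullet> Var) (sub [Var 0, Var 0] 1 eq))"
    then have "incl w x x" unfolding incl_def mem_def by (auto elim!: box_mono)
    then show "holds w (x \<bullet> Var) (sub [Var 0, Var 0] 1 eq)" using ext_eq_iff[OF w x x] by simp
  qed
  then show ?thesis by simp
qed

lemma InEL_mem: "world w \<Longrightarrow> VS x \<in> w \<Longrightarrow> InEL a x \<in> w \<Longrightarrow> mem w a x"
  unfolding mem_def using ext_eq_refl VS_InEL by blast

text \<open>V-set induction on \<open>x\<close> with \<open>y\<close> and \<open>z\<close>
  quantified inside the formula, since elements of \<open>x\<close> are compared with elements of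
  the other two sets.\<close>

lemma ext_eq_trans:
  assumes w: "world w" and "VS x \<in> w" "VS y \<in> w" "VS z \<in> w" "ext_eq w x y" "ext_eq w y z"
  shows "ext_eq w x z"
proof -
  let ?a = "\<^bold>\<forall> \<^bold>\<forall> (VS (Var 1) \<^bold>\<and> VS (Var 0) \<^bold>\<and> sub [Var 2, Var 1] 0 eq \<^bold>\<and> sub [Var 1, Var 0] 0 eq \<^bold>\<longrightarrow>
    sub [Var 2, Var 0] 0 eq)"
  have a: "holds w (x \<bullet> Var) ?a \<longleftrightarrow> box w (\<lambda>w. \<forall>y z. VS y \<in> w \<and> VS z \<in> w \<and>
      ext_eq w x y \<and> ext_eq w y z \<longrightarrow> ext_eq w x z)" if "world w" for w x
    using that by (simp add: holds_Uni2_Impl)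
  have "holds w (x \<bullet> Var) ?a"
  proof (rule VS_induct[OF assms(1,2)])
    fix w x assume w: "world w" and x: "VS x \<in> w"
      and IH: "box w (\<lambda>w. \<forall>y. InEL y x \<in> w \<longrightarrow> holds w (y \<bullet> Var) ?a)"
    show "holds w (x \<bullet> Var) ?a"
      unfolding a[OF w]
    proof (rule boxI[of "\<lambda>w. VS x \<in> w \<and> box w (\<lambda>w. \<forall>y. InEL y x \<in> w \<longrightarrow> holds w (y \<bullet> Var) ?a)"],
        goal_cases)
      case (4 w)
      then have w: "world w" and x: "VS x \<in> w"
        and IH: "box w (\<lambda>w. \<forall>y. InEL y x \<in> w \<longrightarrow> holds w (y \<bullet> Var) ?a)" by blast+
      show ?case
      proof (intro allI impI)
        fix y z assume yz: "VS y \<in> w \<and> VS z \<in> w \<and> ext_eq w x y \<and> ext_eq w y z"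
        have IH': "ext_eq w a c" if "world w" "\<forall>y. InEL y x \<in> w \<longrightarrow> holds w (y \<bullet> Var) ?a"
          "InEL a x \<in> w" "VS b \<in> w" "VS c \<in> w" "ext_eq w a b" "ext_eq w b c" for w a b c
          using that a[OF that(1), of a] boxD[OF _ that(1)] by blast
        let ?R = "\<lambda>w. VS x \<in> w \<and> VS y \<in> w \<and> VS z \<in> w \<and>
          box w (\<lambda>w. \<forall>y. InEL y x \<in> w \<longrightarrow> holds w (y \<bullet> Var) ?a) \<and> incl w x y \<and> incl w y x \<and>
          incl w y z \<and> incl w z y"
        have R: "pers ?R" by (intro pers_intros)
        have Rw: "?R w" using x yz IH ext_eq_iff[OF w] by blast
        have "incl w x z"
          unfolding incl_def
        proof (rule boxI[OF R Rw w], intro allI impI)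
          fix w c assume w: "world w" and R: "?R w" and c: "InEL c x \<in> w"
          then have IH: "\<forall>y. InEL y x \<in> w \<longrightarrow> holds w (y \<bullet> Var) ?a"
            and xy: "\<forall>a. InEL a x \<in> w \<longrightarrow> mem w a y" and yz: "\<forall>a. InEL a y \<in> w \<longrightarrow> mem w a z"
            unfolding incl_def using boxD[OF _ w] by blast+
          obtain b where b: "InEL b y \<in> w" "ext_eq w c b" using xy c by (auto simp: mem_def)
          then obtain d where d: "InEL d z \<in> w" "ext_eq w b d" using yz by (auto simp: mem_def)
          have "VS b \<in> w" "VS d \<in> w" using b d R VS_InEL[OF w] by blast+
          then have "ext_eq w c d" using IH'[OF w IH c] b d by blast
          then show "mem w c z" using d by (auto simp: mem_def)
        qed
        moreover have "incl w z x"
          unfolding incl_def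
        proof (rule boxI[OF R Rw w], intro allI impI)
          fix w c assume w: "world w" and R: "?R w" and c: "InEL c z \<in> w"
          then have IH: "\<forall>y. InEL y x \<in> w \<longrightarrow> holds w (y \<bullet> Var) ?a"
            and xy: "\<forall>a. InEL a y \<in> w \<longrightarrow> mem w a x" and yz: "\<forall>a. InEL a z \<in> w \<longrightarrow> mem w a y"
            unfolding incl_def using boxD[OF _ w] by blast+
          obtain b where b: "InEL b y \<in> w" "ext_eq w c b" using yz c by (auto simp: mem_def)
          then obtain d where d: "InEL d x \<in> w" "ext_eq w b d" using xy by (auto simp: mem_def)
          have v: "VS b \<in> w" "VS d \<in> w" "VS c \<in> w" using b d c R VS_InEL[OF w] by blast+
          \<comment> \<open>The induction hypothesis concerns the element \<open>d\<close> of
            \<open>x\<close>, so the chain is run from \<open>d\<close> to \<open>c\<close> and then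
            reversed.\<close>
          then have "ext_eq w d c" using IH'[OF w IH d(1)] b d ext_eq_sym[OF w] by blast
          then have "ext_eq w c d" using v ext_eq_sym[OF w] by blast
          then show "mem w c x" using d by (auto simp: mem_def)
        qed
        ultimately show "ext_eq w x z" using ext_eq_iff[OF w] x yz by blast
      qed
    qed (use w x IH in \<open>auto intro!: pers_intros\<close>)
  qed
  from boxD[OF this[unfolded a[OF w]] w] assms show ?thesis by blast
qed

text \<open>An element \<open>y\<close> of \<open>x\<close> equal to \<open>x\<close> is itself
  matched by an element of \<open>y\<close> equal to \<open>y\<close>, which the induction
  hypothesis for \<open>y\<close> excludes.\<close>

lemma mem_irrefl:
  assumes w: "world w" and x: "VS x \<in> w"
  shows "\<not> mem w x x"
proof -
  let ?a = "\<^bold>\<forall> (InEL (Var 0) (Var 1) \<^bold>\<and> sub [Var 0, Var 1] 0 eq \<^bold>\<longrightarrow> Fls)"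
  have a: "holds w (x \<bullet> Var) ?a \<longleftrightarrow> box w (\<lambda>w. \<forall>y. \<not> (InEL y x \<in> w \<and> ext_eq w y x))"
    if "world w" for w x using that by (simp add: holds_Uni_Impl)
  have "holds w (x \<bullet> Var) ?a"
  proof (rule VS_induct[OF w x])
    fix w x assume w: "world w" and x: "VS x \<in> w"
      and IH: "box w (\<lambda>w. \<forall>y. InEL y x \<in> w \<longrightarrow> holds w (y \<bullet> Var) ?a)"
    show "holds w (x \<bullet> Var) ?a"
      unfolding a[OF w]
    proof (rule boxI[of "\<lambda>w. VS x \<in> w \<and> box w (\<lambda>w. \<forall>y. InEL y x \<in> w \<longrightarrow> holds w (y \<bullet> Var) ?a)"],
        goal_cases)
      case (4 w)
      then have w: "world w" and x: "VS x \<in> w" by blast+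
      have IH: "holds w (y \<bullet> Var) ?a" if "InEL y x \<in> w" for y using 4 boxD[OF _ w] that by blast
      show ?case
      proof (intro allI notI)
        fix y assume y: "InEL y x \<in> w \<and> ext_eq w y x"
        then have "VS y \<in> w" using VS_InEL[OF w x] by blast
        then have "incl w x y" using y ext_eq_iff[OF w] x by blast
        from boxD[OF this[unfolded incl_def] w] have "mem w y y" using y by blast
        then obtain z where z: "InEL z y \<in> w" "ext_eq w y z" by (auto simp: mem_def)
        then have "ext_eq w z y" using VS_InEL[OF w] ext_eq_sym[OF w] \<open>VS y \<in> w\<close> by blast
        then show False using IH[of y] y z boxD[OF _ w] unfolding a[OF w] by blast
      qed
    qed (use w x IH in \<open>auto intro!: pers_intros\<close>)
  qed
  from boxD[OF this[unfolded a[OF w]] w] show ?thesis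
    unfolding mem_def using ext_eq_sym[OF w] VS_InEL[OF w x] x by blast
qed

lemma mem_ext_left:
  assumes "world w" "VS x \<in> w" "VS x' \<in> w" "VS y \<in> w" "ext_eq w x' x" "mem w x y"
  shows "mem w x' y"
  using assms unfolding mem_def by (meson VS_InEL ext_eq_trans)

lemma incl_mem:
  assumes w: "world w" and "VS x \<in> w" "VS y \<in> w" "VS z \<in> w" "incl w y z" "mem w x y"
  shows "mem w x z"
proof -
  obtain b where b: "InEL b y \<in> w" "ext_eq w x b" using assms by (auto simp: mem_def)
  then have "mem w b z" using boxD[OF assms(5)[unfolded incl_def] w] by blast
  then show ?thesis using mem_ext_left[OF w _ assms(2,4) b(2)] VS_InEL[OF w assms(3) b(1)] by blast
qed

lemma mem_ext_right:
  assumes "world w" "VS x \<in> w" "VS y \<in> w" "VS y' \<in> w" "ext_eq w y y'" "mem w x y"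
  shows "mem w x y'"
  using assms incl_mem[of w x y y'] ext_eq_iff by blast

lemma inclI:
  assumes "world w" "pers R" "R w" "\<And>w a. world w \<Longrightarrow> R w \<Longrightarrow> InEL a x \<in> w \<Longrightarrow> mem w a y"
  shows "incl w x y"
  unfolding incl_def by (rule boxI[OF assms(2,3,1)]) (use assms(4) in blast)

lemma empty_set_unique:
  assumes w: "world w" and "VS x \<in> w" "VS y \<in> w" "empty_set w x" "empty_set w y"
  shows "ext_eq w x y"
proof -
  have "incl w x y" "incl w y x"
    using assms(4,5) unfolding empty_set_def incl_def by (auto elim: box_mono)
  then show ?thesis using ext_eq_iff[OF w] assms by blast
qed

text \<open>One half of uniqueness; the other follows by exchanging the two successors.\<close>

lemma succ_set_incl:
  assumes w: "world w" and "VS s \<in> w" "VS n \<in> w" "VS s' \<in> w" "VS n' \<in> w"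
    "succ_set w s n" "succ_set w s' n'" "ext_eq w n n'"
  shows "incl w s s'"
proof (rule inclI[OF w, of "\<lambda>w. VS s \<in> w \<and> VS n \<in> w \<and> VS s' \<in> w \<and> VS n' \<in> w \<and>
    succ_set w s n \<and> succ_set w s' n' \<and> ext_eq w n n'"])
  fix w a assume w: "world w" and R: "VS s \<in> w \<and> VS n \<in> w \<and> VS s' \<in> w \<and> VS n' \<in> w \<and>
    succ_set w s n \<and> succ_set w s' n' \<and> ext_eq w n n'" and a: "InEL a s \<in> w"
  have va: "VS a \<in> w" using VS_InEL[OF w] R a by blast
  have "box w (\<lambda>w. \<forall>a. InEL a s \<in> w \<longrightarrow> mem w a n \<or> ext_eq w a n)" using R by (simp add: succ_set_def)
  from boxD[OF this w] consider "mem w a n" | "ext_eq w a n" using a by blast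
  then show "mem w a s'"
  proof cases
    case 1
    then have "mem w a n'" using mem_ext_right[OF w va] R by blast
    then show ?thesis using incl_mem[OF w va] R by (auto simp: succ_set_def)
  next
    case 2
    then have "ext_eq w a n'" using ext_eq_trans[OF w va] R by blast
    then show ?thesis using mem_ext_left[OF w _ va] R by (auto simp: succ_set_def)
  qed
qed (use assms in \<open>auto intro!: pers_intros\<close>)

lemma succ_set_unique:
  assumes w: "world w" and "VS s \<in> w" "VS n \<in> w" "VS s' \<in> w" "VS n' \<in> w"
    "succ_set w s n" "succ_set w s' n'" "ext_eq w n n'"
  shows "ext_eq w s s'"
  using succ_set_incl[OF w, of s n s' n'] succ_set_incl[OF w, of s' n' s n] ext_eq_sym[OF w, of n n']
    ext_eq_iff[OF w, of s s'] assms(2-8) by blast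

section \<open>Empty set, successor and pairs\<close>

lemma ex_empty_set:
  assumes w: "world w"
  obtains z where "VS z \<in> w" "empty_set w z"
proof -
  \<comment> \<open>The index of a v-set is a total function, so emptiness has to come from a
    condition that is never true; the element component is an arbitrary number.\<close>
  obtain c where c: "MC c \<in> w" "box w (\<lambda>w. TC c \<notin> w)" by (rule ex_false_code[OF w])
  have "box w (\<lambda>w. \<forall>n. \<exists>m. MC (Rgt m) \<in> w \<and> box w (\<lambda>w. TC (Rgt m) \<in> w \<longrightarrow> VS (Lft m) \<in> w) \<and>
    holds w (m \<bullet> n \<bullet> Var) (TC (Rgt (Var 0)) \<^bold>\<longrightarrow> Fls))"
  proof (rule boxI[of "\<lambda>w. MC c \<in> w \<and> box w (\<lambda>w. TC c \<notin> w)"], goal_cases)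
    case (4 w)
    have *: "norm w (Rgt (Pair Zero c)) = norm w c" if "world w" for w using that by simp
    have "MC (Rgt (Pair Zero c)) \<in> w" using 4 MC_cong[OF 4(1) *[OF 4(1)]] by blast
    moreover have "box w (\<lambda>w. TC (Rgt (Pair Zero c)) \<notin> w)"
      by (rule box_mono[of _ "\<lambda>w. TC c \<notin> w"]) (use 4 TC_cong[OF _ *] in blast)+
    ultimately show ?case
      by (intro allI exI[of _ "Pair Zero c"]) (auto simp: 4(1) holds_Impl elim: box_mono)
  qed (use w c in \<open>auto intro!: pers_intros\<close>)
  then obtain z where z: "VS z \<in> w" "box w (\<lambda>w. \<forall>n. \<exists>m. App z n m \<in> w \<and>
      holds w (m \<bullet> n \<bullet> Var) (TC (Rgt (Var 0)) \<^bold>\<longrightarrow> Fls))"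
    by (rule ex_v_set[OF w])
  have "empty_set w z"
    unfolding empty_set_def
  proof (rule box_mono[OF z(2)], intro allI notI)
    fix w a assume w: "world w" and z: "\<forall>n. \<exists>m. App z n m \<in> w \<and>
      holds w (m \<bullet> n \<bullet> Var) (TC (Rgt (Var 0)) \<^bold>\<longrightarrow> Fls)" and "InEL a z \<in> w"
    then obtain n m where m: "App z n m \<in> w" "TC (Rgt m) \<in> w" by (auto simp: InEL_iff El_iff)
    obtain m' where m': "App z n m' \<in> w" "holds w (m' \<bullet> n \<bullet> Var) (TC (Rgt (Var 0)) \<^bold>\<longrightarrow> Fls)"
      using z by blast
    have "norm w m = norm w m'" using App_functional[OF w m(1) m'(1)] .
    then have "TC (Rgt m') \<in> w" using TC_cong[OF w norm_Fn1_cong[OF w]] m(2) by blast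
    then show False using holds_mp[OF w m'(2)] w by simp
  qed
  with z(1) show ?thesis by (rule that)
qed

text \<open>Index 0 yields \<open>p\<close> and index \<open>j + 1\<close> copies the whole code
  \<open>p j\<close>. Copying the condition together with the element avoids having to decide its
  truth.\<close>

lemma ex_succ_set:
  assumes w: "world w" and p: "VS p \<in> w"
  obtains q where "VS q \<in> w" "succ_set w q p"
proof -
  let ?b = "(Var 1 \<^bold>= Zero \<^bold>\<and> Lft (Var 0) \<^bold>= Var 2 \<^bold>\<and> TC (Rgt (Var 0))) \<^bold>\<or>
    \<^bold>\<exists> (Var 2 \<^bold>= Succ (Var 0) \<^bold>\<and> App (Var 3) (Var 0) (Var 1))"
  have b: "holds w (m \<bullet> n \<bullet> p \<bullet> Var) ?b \<longleftrightarrow>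
      norm w n = Zq w \<and> norm w (Lft m) = norm w p \<and> TC (Rgt m) \<in> w \<or>
      (\<exists>j. norm w n = Sq w j \<and> App p j m \<in> w)" if "world w" for w m n
    using that by simp
  have "box w (\<lambda>w. \<forall>n. \<exists>m. MC (Rgt m) \<in> w \<and> box w (\<lambda>w. TC (Rgt m) \<in> w \<longrightarrow> VS (Lft m) \<in> w) \<and>
    holds w (m \<bullet> n \<bullet> p \<bullet> Var) ?b)"
  proof (rule boxI[OF pers_mem p w], intro allI)
    fix w n assume w: "world w" and p: "VS p \<in> w"
    consider "norm w n = Zq w" | j where "norm w n = Sq w j" using zero_or_succ[OF w] by blast
    then show "\<exists>m. MC (Rgt m) \<in> w \<and> box w (\<lambda>w. TC (Rgt m) \<in> w \<longrightarrow> VS (Lft m) \<in> w) \<and>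
      holds w (m \<bullet> n \<bullet> p \<bullet> Var) ?b"
    proof cases
      case 1
      let ?m = "Pair p true_code"
      have R: "norm w (Rgt ?m) = norm w true_code" and L: "norm w (Lft ?m) = norm w p"
        if "world w" for w using that by simp_all
      have "MC (Rgt ?m) \<in> w" "TC (Rgt ?m) \<in> w"
        using MC_cong[OF w R[OF w]] TC_cong[OF w R[OF w]] true_code[OF w] by blast+
      moreover have "box w (\<lambda>w. TC (Rgt ?m) \<in> w \<longrightarrow> VS (Lft ?m) \<in> w)"
        by (rule boxI[OF pers_mem p w]) (use VS_cong[OF _ L] in blast)
      ultimately show ?thesis unfolding b[OF w] using 1 L[OF w] by blast
    next
      case (2 j)
      then show ?thesis unfolding b[OF w] using boxD[OF VS_unfold[OF w p] w] by blast
    qed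
  qed
  then obtain q where q: "VS q \<in> w" "box w (\<lambda>w. \<forall>n. \<exists>m. App q n m \<in> w \<and> holds w (m \<bullet> n \<bullet> p \<bullet> Var) ?b)"
    by (rule ex_v_set[OF w])
  let ?R = "\<lambda>w. VS q \<in> w \<and> VS p \<in> w \<and> box w (\<lambda>w. \<forall>n. \<exists>m. App q n m \<in> w \<and> holds w (m \<bullet> n \<bullet> p \<bullet> Var) ?b)"
  have R: "pers ?R" by (intro pers_intros)
  have Rw: "?R w" using p q by blast
  have "mem w p q"
  proof -
    obtain m where m: "App q Zero m \<in> w" "holds w (m \<bullet> Zero \<bullet> p \<bullet> Var) ?b" using boxD[OF q(2) w] by blast
    then have *: "norm w (Lft m) = norm w p" "TC (Rgt m) \<in> w" using w unfolding b[OF w] by auto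
    then have "InEL p q \<in> w" using App_InEL[OF w m(1)] InEL_cong[OF w _ refl] by blast
    then show ?thesis using InEL_mem[OF w q(1)] by blast
  qed
  moreover have "incl w p q"
  proof (rule inclI[OF w R Rw])
    fix w a assume w: "world w" and R: "?R w" and "InEL a p \<in> w"
    then obtain n m where m: "App p n m \<in> w" "TC (Rgt m) \<in> w" "norm w a = norm w (Lft m)"
      by (auto simp: InEL_iff El_iff)
    obtain m' where m': "App q (Succ n) m' \<in> w" "holds w (m' \<bullet> Succ n \<bullet> p \<bullet> Var) ?b"
      using R boxD[OF _ w] by blast
    then obtain j where "norm w n = norm w j" "App p j m' \<in> w" using w unfolding b[OF w] by auto
    then have "norm w m = norm w m'" using App_cong[OF w refl _ refl] App_functional[OF w m(1)] by blast
    then have "norm w a = norm w (Lft m')" "TC (Rgt m') \<in> w"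
      using m(2,3) norm_Fn1_cong[OF w, of m m'] TC_cong[OF w] by metis+
    then have "InEL a q \<in> w" using App_InEL[OF w m'(1)] InEL_cong[OF w _ refl] by blast
    then show "mem w a q" using InEL_mem[OF w] R by blast
  qed
  moreover have "box w (\<lambda>w. \<forall>a. InEL a q \<in> w \<longrightarrow> mem w a p \<or> ext_eq w a p)"
  proof (rule boxI[OF R Rw w], intro allI impI)
    fix w a assume w: "world w" and R: "?R w" and a: "InEL a q \<in> w"
    then obtain n m where m: "App q n m \<in> w" "TC (Rgt m) \<in> w" "norm w a = norm w (Lft m)"
      by (auto simp: InEL_iff El_iff)
    obtain m' where m': "App q n m' \<in> w" "holds w (m' \<bullet> n \<bullet> p \<bullet> Var) ?b"
      using R boxD[OF _ w] by blast
    have mm: "norm w m = norm w m'" using App_functional[OF w m(1) m'(1)] .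
    from m'(2) consider "norm w (Lft m') = norm w p" | j where "App p j m' \<in> w"
      unfolding b[OF w] by blast
    then show "mem w a p \<or> ext_eq w a p"
    proof cases
      case 1
      then have "norm w a = norm w p" using m(3) norm_Fn1_cong[OF w mm] by metis
      moreover have "ext_eq w p p" using ext_eq_refl[OF w] R by blast
      ultimately show ?thesis unfolding ext_eq_def using holds_cong[OF w] by blast
    next
      case 2
      then have "App p j m \<in> w" using App_cong[OF w refl refl mm] by blast
      then have "InEL (Lft m) p \<in> w" using App_InEL[OF w _ m(2)] by blast
      then have "InEL a p \<in> w" using InEL_cong[OF w m(3) refl] by blast
      then show ?thesis using InEL_mem[OF w] R by blast
    qed
  qed
  ultimately have "succ_set w q p" unfolding succ_set_def by blast
  with q(1) show ?thesis by (rule that)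
qed

lemma ex_upair_set:
  assumes w: "world w" and a: "VS a \<in> w" and b: "VS b \<in> w"
  obtains u where "VS u \<in> w" "upair_set w u a b"
proof -
  \<comment> \<open>Index 0 names \<open>a\<close>, and every successor names
    \<open>b\<close>.\<close>
  let ?f = "(Var 1 \<^bold>= Zero \<^bold>\<and> Var 0 \<^bold>= Var 2) \<^bold>\<or> (\<^bold>\<exists> (Var 2 \<^bold>= Succ (Var 0)) \<^bold>\<and> Var 0 \<^bold>= Var 3)"
  have f: "holds w (c \<bullet> n \<bullet> a \<bullet> b \<bullet> Var) ?f \<longleftrightarrow>
      norm w n = Zq w \<and> norm w c = norm w a \<or> (\<exists>j. norm w n = Sq w j) \<and> norm w c = norm w b"
    if "world w" for w c n using that by simp
  have "box w (\<lambda>w. \<forall>n. \<exists>c. VS c \<in> w \<and> holds w (c \<bullet> n \<bullet> a \<bullet> b \<bullet> Var) ?f)"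
  proof (rule boxI[of "\<lambda>w. VS a \<in> w \<and> VS b \<in> w"], goal_cases)
    case (4 w)
    then show ?case unfolding f[OF 4(1)] using zero_or_succ[OF 4(1)] by blast
  qed (use w a b in \<open>auto intro!: pers_intros\<close>)
  then obtain u where u: "VS u \<in> w"
    "box w (\<lambda>w. \<forall>n. \<exists>c. El u n c \<in> w \<and> holds w (c \<bullet> n \<bullet> a \<bullet> b \<bullet> Var) ?f)"
    by (rule ex_v_set_enumerated[OF w])
  have ua: "InEL a u \<in> w" 
  proof -
    obtain c where "El u Zero c \<in> w" "holds w (c \<bullet> Zero \<bullet> a \<bullet> b \<bullet> Var) ?f" using boxD[OF u(2) w] by blast
    then have "InEL c u \<in> w" "norm w c = norm w a" using w unfolding f[OF w] by (auto simp: InEL_iff)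
    then show ?thesis using InEL_cong[OF w _ refl] by blast
  qed
  have ub: "InEL b u \<in> w"
  proof -
    obtain c where "El u (Succ Zero) c \<in> w" "holds w (c \<bullet> Succ Zero \<bullet> a \<bullet> b \<bullet> Var) ?f"
      using boxD[OF u(2) w] by blast
    then have "InEL c u \<in> w" "norm w c = norm w b" using w unfolding f[OF w] by (auto simp: InEL_iff)
    then show ?thesis using InEL_cong[OF w _ refl] by blast
  qed
  have "box w (\<lambda>w. \<forall>c. InEL c u \<in> w \<longrightarrow> ext_eq w c a \<or> ext_eq w c b)"
  proof (rule boxI[of "\<lambda>w. VS a \<in> w \<and> VS b \<in> w \<and>
      box w (\<lambda>w. \<forall>n. \<exists>c. El u n c \<in> w \<and> holds w (c \<bullet> n \<bullet> a \<bullet> b \<bullet> Var) ?f)"], goal_cases)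
    case (4 w)
    then have w: "world w" by blast
    have u: "\<forall>n. \<exists>c. El u n c \<in> w \<and> holds w (c \<bullet> n \<bullet> a \<bullet> b \<bullet> Var) ?f" using 4 boxD[OF _ w] by blast
    show ?case
    proof (intro allI impI)
      fix c assume "InEL c u \<in> w"
      from enumerated_InEL[OF w u this] have "norm w c = norm w a \<or> norm w c = norm w b"
        unfolding f[OF w] by blast
      moreover have "ext_eq w a a" "ext_eq w b b" using ext_eq_refl[OF w] 4 by blast+
      ultimately show "ext_eq w c a \<or> ext_eq w c b"
        unfolding ext_eq_def using holds_cong[OF w] by blast
    qed
  qed (use w a b u in \<open>auto intro!: pers_intros\<close>)
  then have "upair_set w u a b" unfolding upair_set_def using InEL_mem[OF w u(1)] ua ub by blast
  with u(1) show ?thesis by (rule that)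
qed

lemma upair_set_ext:
  assumes w: "world w" and "VS u \<in> w" "VS v \<in> w" "VS a \<in> w" "VS b \<in> w"
    "ext_eq w v u" "upair_set w u a b"
  shows "upair_set w v a b"
proof -
  have "ext_eq w u v" using ext_eq_sym[OF w] assms by blast
  then have "mem w a v" "mem w b v"
    using mem_ext_right[OF w] assms by (auto simp: upair_set_def)
  moreover have "box w (\<lambda>w. \<forall>c. InEL c v \<in> w \<longrightarrow> ext_eq w c a \<or> ext_eq w c b)"
  proof (rule boxI[of "\<lambda>w. VS u \<in> w \<and> VS v \<in> w \<and> VS a \<in> w \<and> VS b \<in> w \<and> ext_eq w v u \<and>
      upair_set w u a b"], goal_cases)
    case (4 w)
    then have w: "world w" by blast
    show ?case
    proof (intro allI impI)
      fix c assume c: "InEL c v \<in> w"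
      have vc: "VS c \<in> w" using VS_InEL[OF w] 4 c by blast
      have "mem w c u" using InEL_mem[OF w _ c] mem_ext_right[OF w vc] 4 by blast
      then obtain d where d: "InEL d u \<in> w" "ext_eq w c d" by (auto simp: mem_def)
      have vd: "VS d \<in> w" using VS_InEL[OF w] 4 d by blast
      have "ext_eq w d a \<or> ext_eq w d b" using 4 d boxD[OF _ w] unfolding upair_set_def by blast
      then show "ext_eq w c a \<or> ext_eq w c b" using ext_eq_trans[OF w vc vd _ d(2)] 4 by blast
    qed
  qed (use assms in \<open>auto intro!: pers_intros\<close>)
  ultimately show ?thesis by (simp add: upair_set_def)
qed

text \<open>The elements of \<open>p\<close> are known only to equal \<open>u\<close> or
  \<open>v\<close>, so their properties are carried over by \<open>upair_set_ext\<close>.\<close>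

lemma ex_opair_set:
  assumes w: "world w" and a: "VS a \<in> w" and b: "VS b \<in> w"
  obtains p where "VS p \<in> w" "opair_set w p a b"
proof -
  obtain u where u: "VS u \<in> w" "upair_set w u a a" by (rule ex_upair_set[OF w a a])
  obtain v where v: "VS v \<in> w" "upair_set w v a b" by (rule ex_upair_set[OF w a b])
  obtain p where p: "VS p \<in> w" "upair_set w p u v" by (rule ex_upair_set[OF w u(1) v(1)])
  have "\<exists>c. InEL c p \<in> w \<and> upair_set w c a a"
  proof -
    obtain c where c: "InEL c p \<in> w" "ext_eq w u c" using p(2) by (auto simp: upair_set_def mem_def)
    have vc: "VS c \<in> w" using VS_InEL[OF w p(1) c(1)] .
    then show ?thesis using c upair_set_ext[OF w u(1) vc a a ext_eq_sym[OF w u(1) vc c(2)] u(2)] by blast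
  qed
  moreover have "\<exists>c. InEL c p \<in> w \<and> upair_set w c a b"
  proof -
    obtain c where c: "InEL c p \<in> w" "ext_eq w v c" using p(2) by (auto simp: upair_set_def mem_def)
    have vc: "VS c \<in> w" using VS_InEL[OF w p(1) c(1)] .
    then show ?thesis using c upair_set_ext[OF w v(1) vc a b ext_eq_sym[OF w v(1) vc c(2)] v(2)] by blast
  qed
  moreover have "box w (\<lambda>w. \<forall>c. InEL c p \<in> w \<longrightarrow> upair_set w c a a \<or> upair_set w c a b)"
  proof (rule boxI[of "\<lambda>w. VS a \<in> w \<and> VS b \<in> w \<and> VS u \<in> w \<and> VS v \<in> w \<and> VS p \<in> w \<and>
      upair_set w u a a \<and> upair_set w v a b \<and> upair_set w p u v"], goal_cases)
    case (4 w)
    then have w: "world w" by blast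
    show ?case
    proof (intro allI impI)
      fix c assume c: "InEL c p \<in> w"
      have vc: "VS c \<in> w" using VS_InEL[OF w] 4 c by blast
      have "ext_eq w c u \<or> ext_eq w c v" using 4 c boxD[OF _ w] unfolding upair_set_def by blast
      then show "upair_set w c a a \<or> upair_set w c a b" using upair_set_ext[OF w _ vc] 4 by blast
    qed
  qed (use a b u v p w in \<open>auto intro!: pers_intros\<close>)
  ultimately have "opair_set w p a b" by (simp add: opair_set_def)
  with p(1) show ?thesis by (rule that)
qed

section \<open>Injectivity of ordered pairs\<close>

lemma upair_set_members:
  assumes w: "world w" and u: "VS u \<in> w" and "VS a \<in> w" "VS b \<in> w" "VS c \<in> w" "VS d \<in> w"
    "upair_set w u a b" "upair_set w u c d"
  shows "(ext_eq w a c \<or> ext_eq w a d) \<and> (ext_eq w b c \<or> ext_eq w b d)"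
proof -
  have *: "ext_eq w x c \<or> ext_eq w x d" if x: "VS x \<in> w" and "mem w x u" for x
  proof -
    obtain e where e: "InEL e u \<in> w" "ext_eq w x e" using \<open>mem w x u\<close> by (auto simp: mem_def)
    have ve: "VS e \<in> w" using VS_InEL[OF w u e(1)] .
    have "box w (\<lambda>w. \<forall>e. InEL e u \<in> w \<longrightarrow> ext_eq w e c \<or> ext_eq w e d)"
      using assms(8) by (simp add: upair_set_def)
    from boxD[OF this w] e(1) have "ext_eq w e c \<or> ext_eq w e d" by blast
    then show ?thesis using ext_eq_trans[OF w x ve _ e(2)] assms by blast
  qed
  then show ?thesis using assms(3,4,7) by (simp add: upair_set_def)
qed

lemma opair_set_inject:
  assumes w: "world w" and p: "VS p \<in> w" and v: "VS a \<in> w" "VS b \<in> w" "VS c \<in> w" "VS d \<in> w"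
    and ab: "opair_set w p a b" and cd: "opair_set w p c d"
  shows "ext_eq w a c \<and> ext_eq w b d"
proof -
  have sym: "ext_eq w x y \<Longrightarrow> ext_eq w y x" if "x \<in> {a, b, c, d}" "y \<in> {a, b, c, d}" for x y
    using that v ext_eq_sym[OF w] by blast
  have trans: "ext_eq w x y \<Longrightarrow> ext_eq w y z \<Longrightarrow> ext_eq w x z"
    if "x \<in> {a, b, c, d}" "y \<in> {a, b, c, d}" "z \<in> {a, b, c, d}" for x y z
    using that v ext_eq_trans[OF w, of x y z] by blast
  have cd': "\<forall>u. InEL u p \<in> w \<longrightarrow> upair_set w u c c \<or> upair_set w u c d"
    using cd boxD[OF _ w] unfolding opair_set_def by blast
  have ab': "\<forall>u. InEL u p \<in> w \<longrightarrow> upair_set w u a a \<or> upair_set w u a b"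
    using ab boxD[OF _ w] unfolding opair_set_def by blast
  obtain u1 where u1: "InEL u1 p \<in> w" "upair_set w u1 a a" using ab unfolding opair_set_def by blast
  obtain u2 where u2: "InEL u2 p \<in> w" "upair_set w u2 a b" using ab unfolding opair_set_def by blast
  obtain u3 where u3: "InEL u3 p \<in> w" "upair_set w u3 c d" using cd unfolding opair_set_def by blast
  have vu: "VS u1 \<in> w" "VS u2 \<in> w" "VS u3 \<in> w" using VS_InEL[OF w p] u1 u2 u3 by blast+
  have ac: "ext_eq w a c"
    using cd' u1 upair_set_members[OF w vu(1), of c c a a] upair_set_members[OF w vu(1), of c d a a]
      v sym by blast
  have b: "ext_eq w b c \<or> ext_eq w b d"
    using cd' u2 upair_set_members[OF w vu(2), of a b c c] upair_set_members[OF w vu(2), of a b c d] v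
    by blast
  have d: "ext_eq w d a \<or> ext_eq w d b"
    using ab' u3 upair_set_members[OF w vu(3), of c d a a] upair_set_members[OF w vu(3), of c d a b] v
    by blast
  \<comment> \<open>In the remaining case \<open>b\<close> equals \<open>c\<close>, hence
    \<open>a\<close>; since \<open>d\<close> equals \<open>a\<close> or \<open>b\<close>, it equals
    \<open>b\<close> either way.\<close>
  have "ext_eq w b d"
    using b
  proof
    assume bc: "ext_eq w b c"
    then have ba: "ext_eq w b a" using trans[of b c a] sym[of a c] ac by blast
    show ?thesis using d ba trans[of b a d] sym[of d a] sym[of d b] by blast
  qed
  with ac show ?thesis by blast
qed

section \<open>The set of natural numbers\<close>

definition numerals :: "fm set \<Rightarrow> tm \<Rightarrow> bool" where
  "numerals w h \<longleftrightarrow> (\<exists>z. App h Zero z \<in> w \<and> empty_set w z) \<and>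
     box w (\<lambda>w. \<forall>k. \<exists>p q. App h k p \<in> w \<and> App h (Succ k) q \<in> w \<and> VS p \<in> w \<and> VS q \<in> w \<and>
       succ_set w q p)"

definition omega_set :: "fm set \<Rightarrow> tm \<Rightarrow> tm \<Rightarrow> bool" where
  "omega_set w W h \<longleftrightarrow> VS W \<in> w \<and> numerals w h \<and>
     box w (\<lambda>w. \<forall>n. \<exists>a. El W n a \<in> w \<and> App h n a \<in> w)"

lemma pers_numerals [pers_intros]: "pers (\<lambda>w. numerals w h)" "pers (\<lambda>w. omega_set w W h)"
  unfolding numerals_def omega_set_def by (intro pers_intros)+

text \<open>The von Neumann numerals arise from the same iteration principle as the final sequence,
  with \<open>VS\<close> as the almost negative domain and the successor relation as the
  step.\<close>

lemma ex_numerals: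
  assumes w: "world w"
  obtains h where "numerals w h"
proof -
  obtain z where z: "VS z \<in> w" "empty_set w z" by (rule ex_empty_set[OF w])
  have z': "holds w (z \<bullet> Var) (VS (Var 0))" using z by simp
  have step: "box w (\<lambda>w. \<forall>p. holds w (p \<bullet> Var) (VS (Var 0)) \<longrightarrow>
      (\<exists>q. holds w (q \<bullet> Var) (VS (Var 0)) \<and> holds w (q \<bullet> p \<bullet> Var) (interp eq (is_succ 0 1))))"
    by (rule box_necessitation) (auto simp: holds_succ_set elim: ex_succ_set)
  obtain h where "App h Zero z \<in> w" "box w (\<lambda>w. \<forall>k. \<exists>p q. App h k p \<in> w \<and> App h (Succ k) q \<in> w \<and>
       holds w (p \<bullet> Var) (VS (Var 0)) \<and> holds w (q \<bullet> Var) (VS (Var 0)) \<and>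
       holds w (q \<bullet> p \<bullet> Var) (interp eq (is_succ 0 1)))"
    by (rule number_rdc[OF w almost_neg.intros(2) z' step])
  then have "numerals w h" using z(2) unfolding numerals_def by (auto simp: holds_succ_set)
  then show ?thesis by (rule that)
qed

lemma numerals_VS:
  assumes w: "world w" and h: "numerals w h" and "App h k a \<in> w"
  shows "VS a \<in> w"
proof -
  obtain p where "App h k p \<in> w" "VS p \<in> w" using h boxD[OF _ w] unfolding numerals_def by blast
  then show ?thesis using App_functional[OF w assms(3)] VS_cong[OF w] by blast
qed

lemma numerals_succ:
  assumes w: "world w" and h: "numerals w h" and "App h k a \<in> w" "App h (Succ k) b \<in> w"
  shows "succ_set w b a"
proof -
  obtain p q where "App h k p \<in> w" "App h (Succ k) q \<in> w" and pq: "succ_set w q p"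
    using h boxD[OF _ w] unfolding numerals_def by blast
  then have "norm w b = norm w q" "norm w a = norm w p" using App_functional[OF w] assms by blast+
  from holds_cong2[OF w this, of Var "interp eq (is_succ 0 1)"] pq show ?thesis
    using w by (simp add: holds_succ_set)
qed

lemma numerals_defined: "world w \<Longrightarrow> numerals w h \<Longrightarrow> \<exists>a. App h k a \<in> w"
  unfolding numerals_def using boxD by blast

text \<open>Induction on \<open>d\<close>. The difference is \<open>d + 1\<close>, so the base case
  is a numeral and its immediate successor.\<close>

lemma numerals_mem:
  assumes w: "world w" and h: "numerals w h"
    and a: "App h k a \<in> w" and b: "App h j b \<in> w" and j: "norm w j = norm w (Fn pAdd [k, Succ d])"
  shows "mem w a b"
proof -
  let ?a = "\<^bold>\<exists> \<^bold>\<exists> (App (Var 4) (Var 3) (Var 1) \<^bold>\<and> App (Var 4) (Fn pAdd [Var 3, Succ (Var 2)]) (Var 0) \<^bold>\<and>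
    interp eq (SMem 1 0))"
  have a_iff: "holds w (d \<bullet> k \<bullet> h \<bullet> Var) ?a \<longleftrightarrow>
      (\<exists>a b. App h k a \<in> w \<and> App h (Fn pAdd [k, Succ d]) b \<in> w \<and> mem w a b)"
    if "world w" for w d using that by (simp add: holds_interp(2) del: interp.simps)
  have "holds w (d \<bullet> k \<bullet> h \<bullet> Var) ?a"
  proof (rule induct_world[OF w])
    obtain p q where pq: "App h k p \<in> w" "App h (Succ k) q \<in> w" "succ_set w q p"
      using h boxD[OF _ w] unfolding numerals_def by blast
    have "norm w (Succ k) = norm w (Fn pAdd [k, Succ Zero])" using w by simp
    then have "App h (Fn pAdd [k, Succ Zero]) q \<in> w" using pq(2) App_cong[OF w refl _ refl] by blast
    then show "holds w (Zero \<bullet> k \<bullet> h \<bullet> Var) ?a"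
      unfolding a_iff[OF w] using pq by (auto simp: succ_set_def)
    show "box w (\<lambda>w. \<forall>d. holds w (d \<bullet> k \<bullet> h \<bullet> Var) ?a \<longrightarrow> holds w (Succ d \<bullet> k \<bullet> h \<bullet> Var) ?a)"
    proof (rule boxI[OF pers_numerals(1) h w], intro allI impI)
      fix w d assume w: "world w" and h: "numerals w h" and "holds w (d \<bullet> k \<bullet> h \<bullet> Var) ?a"
      then obtain a b where ab: "App h k a \<in> w" "App h (Fn pAdd [k, Succ d]) b \<in> w" "mem w a b"
        unfolding a_iff[OF w] by blast
      obtain c where c: "App h (Succ (Fn pAdd [k, Succ d])) c \<in> w" using numerals_defined[OF w h] by blast
      have v: "VS a \<in> w" "VS b \<in> w" "VS c \<in> w" using numerals_VS[OF w h] ab c by blast+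
      have "incl w b c" using numerals_succ[OF w h ab(2) c] by (simp add: succ_set_def)
      then have "mem w a c" using incl_mem[OF w v] ab(3) by blast
      moreover have "norm w (Succ (Fn pAdd [k, Succ d])) = norm w (Fn pAdd [k, Succ (Succ d)])"
        using w by simp
      then have "App h (Fn pAdd [k, Succ (Succ d)]) c \<in> w" using c App_cong[OF w refl _ refl] by blast
      ultimately show "holds w (Succ d \<bullet> k \<bullet> h \<bullet> Var) ?a" unfolding a_iff[OF w] using ab(1) by blast
    qed
  qed
  then obtain a' b' where ab: "App h k a' \<in> w" "App h (Fn pAdd [k, Succ d]) b' \<in> w" "mem w a' b'"
    unfolding a_iff[OF w] by blast
  have "App h (Fn pAdd [k, Succ d]) b \<in> w" using App_cong[OF w refl j refl] b by blast
  then have "norm w a = norm w a'" "norm w b = norm w b'" using App_functional[OF w] ab a by blast+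
  from holds_cong2[OF w this, of Var "interp eq (SMem 0 1)"] ab(3) show ?thesis
    using w by (simp add: holds_interp(2) del: interp.simps)
qed

text \<open>If the indices differed, one numeral would be a member of the other and, being equal to
  it, of itself. This is the bridge from extensional equality of arguments to equality of
  indices.\<close>

lemma numerals_inject:
  assumes w: "world w" and h: "numerals w h"
    and a: "App h k a \<in> w" and b: "App h j b \<in> w" and ab: "ext_eq w a b"
  shows "norm w k = norm w j"
proof -
  have v: "VS a \<in> w" "VS b \<in> w" using numerals_VS[OF w h] a b by blast+
  have ba: "ext_eq w b a" using ext_eq_sym[OF w v ab] .
  have no: "\<not> mem w a b" "\<not> mem w b a"
    using mem_irrefl[OF w] mem_ext_right[OF w v(1) v(2) v(1) ba] mem_ext_right[OF w v(2) v(1) v(2) ab] v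
    by blast+
  from le_or_greater[OF w, of j k] show ?thesis
  proof (elim disjE exE)
    fix d assume d: "norm w j = Fq w pAdd [k, d]"
    consider "norm w d = Zq w" | s where "norm w d = Sq w s" using zero_or_succ[OF w] by blast
    then show ?thesis
    proof cases
      case 1
      then show ?thesis using d w Fq_absorb(3)[OF w, of pAdd k d] by simp
    next
      case (2 s)
      then have "norm w j = norm w (Fn pAdd [k, Succ s])" using d w Fq_absorb(3)[OF w, of pAdd k d] by simp
      then show ?thesis using numerals_mem[OF w h a b] no by blast
    qed
  next
    fix d assume "norm w k = Fq w pAdd [j, Sq w d]"
    then have "norm w k = norm w (Fn pAdd [j, Succ d])" using w by simp
    then show ?thesis using numerals_mem[OF w h b a] no by blast
  qed
qed

lemma ex_omega_set:
  assumes w: "world w" and h: "numerals w h"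
  obtains W where "omega_set w W h"
proof -
  have "box w (\<lambda>w. \<forall>n. \<exists>a. VS a \<in> w \<and> holds w (a \<bullet> n \<bullet> h \<bullet> Var) (App (Var 2) (Var 1) (Var 0)))"
    by (rule boxI[OF pers_numerals(1) h w]) (use numerals_defined numerals_VS in force)
  then obtain W where "VS W \<in> w"
    "box w (\<lambda>w. \<forall>n. \<exists>a. El W n a \<in> w \<and> holds w (a \<bullet> n \<bullet> h \<bullet> Var) (App (Var 2) (Var 1) (Var 0)))"
    by (rule ex_v_set_enumerated[OF w])
  then have "omega_set w W h" using h by (simp add: omega_set_def)
  then show ?thesis by (rule that)
qed

lemma omega_set_numerals: "omega_set w W h \<Longrightarrow> numerals w h"
  by (simp add: omega_set_def)

text \<open>The indices of \<open>W\<close> and of \<open>h\<close> agree, so the index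
  \<open>k\<close> under which an element occurs in \<omega> is also the argument at which
  \<open>r\<close> is evaluated.\<close>

lemma omega_set_El:
  assumes w: "world w" and W: "omega_set w W h"
  shows "El W k a \<in> w \<longleftrightarrow> App h k a \<in> w"
proof -
  obtain b where b: "El W k b \<in> w" "App h k b \<in> w" using W boxD[OF _ w] unfolding omega_set_def by blast
  show ?thesis
  proof
    assume "El W k a \<in> w"
    then have "norm w a = norm w b" using El_functional[OF w] b by blast
    then show "App h k a \<in> w" using b App_cong[OF w refl refl] by blast
  next
    assume "App h k a \<in> w"
    then have "norm w a = norm w b" using App_functional[OF w] b by blast
    then show "El W k a \<in> w" using b(1) unfolding El_iff[OF w] by simp
  qed
qed

lemma omega_set_InEL:
  "world w \<Longrightarrow> omega_set w W h \<Longrightarrow> InEL a W \<in> w \<longleftrightarrow> (\<exists>k. App h k a \<in> w)"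
  by (simp add: InEL_iff omega_set_El)

lemma omega_set_inductive:
  assumes w: "world w" and W: "omega_set w W h"
  shows "inductive_vset w W"
  unfolding inductive_vset_def
proof (intro conjI)
  show "\<exists>z. InEL z W \<in> w \<and> empty_set w z"
    using omega_set_InEL[OF w W] omega_set_numerals[OF W] unfolding numerals_def by blast
  show "box w (\<lambda>w. \<forall>n. InEL n W \<in> w \<longrightarrow> (\<exists>s. InEL s W \<in> w \<and> succ_set w s n))"
  proof (rule boxI[OF pers_numerals(2) W w], intro allI impI)
    fix w n assume w: "world w" and W: "omega_set w W h" and "InEL n W \<in> w"
    note h = omega_set_numerals[OF W]
    from \<open>InEL n W \<in> w\<close> obtain k where k: "App h k n \<in> w" using omega_set_InEL[OF w W] by blast
    obtain s where s: "App h (Succ k) s \<in> w" using numerals_defined[OF w h] by blast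
    show "\<exists>s. InEL s W \<in> w \<and> succ_set w s n"
      using s numerals_succ[OF w h k s] omega_set_InEL[OF w W] by blast
  qed
qed

text \<open>Induction on \<open>k\<close>. The set \<open>v\<close> contains the numerals only up to
  equality, and uniqueness of empty sets and of successors bridges the difference.\<close>

lemma omega_set_least:
  assumes w: "world w" and h: "numerals w h" and v: "VS v \<in> w" and iv: "inductive_vset w v"
    and a: "App h k a \<in> w"
  shows "mem w a v"
proof -
  let ?a = "\<^bold>\<exists> (App (Var 2) (Var 1) (Var 0) \<^bold>\<and> interp eq (SMem 0 3))"
  have a_iff: "holds w (k \<bullet> h \<bullet> v \<bullet> Var) ?a \<longleftrightarrow> (\<exists>a. App h k a \<in> w \<and> mem w a v)"
    if "world w" for w k using that by (simp add: holds_interp(2) del: interp.simps)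
  have "holds w (k \<bullet> h \<bullet> v \<bullet> Var) ?a"
  proof (rule induct_world[OF w])
    obtain z where z: "App h Zero z \<in> w" "empty_set w z" using h unfolding numerals_def by blast
    obtain e where e: "InEL e v \<in> w" "empty_set w e" using iv unfolding inductive_vset_def by blast
    have "ext_eq w z e"
      using empty_set_unique[OF w _ _ z(2) e(2)] numerals_VS[OF w h z(1)] VS_InEL[OF w v e(1)] by blast
    then show "holds w (Zero \<bullet> h \<bullet> v \<bullet> Var) ?a"
      unfolding a_iff[OF w] mem_def using z e by blast
    show "box w (\<lambda>w. \<forall>k. holds w (k \<bullet> h \<bullet> v \<bullet> Var) ?a \<longrightarrow> holds w (Succ k \<bullet> h \<bullet> v \<bullet> Var) ?a)"
    proof (rule boxI[of "\<lambda>w. numerals w h \<and> VS v \<in> w \<and> inductive_vset w v"], goal_cases)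
      case (4 w)
      then have w: "world w" and h: "numerals w h" and v: "VS v \<in> w" and iv: "inductive_vset w v" by blast+
      show ?case
      proof (intro allI impI)
        fix k assume "holds w (k \<bullet> h \<bullet> v \<bullet> Var) ?a"
        then obtain a where a: "App h k a \<in> w" "mem w a v" unfolding a_iff[OF w] by blast
        then obtain b where b: "InEL b v \<in> w" "ext_eq w a b" by (auto simp: mem_def)
        obtain s where s: "InEL s v \<in> w" "succ_set w s b"
          using iv b(1) boxD[OF _ w] unfolding inductive_vset_def by blast
        obtain c where c: "App h (Succ k) c \<in> w" using numerals_defined[OF w h] by blast
        have "VS a \<in> w" "VS b \<in> w" "VS s \<in> w" "VS c \<in> w"
          using numerals_VS[OF w h] VS_InEL[OF w v] a b s c by blast+
        then have "ext_eq w c s"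
          using succ_set_unique[OF w _ _ _ _ numerals_succ[OF w h a(1) c] s(2) b(2)] by blast
        then show "holds w (Succ k \<bullet> h \<bullet> v \<bullet> Var) ?a"
          unfolding a_iff[OF w] mem_def using c s(1) by blast
      qed
    qed (use w h v iv in \<open>auto intro!: pers_intros\<close>)
  qed
  then obtain a' where a': "App h k a' \<in> w" "mem w a' v" unfolding a_iff[OF w] by blast
  have "norm w a = norm w a'" using App_functional[OF w a a'(1)] .
  then show ?thesis using a'(2) unfolding mem_def ext_eq_def using holds_cong[OF w] by blast
qed

lemma holds_is_omega:
  assumes w: "world w" and W: "omega_set w W h"
  shows "holds w (W \<bullet> \<sigma>) (interp eq (is_omega 0))"
proof -
  have "box w (\<lambda>w. \<forall>v. VS v \<in> w \<longrightarrow> box w (\<lambda>w. inductive_vset w v \<longrightarrow> incl w W v))"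
  proof (rule boxI[OF pers_numerals(2) W w], intro allI impI)
    fix w v assume w: "world w" and W: "omega_set w W h" and v: "VS v \<in> w"
    show "box w (\<lambda>w. inductive_vset w v \<longrightarrow> incl w W v)"
    proof (rule boxI[of "\<lambda>w. omega_set w W h \<and> VS v \<in> w"], goal_cases)
      case (4 w)
      then have w: "world w" by blast
      show ?case
      proof
        assume iv: "inductive_vset w v"
        show "incl w W v"
        proof (rule inclI[OF w, of "\<lambda>w. omega_set w W h \<and> VS v \<in> w \<and> inductive_vset w v"])
          fix w a assume w: "world w" and R: "omega_set w W h \<and> VS v \<in> w \<and> inductive_vset w v"
            and "InEL a W \<in> w"
          then obtain k where "App h k a \<in> w" using omega_set_InEL[OF w] by blast
          then show "mem w a v" using omega_set_least[OF w omega_set_numerals] R by blast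
        qed (use 4 iv in \<open>auto intro!: pers_intros\<close>)
      qed
    qed (use w W v in \<open>auto intro!: pers_intros\<close>)
  qed
  then show ?thesis
    using w omega_set_inductive[OF w W]
    by (simp add: is_omega_def holds_inductive_vset holds_Uni_Impl holds_Impl incl_def mem_def)
qed

section \<open>Functions on the natural numbers\<close>

definition graph_set :: "fm set \<Rightarrow> tm \<Rightarrow> tm \<Rightarrow> tm \<Rightarrow> bool" where
  "graph_set w f h r \<longleftrightarrow> VS f \<in> w \<and> box w (\<lambda>w. \<forall>n. \<exists>y. App r n y \<in> w \<and> VS y \<in> w) \<and>
     box w (\<lambda>w. \<forall>n. \<exists>p. El f n p \<in> w \<and>
       (\<exists>a y. App h n a \<in> w \<and> App r n y \<in> w \<and> opair_set w p a y))"

lemma pers_graph_set [pers_intros]: "pers (\<lambda>w. graph_set w f h r)"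
  unfolding graph_set_def by (intro pers_intros)

lemma ex_graph_set:
  assumes w: "world w" and h: "numerals w h" and r: "box w (\<lambda>w. \<forall>n. \<exists>y. App r n y \<in> w \<and> VS y \<in> w)"
  obtains f where "graph_set w f h r"
proof -
  let ?b = "\<^bold>\<exists> \<^bold>\<exists> (App (Var 4) (Var 3) (Var 1) \<^bold>\<and> App (Var 5) (Var 3) (Var 0) \<^bold>\<and> interp eq (is_opair 2 1 0))"
  have b: "holds w (p \<bullet> n \<bullet> h \<bullet> r \<bullet> Var) ?b \<longleftrightarrow>
      (\<exists>a y. App h n a \<in> w \<and> App r n y \<in> w \<and> opair_set w p a y)" if "world w" for w p n
    using that by (simp add: holds_opair_set)
  have "box w (\<lambda>w. \<forall>n. \<exists>p. VS p \<in> w \<and> holds w (p \<bullet> n \<bullet> h \<bullet> r \<bullet> Var) ?b)"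
  proof (rule boxI[of "\<lambda>w. numerals w h \<and> box w (\<lambda>w. \<forall>n. \<exists>y. App r n y \<in> w \<and> VS y \<in> w)"], goal_cases)
    case (4 w)
    then have w: "world w" and h: "numerals w h" by blast+
    show ?case
    proof
      fix n
      obtain y where y: "App r n y \<in> w" "VS y \<in> w" using 4 boxD[OF _ w] by blast
      obtain a where a: "App h n a \<in> w" using numerals_defined[OF w h] by blast
      obtain p where "VS p \<in> w" "opair_set w p a y"
        by (rule ex_opair_set[OF w numerals_VS[OF w h a] y(2)])
      then show "\<exists>p. VS p \<in> w \<and> holds w (p \<bullet> n \<bullet> h \<bullet> r \<bullet> Var) ?b" unfolding b[OF w] using a y by blast
    qed
  qed (use w h r in \<open>auto intro!: pers_intros\<close>)
  then obtain f where "VS f \<in> w" "box w (\<lambda>w. \<forall>n. \<exists>p. El f n p \<in> w \<and> holds w (p \<bullet> n \<bullet> h \<bullet> r \<bullet> Var) ?b)"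
    by (rule ex_v_set_enumerated[OF w])
  then have "graph_set w f h r" unfolding graph_set_def using r b by (simp cong: box_cong)
  then show ?thesis by (rule that)
qed

lemma opair_set_cong:
  assumes w: "world w" and "norm w p = norm w p'" "norm w a = norm w a'" "norm w y = norm w y'"
  shows "opair_set w p a y \<longleftrightarrow> opair_set w p' a' y'"
  using holds_cong2[OF assms(1,3,4), of "p \<bullet> Var" "interp eq (is_opair 2 0 1)"]
    holds_cong[OF assms(1,2), of "a' \<bullet> y' \<bullet> Var" "interp eq (is_opair 0 1 2)"] w
  by (simp add: holds_opair_set)

lemma graph_set_InEL:
  assumes w: "world w" and f: "graph_set w f h r" and p: "InEL p f \<in> w"
  obtains n a y where "App h n a \<in> w" "App r n y \<in> w" "VS y \<in> w" "opair_set w p a y"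
proof -
  obtain n where n: "El f n p \<in> w" using p InEL_iff[OF w] by blast
  obtain q a y where q: "El f n q \<in> w" "App h n a \<in> w" "App r n y \<in> w" "opair_set w q a y"
    using f boxD[OF _ w] unfolding graph_set_def by blast
  have "opair_set w p a y"
    using opair_set_cong[OF w El_functional[OF w n q(1)] refl refl] q(4) by blast
  moreover obtain y' where "App r n y' \<in> w" "VS y' \<in> w"
    using f boxD[OF _ w] unfolding graph_set_def by blast
  then have "VS y \<in> w" using App_functional[OF w q(3)] VS_cong[OF w] by blast
  ultimately show ?thesis using that q by blast
qed

lemma graph_set_maps:
  assumes w: "world w" and f: "graph_set w f h r" and a: "App h n a \<in> w" and y: "App r n y \<in> w"
  shows "maps w f a y"
proof -
  obtain q a' y' where q: "El f n q \<in> w" "App h n a' \<in> w" "App r n y' \<in> w" "opair_set w q a' y'"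
    using f boxD[OF _ w] unfolding graph_set_def by blast
  have "opair_set w q a y"
    using opair_set_cong[OF w refl App_functional[OF w a q(2)] App_functional[OF w y q(3)]] q(4) by blast
  then show ?thesis unfolding maps_def using q(1) InEL_iff[OF w] by blast
qed

text \<open>A pair in \<open>f\<close> sits at some index \<open>m\<close>. Injectivity of pairs
  makes the numerals at \<open>m\<close> and \<open>n\<close> equal, and injectivity of numerals
  gives \<open>m = n\<close>.\<close>

lemma graph_set_maps_ext:
  assumes w: "world w" and h: "numerals w h" and f: "graph_set w f h r"
    and a: "App h n a \<in> w" and y: "App r n y \<in> w" and b: "VS b \<in> w" and ab: "maps w f a b"
  shows "ext_eq w y b"
proof -
  obtain p where p: "InEL p f \<in> w" "opair_set w p a b" using ab unfolding maps_def by blast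
  obtain m c z where c: "App h m c \<in> w" "App r m z \<in> w" "VS z \<in> w" "opair_set w p c z"
    by (rule graph_set_InEL[OF w f p(1)])
  have "VS p \<in> w" using f VS_InEL[OF w _ p(1)] by (simp add: graph_set_def)
  then have eq: "ext_eq w c a \<and> ext_eq w z b"
    using opair_set_inject[OF w _ _ _ _ _ c(4) p(2)] numerals_VS[OF w h] c a b by blast
  then have "norm w m = norm w n" using numerals_inject[OF w h c(1) a] by blast
  then have "App r n z \<in> w" using c(2) App_cong[OF w refl _ refl] by blast
  then have "norm w y = norm w z" using App_functional[OF w y] by blast
  then show ?thesis using eq unfolding ext_eq_def using holds_cong[OF w] by blast
qed

lemma holds_is_function_on:
  assumes w: "world w" and W: "omega_set w W h" and f: "graph_set w f h r"
  shows "holds w (W \<bullet> f \<bullet> \<sigma>) (interp eq (is_function_on 1 0))"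
proof -
  have R: "pers (\<lambda>w. omega_set w W h \<and> graph_set w f h r)" by (intro pers_intros)
  have "box w (\<lambda>w. \<forall>p. InEL p f \<in> w \<longrightarrow> (\<exists>n. InEL n W \<in> w \<and> (\<exists>y. VS y \<in> w \<and> opair_set w p n y)))"
  proof (rule boxI[OF R _ w], goal_cases)
    case (2 w)
    then show ?case by (metis graph_set_InEL omega_set_InEL)
  qed (use W f in blast)
  moreover have "box w (\<lambda>w. \<forall>n. InEL n W \<in> w \<longrightarrow> (\<exists>y. VS y \<in> w \<and> maps w f n y) \<and>
    box w (\<lambda>w. \<forall>y. VS y \<in> w \<longrightarrow> box w (\<lambda>w. \<forall>y'. VS y' \<in> w \<longrightarrow>
      box w (\<lambda>w. maps w f n y \<and> maps w f n y' \<longrightarrow> ext_eq w y y'))))"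
  proof (rule boxI[OF R _ w], goal_cases)
    case (2 w)
    then have w: "world w" and W: "omega_set w W h" and f: "graph_set w f h r" by blast+
    note h = omega_set_numerals[OF W]
    show ?case
    proof (intro allI impI)
      fix n assume "InEL n W \<in> w"
      then obtain k where k: "App h k n \<in> w" using omega_set_InEL[OF w W] by blast
      obtain y where y: "App r k y \<in> w" "VS y \<in> w"
        using f boxD[OF _ w] unfolding graph_set_def by blast
      \<comment> \<open>Every value at \<open>n\<close> is compared with the fixed representative
        \<open>y\<close>; two values then agree through it.\<close>
      have "box w (\<lambda>w. \<forall>a. VS a \<in> w \<longrightarrow> maps w f n a \<longrightarrow> VS y \<in> w \<and> ext_eq w y a)"
        by (rule boxI[of "\<lambda>w. numerals w h \<and> graph_set w f h r \<and> App h k n \<in> w \<and> App r k y \<in> w \<and> VS y \<in> w"])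
          (use h f k y w graph_set_maps_ext in \<open>auto intro!: pers_intros\<close>)
      then have "box w (\<lambda>w. \<forall>a. VS a \<in> w \<longrightarrow> (\<forall>b. VS b \<in> w \<longrightarrow>
          maps w f n a \<and> maps w f n b \<longrightarrow> ext_eq w a b))" (is "box w ?P")
        by (rule box_mono) (meson ext_eq_sym ext_eq_trans)
      \<comment> \<open>Each of the two set quantifiers and the implication below them contributes
        its own box, and each is entered with the earlier assumptions carried along.\<close>
      then have "box w (\<lambda>w. \<forall>y. VS y \<in> w \<longrightarrow> box w (\<lambda>w. \<forall>y'. VS y' \<in> w \<longrightarrow>
        box w (\<lambda>w. maps w f n y \<and> maps w f n y' \<longrightarrow> ext_eq w y y')))"
      proof (rule boxI[OF pers_box _ w], intro allI impI, goal_cases)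
        case (1 w a)
        show ?case
        proof (rule boxI[of "\<lambda>w. VS a \<in> w \<and> box w ?P"], goal_cases)
          case (4 w)
          show ?case
          proof (intro allI impI)
            fix b assume b: "VS b \<in> w"
            show "box w (\<lambda>w. maps w f n a \<and> maps w f n b \<longrightarrow> ext_eq w a b)"
              by (rule boxI[of "\<lambda>w. VS a \<in> w \<and> VS b \<in> w \<and> box w ?P"])
                (use 4 b boxD in \<open>auto intro!: pers_intros\<close>)
          qed
        qed (use 1 in \<open>auto intro!: pers_intros\<close>)
      qed
      then show "(\<exists>y. VS y \<in> w \<and> maps w f n y) \<and> box w (\<lambda>w. \<forall>y. VS y \<in> w \<longrightarrow>
        box w (\<lambda>w. \<forall>y'. VS y' \<in> w \<longrightarrow> box w (\<lambda>w. maps w f n y \<and> maps w f n y' \<longrightarrow> ext_eq w y y')))"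
        using y graph_set_maps[OF w f k] by blast
    qed
  qed (use W f in blast)
  ultimately show ?thesis
    using w by (simp add: is_function_on_def holds_opair_set holds_maps holds_Uni_Impl holds_Impl)
qed

section \<open>Relativised dependent choices\<close>

text \<open>The iterated objects are pairs of a v-set and a realizer of \<Phi> for it, because
  Church's thesis can use the truth of \<Phi> only through a realizer given as part of the
  input.\<close>

lemma rdc_sequence:
  assumes w: "world w" and x: "VS x \<in> w" "holds w (x \<bullet> \<sigma>) \<Phi>"
    and hyp: "box w (\<lambda>w. \<forall>x. VS x \<in> w \<longrightarrow> box w (\<lambda>w. holds w (x \<bullet> \<sigma>) \<Phi> \<longrightarrow>
      (\<exists>y. VS y \<in> w \<and> holds w (y \<bullet> \<sigma>) \<Phi> \<and> holds w (x \<bullet> y \<bullet> \<sigma>) \<psi>)))"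
  obtains r where "App r Zero x \<in> w"
    "box w (\<lambda>w. \<forall>k. \<exists>y y'. App r k y \<in> w \<and> App r (Succ k) y' \<in> w \<and> VS y \<in> w \<and>
      holds w (y \<bullet> \<sigma>) \<Phi> \<and> holds w (y \<bullet> y' \<bullet> \<sigma>) \<psi>)"
proof -
  obtain \<rho> where \<rho>: "almost_neg \<rho>"
    "\<And>w \<sigma>. world w \<Longrightarrow> holds w \<sigma> \<Phi> \<longleftrightarrow> (\<exists>e. holds w (e \<bullet> \<sigma>) \<rho>)"
    using realizer[of \<Phi>] by blast
  define A where "A = VS (Lft (Var 0)) \<^bold>\<and> sub [Rgt (Var 0), Lft (Var 0)] 1 \<rho>"
  \<comment> \<open>Variable 0 is the new pair and variable 1 the old one, while \<psi> expects the
    old set first.\<close>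
  define B where "B = sub [Lft (Var 1), Lft (Var 0)] 2 \<psi>"
  have A: "holds w (p \<bullet> \<sigma>) A \<longleftrightarrow> VS (Lft p) \<in> w \<and> holds w (Rgt p \<bullet> Lft p \<bullet> \<sigma>) \<rho>" if "world w" for w p
    using that by (simp add: A_def)
  have B: "holds w (q \<bullet> p \<bullet> \<sigma>) B \<longleftrightarrow> holds w (Lft p \<bullet> Lft q \<bullet> \<sigma>) \<psi>" for w p q
    by (simp add: B_def)
  have A_Pair: "holds w (Pair y e \<bullet> \<sigma>) A"
    if w: "world w" and y: "VS y \<in> w" "holds w (e \<bullet> y \<bullet> \<sigma>) \<rho>" for w y e
  proof -
    have *: "norm w (Lft (Pair y e)) = norm w y" "norm w (Rgt (Pair y e)) = norm w e" using w by simp_all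
    show ?thesis unfolding A[OF w] using VS_cong[OF w *(1)] holds_cong2[OF w *(2,1)] y by blast
  qed
  obtain e where "holds w (e \<bullet> x \<bullet> \<sigma>) \<rho>" using x \<rho>(2)[OF w] by blast
  then have init: "holds w (Pair x e \<bullet> \<sigma>) A" using A_Pair[OF w x(1)] by blast
  have "almost_neg A" unfolding A_def using \<rho>(1) by (intro almost_neg_intros)
  moreover note init
  moreover have "box w (\<lambda>w. \<forall>p. holds w (p \<bullet> \<sigma>) A \<longrightarrow>
      (\<exists>q. holds w (q \<bullet> \<sigma>) A \<and> holds w (q \<bullet> p \<bullet> \<sigma>) B))"
  proof (rule box_mono[OF hyp], intro allI impI)
    fix w p assume w: "world w" and p: "holds w (p \<bullet> \<sigma>) A"
      and hyp: "\<forall>x. VS x \<in> w \<longrightarrow> box w (\<lambda>w. holds w (x \<bullet> \<sigma>) \<Phi> \<longrightarrow>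
      (\<exists>y. VS y \<in> w \<and> holds w (y \<bullet> \<sigma>) \<Phi> \<and> holds w (x \<bullet> y \<bullet> \<sigma>) \<psi>))"
    have "VS (Lft p) \<in> w" "holds w (Lft p \<bullet> \<sigma>) \<Phi>" using p \<rho>(2)[OF w] unfolding A[OF w] by blast+
    then obtain y where y: "VS y \<in> w" "holds w (y \<bullet> \<sigma>) \<Phi>" "holds w (Lft p \<bullet> y \<bullet> \<sigma>) \<psi>"
      using hyp boxD[OF _ w] by blast
    then obtain e where "holds w (e \<bullet> y \<bullet> \<sigma>) \<rho>" using \<rho>(2)[OF w] by blast
    then have "holds w (Pair y e \<bullet> \<sigma>) A" using A_Pair[OF w y(1)] by blast
    moreover have "norm w y = norm w (Lft (Pair y e))" using w by simp
    then have "holds w (Pair y e \<bullet> p \<bullet> \<sigma>) B" unfolding B using y(3) holds_cong2[OF w refl] by blast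
    ultimately show "\<exists>q. holds w (q \<bullet> \<sigma>) A \<and> holds w (q \<bullet> p \<bullet> \<sigma>) B" by blast
  qed
  ultimately obtain s where s: "App s Zero (Pair x e) \<in> w"
    "box w (\<lambda>w. \<forall>k. \<exists>p q. App s k p \<in> w \<and> App s (Succ k) q \<in> w \<and>
       holds w (p \<bullet> \<sigma>) A \<and> holds w (q \<bullet> \<sigma>) A \<and> holds w (q \<bullet> p \<bullet> \<sigma>) B)"
    by (rule number_rdc[OF w])
  \<comment> \<open>The realizers are discarded by one more application of Church's thesis, which
    replaces an explicit index for the composition with the left projection.\<close>
  let ?b = "\<^bold>\<exists> (App (Var 3) (Var 2) (Var 0) \<^bold>\<and> Var 1 \<^bold>= Lft (Var 0))"
  have b: "holds w (m \<bullet> n \<bullet> s \<bullet> Var) ?b \<longleftrightarrow> (\<exists>p. App s n p \<in> w \<and> norm w m = norm w (Lft p))"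
    if "world w" for w m n using that by simp
  have "box w (\<lambda>w. \<forall>n. \<exists>m. holds w (m \<bullet> n \<bullet> s \<bullet> Var) ?b)"
    using s(2) by (rule box_mono) (unfold b, blast)
  then obtain r where r: "box w (\<lambda>w. \<forall>n. \<exists>m. App r n m \<in> w \<and> holds w (m \<bullet> n \<bullet> s \<bullet> Var) ?b)"
    by (rule ECT_total[OF w])
  have rs: "App r n (Lft p) \<in> w" if w: "world w" and p: "App s n p \<in> w"
    and r: "\<forall>n. \<exists>m. App r n m \<in> w \<and> holds w (m \<bullet> n \<bullet> s \<bullet> Var) ?b" for w n p
  proof -
    obtain m p' where m: "App r n m \<in> w" "App s n p' \<in> w" "norm w m = norm w (Lft p')"
      using r b[OF w] by blast
    have "norm w m = norm w (Lft p)"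
      using m(3) norm_Fn1_cong[OF w App_functional[OF w p m(2)]] by metis
    then show ?thesis using m(1) App_cong[OF w refl refl] by blast
  qed
  have "App r Zero (Lft (Pair x e)) \<in> w" using rs[OF w s(1) boxD[OF r w]] .
  moreover have "norm w (Lft (Pair x e)) = norm w x" using w by simp
  ultimately have "App r Zero x \<in> w" using App_cong[OF w refl refl] by blast
  moreover have "box w (\<lambda>w. \<forall>k. \<exists>y y'. App r k y \<in> w \<and> App r (Succ k) y' \<in> w \<and> VS y \<in> w \<and>
      holds w (y \<bullet> \<sigma>) \<Phi> \<and> holds w (y \<bullet> y' \<bullet> \<sigma>) \<psi>)"
  proof (rule box_mono[OF iffD2[OF box_conj conjI[OF s(2) r]]], intro allI, elim conjE)
    fix w k assume w: "world w" and r: "\<forall>n. \<exists>m. App r n m \<in> w \<and> holds w (m \<bullet> n \<bullet> s \<bullet> Var) ?b"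
      and "\<forall>k. \<exists>p q. App s k p \<in> w \<and> App s (Succ k) q \<in> w \<and>
       holds w (p \<bullet> \<sigma>) A \<and> holds w (q \<bullet> \<sigma>) A \<and> holds w (q \<bullet> p \<bullet> \<sigma>) B"
    then obtain p q where pq: "App s k p \<in> w" "App s (Succ k) q \<in> w" "holds w (p \<bullet> \<sigma>) A"
      "holds w (q \<bullet> p \<bullet> \<sigma>) B" by blast
    then show "\<exists>y y'. App r k y \<in> w \<and> App r (Succ k) y' \<in> w \<and> VS y \<in> w \<and>
      holds w (y \<bullet> \<sigma>) \<Phi> \<and> holds w (y \<bullet> y' \<bullet> \<sigma>) \<psi>"
      using rs[OF w pq(1) r] rs[OF w pq(2) r] \<rho>(2)[OF w] unfolding A[OF w] B by blast
  qed
  ultimately show ?thesis by (rule that)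
qed

text \<open>Together with \<open>rdc_steps\<close>, names for the two last conjuncts of
  \<open>rdc_concl\<close>, so that each can be verified separately.\<close>

definition rdc_values :: "sfm \<Rightarrow> fm" where
  "rdc_values \<phi> = \<^bold>\<forall> \<^bold>\<forall> (El (Var 3) (Var 1) (Var 0) \<^bold>\<longrightarrow>
     \<^bold>\<exists> (App (Var 3) (Var 2) (Var 0) \<^bold>\<and> VS (Var 0) \<^bold>\<and> interp eq (maps_to 5 1 0) \<^bold>\<and>
       sub [Var 0] 7 (interp eq \<phi>) \<^bold>\<and> interp eq (SImpl (is_empty 1) (SEq 0 6))))"

definition rdc_steps :: "fm \<Rightarrow> fm" where
  "rdc_steps \<psi> = \<^bold>\<forall> \<^bold>\<forall> \<^bold>\<forall> \<^bold>\<forall> (El (Var 5) (Var 3) (Var 2) \<^bold>\<and> El (Var 5) (Var 1) (Var 0) \<^bold>\<and>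
     interp eq (is_succ 0 2) \<^bold>\<longrightarrow>
     \<^bold>\<exists> \<^bold>\<exists> (App (Var 6) (Var 5) (Var 1) \<^bold>\<and> App (Var 6) (Var 3) (Var 0) \<^bold>\<and> sub [Var 1, Var 0] 10 \<psi>))"

lemma holds_rdc_values:
  assumes w: "world w" and W: "omega_set w W h" and f: "graph_set w f h r"
    and x: "VS x \<in> w" "App r Zero x \<in> w"
    and r: "box w (\<lambda>w. \<forall>k. \<exists>y y'. App r k y \<in> w \<and> App r (Succ k) y' \<in> w \<and> VS y \<in> w \<and>
      holds w (y \<bullet> \<sigma>) (interp eq \<phi>) \<and> holds w (y \<bullet> y' \<bullet> \<sigma>) \<psi>)" (is "box w ?r")
  shows "holds w (r \<bullet> W \<bullet> f \<bullet> x \<bullet> \<sigma>) (rdc_values \<phi>)"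
proof -
  have "box w (\<lambda>w. \<forall>k n. El W k n \<in> w \<longrightarrow> (\<exists>y. App r k y \<in> w \<and> VS y \<in> w \<and> maps w f n y \<and>
    holds w (y \<bullet> \<sigma>) (interp eq \<phi>) \<and> box w (\<lambda>w. empty_set w n \<longrightarrow> ext_eq w y x)))"
  proof (rule boxI[of "\<lambda>w. omega_set w W h \<and> graph_set w f h r \<and> VS x \<in> w \<and> App r Zero x \<in> w \<and> box w ?r"],
      goal_cases)
    case (4 w)
    then have w: "world w" and W: "omega_set w W h" and f: "graph_set w f h r" and x: "VS x \<in> w"
      and r0: "App r Zero x \<in> w" and r: "?r w" using boxD by blast+
    show ?case
    proof (intro allI impI)
      fix k n assume "El W k n \<in> w"
      then have k: "App h k n \<in> w" using omega_set_El[OF w W] by blast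
      obtain y where y: "App r k y \<in> w" "VS y \<in> w" "holds w (y \<bullet> \<sigma>) (interp eq \<phi>)" using r by blast
      \<comment> \<open>An empty \<open>n\<close> equals the numeral at zero, so injectivity gives
        \<open>k = 0\<close>, and the value there is \<open>x\<close>.\<close>
      have "box w (\<lambda>w. empty_set w n \<longrightarrow> ext_eq w y x)"
      proof (rule boxI[of "\<lambda>w. omega_set w W h \<and> VS x \<in> w \<and> App h k n \<in> w \<and> App r k y \<in> w \<and> App r Zero x \<in> w"],
          goal_cases)
        case (4 w)
        then have w: "world w" and h: "numerals w h" using omega_set_numerals by blast+
        show ?case
        proof
          assume n: "empty_set w n"
          obtain z where z: "App h Zero z \<in> w" "empty_set w z" using h unfolding numerals_def by blast
          have "ext_eq w n z" using empty_set_unique[OF w _ _ n z(2)] numerals_VS[OF w h] z 4 by blast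
          then have "norm w k = norm w Zero" using numerals_inject[OF w h _ z(1)] 4 by blast
          then have "App r Zero y \<in> w" using App_cong[OF w refl _ refl] 4 by blast
          then have "norm w y = norm w x" using App_functional[OF w] 4 by blast
          moreover have "ext_eq w x x" using ext_eq_refl[OF w] 4 by blast
          ultimately show "ext_eq w y x" unfolding ext_eq_def using holds_cong[OF w] by blast
        qed
      qed (use w W x r0 k y in \<open>auto intro!: pers_intros\<close>)
      then show "\<exists>y. App r k y \<in> w \<and> VS y \<in> w \<and> maps w f n y \<and>
        holds w (y \<bullet> \<sigma>) (interp eq \<phi>) \<and> box w (\<lambda>w. empty_set w n \<longrightarrow> ext_eq w y x)"
        using y graph_set_maps[OF w f k] by blast
    qed
  qed (use w W f x r in \<open>auto intro!: pers_intros\<close>)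
  then show ?thesis
    using w by (simp add: rdc_values_def holds_Uni2_Impl holds_maps holds_Impl holds_interp(3))
qed

text \<open>From \<open>n'\<close> being a successor of \<open>n\<close> only equality with the
  numeral at \<open>k + 1\<close> follows; injectivity turns this into \<open>k' = k + 1\<close>, so
  \<psi> is needed only for consecutive values of \<open>r\<close>.\<close>

lemma holds_rdc_steps:
  assumes w: "world w" and W: "omega_set w W h"
    and r: "box w (\<lambda>w. \<forall>k. \<exists>y y'. App r k y \<in> w \<and> App r (Succ k) y' \<in> w \<and> VS y \<in> w \<and>
      holds w (y \<bullet> \<sigma>) \<Phi> \<and> holds w (y \<bullet> y' \<bullet> \<sigma>) \<psi>)" (is "box w ?r")
  shows "holds w (r \<bullet> W \<bullet> f \<bullet> x \<bullet> \<sigma>) (rdc_steps \<psi>)"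
proof -
  have "box w (\<lambda>w. \<forall>k n k' n'. El W k n \<in> w \<and> El W k' n' \<in> w \<and> succ_set w n' n \<longrightarrow>
    (\<exists>y y'. App r k y \<in> w \<and> App r k' y' \<in> w \<and> holds w (y \<bullet> y' \<bullet> \<sigma>) \<psi>))"
  proof (rule boxI[of "\<lambda>w. omega_set w W h \<and> box w ?r"], goal_cases)
    case (4 w)
    then have w: "world w" and W: "omega_set w W h" and r: "?r w" using boxD by blast+
    note h = omega_set_numerals[OF W]
    show ?case
    proof (intro allI impI)
      fix k n k' n' assume *: "El W k n \<in> w \<and> El W k' n' \<in> w \<and> succ_set w n' n"
      then have k: "App h k n \<in> w" "App h k' n' \<in> w" using omega_set_El[OF w W] by blast+
      obtain m where m: "App h (Succ k) m \<in> w" using numerals_defined[OF w h] by blast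
      have v: "VS n \<in> w" "VS n' \<in> w" "VS m \<in> w" using numerals_VS[OF w h] k m by blast+
      have "ext_eq w m n'"
        using succ_set_unique[OF w v(3,1,2,1) numerals_succ[OF w h k(1) m] _ ext_eq_refl[OF w v(1)]] *
        by blast
      then have "norm w (Succ k) = norm w k'" using numerals_inject[OF w h m k(2)] by blast
      moreover obtain y y' where "App r k y \<in> w" "App r (Succ k) y' \<in> w" "holds w (y \<bullet> y' \<bullet> \<sigma>) \<psi>"
        using r by blast
      ultimately show "\<exists>y y'. App r k y \<in> w \<and> App r k' y' \<in> w \<and> holds w (y \<bullet> y' \<bullet> \<sigma>) \<psi>"
        using App_cong[OF w refl _ refl] by blast
    qed
  qed (use w W r in \<open>auto intro!: pers_intros\<close>)
  then show ?thesis
    using w by (simp add: rdc_steps_def holds_Uni2_Impl holds_Uni[of _ _ "Uni (Uni (Uni _))"]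
      holds_Uni[of _ _ "Uni (Uni _)"] box_all_box holds_succ_set)
qed

lemma rdc_world:
  assumes w: "world w" and hyp: "rdc_hyp eq \<phi> \<psi> \<in> w"
  shows "rdc_concl eq \<phi> \<psi> \<in> w"
proof -
  let ?hyp = "\<lambda>w. box w (\<lambda>w. \<forall>x. VS x \<in> w \<longrightarrow> box w (\<lambda>w. holds w (x \<bullet> Var) (interp eq \<phi>) \<longrightarrow>
      (\<exists>y. VS y \<in> w \<and> holds w (y \<bullet> Var) (interp eq \<phi>) \<and> holds w (x \<bullet> y \<bullet> Var) \<psi>)))"
  let ?c = "\<^bold>\<exists> (VS (Var 0) \<^bold>\<and> \<^bold>\<exists> (VS (Var 0) \<^bold>\<and>
         interp eq (is_omega 0) \<^bold>\<and> interp eq (is_function_on 1 0) \<^bold>\<and>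
         \<^bold>\<exists> (rdc_values \<phi> \<^bold>\<and> rdc_steps \<psi>)))"
  have hyp: "?hyp w"
    using hyp w unfolding holds_Var[symmetric] rdc_hyp_def
    by (simp add: holds_Uni_Impl holds_Impl)
  have core: "holds w (x \<bullet> Var) ?c"
    if w: "world w" and hyp: "?hyp w" and x: "VS x \<in> w" "holds w (x \<bullet> Var) (interp eq \<phi>)" for w x
  proof -
    obtain r where r: "App r Zero x \<in> w"
      "box w (\<lambda>w. \<forall>k. \<exists>y y'. App r k y \<in> w \<and> App r (Succ k) y' \<in> w \<and> VS y \<in> w \<and>
        holds w (y \<bullet> Var) (interp eq \<phi>) \<and> holds w (y \<bullet> y' \<bullet> Var) \<psi>)"
      by (rule rdc_sequence[OF w x hyp])
    obtain h where h: "numerals w h" by (rule ex_numerals[OF w])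
    obtain W where W: "omega_set w W h" by (rule ex_omega_set[OF w h])
    \<comment> \<open>Totality of \<open>r\<close> with v-sets as values is all that the
      construction of the graph requires.\<close>
    have "box w (\<lambda>w. \<forall>n. \<exists>y. App r n y \<in> w \<and> VS y \<in> w)" using r(2) by (rule box_mono) blast
    then obtain f where f: "graph_set w f h r" by (rule ex_graph_set[OF w h])
    have "VS f \<in> w" "VS W \<in> w" using f W by (simp_all add: graph_set_def omega_set_def)
    then show ?thesis
      using holds_is_omega[OF w W, of "f \<bullet> x \<bullet> Var"] holds_is_function_on[OF w W f, of "x \<bullet> Var"]
        holds_rdc_values[OF w W f x(1) r] holds_rdc_steps[OF w W r(2), of f x] w
      by simp blast
  qed
  have "box w (\<lambda>w. \<forall>x. holds w (x \<bullet> Var) (VS (Var 0)) \<longrightarrow>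
      holds w (x \<bullet> Var) (interp eq \<phi> \<^bold>\<longrightarrow> ?c))"
  proof (rule boxI[OF pers_box hyp w], intro allI impI)
    fix w x assume w: "world w" and hyp: "?hyp w" and "holds w (x \<bullet> Var) (VS (Var 0))"
    then have x: "VS x \<in> w" by simp
    show "holds w (x \<bullet> Var) (interp eq \<phi> \<^bold>\<longrightarrow> ?c)"
      unfolding holds_Impl[OF w]
    proof (rule boxI[of "\<lambda>w. ?hyp w \<and> VS x \<in> w"], goal_cases)
      case (4 w)
      then show ?case using core by blast
    qed (use w hyp x in \<open>auto intro!: pers_intros\<close>)
  qed
  then have "holds w Var (\<^bold>\<forall> (VS (Var 0) \<^bold>\<longrightarrow> interp eq \<phi> \<^bold>\<longrightarrow> ?c))" unfolding holds_Uni_Impl[OF w] .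
  then show ?thesis unfolding holds_Var rdc_concl_def rdc_values_def rdc_steps_def .
qed

end

theorem theorem12:
  fixes \<xi> :: prim and eq \<psi> :: fm and \<phi> :: sfm
  assumes "has_arity 2 \<xi>"
    and "\<And>a b c d. prim_eval \<xi> [a, b] = prim_eval \<xi> [c, d] \<Longrightarrow> a = c \<and> b = d"
    and "ext_equality \<xi> eq"
  shows "prv \<xi> (set_params \<phi>) (rdc_hyp eq \<phi> \<psi> \<^bold>\<longrightarrow> rdc_concl eq \<phi> \<psi>)"
proof -
  interpret vset_model \<xi> eq by unfold_locales (rule assms(3))
  have "prv \<xi> {} (rdc_hyp eq \<phi> \<psi> \<^bold>\<longrightarrow> rdc_concl eq \<phi> \<psi>)"
  \<comment> \<open>Completeness reduces the derivation to membership in every world.\<close>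
  proof (rule prv_if_worlds)
    fix w assume w: "world w"
    show "(rdc_hyp eq \<phi> \<psi> \<^bold>\<longrightarrow> rdc_concl eq \<phi> \<psi>) \<in> w"
      unfolding world_Impl[OF w] by (rule box_necessitation) (blast intro: rdc_world)
  qed simp
  then show ?thesis by (rule prv_weaken) simp
qed

end
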